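(* Let $T$ be a semistandard hook-valued tableau, $i\ge1$, and $\mathcal U(T)=(P(T),Q(T))$. (1) If $f_i(T)\neq0$, then $f_i(P(T))=P(f_i(T))$ and $Q(T)=Q(f_i(T))$. (2) If $e_i(T)\neq0$, then $e_i(P(T))=P(e_i(T))$ and $Q(T)=Q(e_i(T))$.
   Context: French notation: row $1$ is the bottom row, rows numbered upward, columns left to right; cell $(r,c)$ is in row $r$, column $c$. A semistandard tableau of hook shape $U$ consists of a hook entry $x$, a leg $\ell_1<\dots<\ell_p$ above $x$ with $x<\ell_1$, and an arm $a_1\le\dots\le a_q$ to the right of $x$ with $x\le a_1$ ($p,q\ge0$, positive integers); $\mathsf L(U)$ is the leg, $\mathsf L^+(U)=(x,\ell_1,\dots,\ell_p)$ the extended leg, $\mathsf A(U)$ the arm. A (semistandard) hook-valued tableau (HVT) of partition shape $\lambda$ is a filling of the cells of $\lambda$ by such hook tableaux with $\max(A)\le\min(B)$ whenever the cell of $A$ is left of that of $B$ in the same row, and $\max(A)<\min(C)$ whenever the cell of $A$ is below that of $C$ in the same column. Arm excess = total number of arm entries; set-valued tableaux are HVT with arm excess $0$. Crystal operators: the column reading word $R(T)$ reads, for each column from left to right, the extended legs of its cells (cells top to bottom, each extended leg from top to bottom), followed by all arm entries of that column in weakly increasing order. Assign $-$ to each $i$ and $+$ to each $i+1$ in $R(T)$, and successively pair a $+$ that is adjacent to and left of a $-$, removing paired signs, until no more pairs. If there is no unpaired $-$, $f_i(T)=0$. Otherwise let $B$ be the cell containing the $i$ of the rightmost unpaired $-$.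 (M) If the cell $B^\uparrow$ above $B$ contains an $i+1$, $f_i$ removes an $i$ from $\mathsf A(B)$ and adds $i+1$ to $\mathsf A(B^\uparrow)$. (S) Otherwise, if the cell $B^\rightarrow$ right of $B$ contains an $i$ in $\mathsf L^+(B^\rightarrow)$, $f_i$ removes this $i$ from $\mathsf L^+(B^\rightarrow)$ and adds $i+1$ to $\mathsf L(B)$. (N) Otherwise $f_i$ changes that $i$ into $i+1$. If there is no unpaired $+$, $e_i(T)=0$; otherwise let $B$ be the cell containing the $i+1$ of the leftmost unpaired $+$. (M) If the cell $B^\downarrow$ below $B$ contains an $i$, $e_i$ removes the $i+1$ from $\mathsf A(B)$ and adds $i$ to $\mathsf A(B^\downarrow)$. (S) Otherwise, if the cell $B^\leftarrow$ left of $B$ contains an $i+1$ in $\mathsf L(B^\leftarrow)$, $e_i$ removes it and adds $i$ to $\mathsf L^+(B)$. (N) Otherwise $e_i$ changes that $i+1$ into $i$. Uncrowding bumping $\mathcal V_b$: if arm excess of $T$ is $0$, $\mathcal V_b(T)=T$. Otherwise let $c$ be the largest index of a column containing a cell with nonempty arm; among such cells in column $c$ let $(r,c)$ be the one whose arm contains the largest value. Let $a$ be the largest arm entry of $(r,c)$, $\ell$ its largest leg entry, and $(a,\ell]\cap\mathsf L_T(r,c)$ the set of leg entries $x$ of $(r,c)$ with $a<x\le\ell$. In column $c+1$ find the smallest entry $\ge a$. If none exists, attach a new empty cell on top of column $c+1$, with row $\tilde r$, and let $k$ be empty; otherwise let $k$ be this entry and $(\tilde r,c+1)$ its cell. (a)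 If $\tilde r\ne r$: remove $a$ from the arm of $(r,c)$, put $a$ in the position of $k$ in $(\tilde r,c+1)$ (as hook entry if the cell is new), append $k$ (if nonempty) to the arm of $(\tilde r,c+1)$. (b) If $\tilde r=r$: move $(a,\ell]\cap\mathsf L_T(r,c)$ from the leg of $(r,c)$ into the leg of $(r,c+1)$, remove $a$ from the arm of $(r,c)$, replace the hook entry of $(r,c+1)$ by $a$, append $k$ (if nonempty) to the arm of $(r,c+1)$. Uncrowding insertion: $\mathcal V(T)=\mathcal V_b^d(T)$, $d\ge1$ minimal such that $\mathsf{shape}(\mathcal V_b^d(T))\neq\mathsf{shape}(\mathcal V_b^{d-1}(T))$ or $\mathcal V_b^d(T)=\mathcal V_b^{d-1}(T)$. Uncrowding map: for $T\in\mathsf{HVT}(\lambda)$ with arm excess $\alpha$, set $P_0=T$, $Q_0$ the empty tableau of shape $\lambda/\lambda$; for $1\le i\le\alpha$ let $P_i=\mathcal V(P_{i-1})$, let $c$ be the index of the rightmost column of $P_{i-1}$ containing a cell with nonzero arm excess and $\tilde c$ the column of the cell $\mathsf{shape}(P_i)/\mathsf{shape}(P_{i-1})$; $Q_i$ is $Q_{i-1}$ with this cell added and filled with $\tilde c-c$. $\mathcal U(T)=(P(T),Q(T)):=(P_\alpha,Q_\alpha)$. *)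

theory Defs
  imports Main
begin

text \<open>A hook tableau is encoded as a pair (extended leg, arm):
  the extended leg is the strictly increasing list (x, l1, ..., lp) whose head is the
  hook entry x and whose tail is the leg; the arm is the weakly increasing list
  (a1, ..., aq).  A (hook-valued) tableau is a partial map from cells (row, column),
  rows and columns numbered from 1 (row 1 = bottom row), to hook tableaux.\<close>

type_synonym hook = "nat list \<times> nat list"
type_synonym hvt = "nat \<times> nat \<Rightarrow> hook option"

definition xleg :: "hvt \<Rightarrow> nat \<times> nat \<Rightarrow> nat list" where
  "xleg T p = (case T p of None \<Rightarrow> [] | Some h \<Rightarrow> fst h)"

definition arm :: "hvt \<Rightarrow> nat \<times> nat \<Rightarrow> nat list" where
  "arm T p = (case T p of None \<Rightarrow> [] | Some h \<Rightarrow> snd h)"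

definition entries :: "hvt \<Rightarrow> nat \<times> nat \<Rightarrow> nat set" where
  "entries T p = set (xleg T p) \<union> set (arm T p)"

definition is_hook :: "hook \<Rightarrow> bool" where
  "is_hook h \<longleftrightarrow> fst h \<noteq> [] \<and> sorted_wrt (<) (fst h) \<and> sorted (snd h)
     \<and> (\<forall>v \<in> set (fst h) \<union> set (snd h). 0 < v)
     \<and> (\<forall>a \<in> set (snd h). hd (fst h) \<le> a)"

definition hmax :: "hook \<Rightarrow> nat" where
  "hmax h = Max (set (fst h) \<union> set (snd h))"

definition hmin :: "hook \<Rightarrow> nat" where
  "hmin h = Min (set (fst h) \<union> set (snd h))"

definition is_shape :: "(nat \<times> nat) set \<Rightarrow> bool" where
  "is_shape S \<longleftrightarrow> finite S \<and> (\<forall>(r, c) \<in> S. 1 \<le> r \<and> 1 \<le> c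
       \<and> (1 < r \<longrightarrow> (r - 1, c) \<in> S) \<and> (1 < c \<longrightarrow> (r, c - 1) \<in> S))"

definition is_hvt :: "hvt \<Rightarrow> bool" where
  "is_hvt T \<longleftrightarrow> is_shape (dom T)
     \<and> (\<forall>p h. T p = Some h \<longrightarrow> is_hook h)
     \<and> (\<forall>r c c' A B. T (r, c) = Some A \<longrightarrow> T (r, c') = Some B \<longrightarrow> c < c' \<longrightarrow> hmax A \<le> hmin B)
     \<and> (\<forall>r r' c A C. T (r, c) = Some A \<longrightarrow> T (r', c) = Some C \<longrightarrow> r < r' \<longrightarrow> hmax A < hmin C)"

definition ncols :: "hvt \<Rightarrow> nat" where
  "ncols T = (if dom T = {} then 0 else Max (snd ` dom T))"

definition colheight :: "hvt \<Rightarrow> nat \<Rightarrow> nat" where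
  "colheight T c = card {r. (r, c) \<in> dom T}"

definition col_word :: "hvt \<Rightarrow> nat \<Rightarrow> (nat \<times> (nat \<times> nat) \<times> bool) list" where
  "col_word T c =
     concat (map (\<lambda>r. map (\<lambda>v. (v, (r, c), False)) (rev (xleg T (r, c))))
                 (rev [1..<colheight T c + 1]))
     @ sort_key fst (concat (map (\<lambda>r. map (\<lambda>v. (v, (r, c), True)) (arm T (r, c)))
                                 [1..<colheight T c + 1]))"

definition reading_word :: "hvt \<Rightarrow> (nat \<times> (nat \<times> nat) \<times> bool) list" where
  "reading_word T = concat (map (col_word T) [1..<ncols T + 1])"

text \<open>Signs: (position in the word, True for '+' (letter i+1), False for '-' (letter i)).
  One pairing step removes the leftmost adjacent pair '+' followed by '-'.\<close>

fun cancel_once :: "(nat \<times> bool) list \<Rightarrow> (nat \<times> bool) list option" where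
  "cancel_once (x # y # zs) =
     (if snd x \<and> \<not> snd y then Some zs else map_option (Cons x) (cancel_once (y # zs)))"
| "cancel_once xs = None"

definition reduce_signs :: "(nat \<times> bool) list \<Rightarrow> (nat \<times> bool) list" where
  "reduce_signs xs =
     ((\<lambda>ys. case cancel_once ys of None \<Rightarrow> ys | Some zs \<Rightarrow> zs) ^^ length xs) xs"

definition signs :: "nat \<Rightarrow> (nat \<times> (nat \<times> nat) \<times> bool) list \<Rightarrow> (nat \<times> bool) list" where
  "signs i w = [(j, fst (w ! j) = Suc i). j \<leftarrow> [0..<length w], fst (w ! j) = i \<or> fst (w ! j) = Suc i]"

definition unpaired :: "nat \<Rightarrow> hvt \<Rightarrow> (nat \<times> bool) list" where
  "unpaired i T = reduce_signs (signs i (reading_word T))"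

section \<open>Crystal operators (None represents 0)\<close>

definition f_op :: "nat \<Rightarrow> hvt \<Rightarrow> hvt option" where
  "f_op i T =
    (let w = reading_word T; ms = filter (\<lambda>x. \<not> snd x) (unpaired i T) in
     if ms = [] then None else
     (case w ! fst (last ms) of (v, (r, c), isarm) \<Rightarrow>
       if Suc i \<in> entries T (Suc r, c) then
         Some (T((r, c) := Some (xleg T (r, c), remove1 i (arm T (r, c))),
                 (Suc r, c) := Some (xleg T (Suc r, c), insort (Suc i) (arm T (Suc r, c)))))
       else if i \<in> set (xleg T (r, Suc c)) then
         Some (T((r, Suc c) := Some (remove1 i (xleg T (r, Suc c)), arm T (r, Suc c)),
                 (r, c) := Some (insort (Suc i) (xleg T (r, c)), arm T (r, c))))
       else if isarm then
         Some (T((r, c) := Some (xleg T (r, c), insort (Suc i) (remove1 i (arm T (r, c))))))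
       else
         Some (T((r, c) := Some (insort (Suc i) (remove1 i (xleg T (r, c))), arm T (r, c))))))"

definition e_op :: "nat \<Rightarrow> hvt \<Rightarrow> hvt option" where
  "e_op i T =
    (let w = reading_word T; ps = filter snd (unpaired i T) in
     if ps = [] then None else
     (case w ! fst (hd ps) of (v, (r, c), isarm) \<Rightarrow>
       if 1 < r \<and> i \<in> entries T (r - 1, c) then
         Some (T((r, c) := Some (xleg T (r, c), remove1 (Suc i) (arm T (r, c))),
                 (r - 1, c) := Some (xleg T (r - 1, c), insort i (arm T (r - 1, c)))))
       else if 1 < c \<and> Suc i \<in> set (tl (xleg T (r, c - 1))) then
         Some (T((r, c - 1) := Some (remove1 (Suc i) (xleg T (r, c - 1)), arm T (r, c - 1)),
                 (r, c) := Some (insort i (xleg T (r, c)), arm T (r, c))))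
       else if isarm then
         Some (T((r, c) := Some (xleg T (r, c), insort i (remove1 (Suc i) (arm T (r, c))))))
       else
         Some (T((r, c) := Some (insort i (remove1 (Suc i) (xleg T (r, c))), arm T (r, c))))))"

definition arm_excess :: "hvt \<Rightarrow> nat" where
  "arm_excess T = (\<Sum>p\<in>dom T. length (arm T p))"

definition arm_cols :: "hvt \<Rightarrow> nat set" where
  "arm_cols T = {c. \<exists>r. arm T (r, c) \<noteq> []}"

definition Vb :: "hvt \<Rightarrow> hvt" where
  "Vb T = (if arm_excess T = 0 then T else
    (let c = Max (arm_cols T);
         r = (SOME r. arm T (r, c) \<noteq> [] \<and>
                (\<forall>r'. arm T (r', c) \<noteq> [] \<longrightarrow> Max (set (arm T (r', c))) \<le> Max (set (arm T (r, c)))));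
         A = arm T (r, c);
         a = Max (set A);
         L = tl (xleg T (r, c));
         l = Max (set L);
         mv = filter (\<lambda>x. a < x \<and> x \<le> l) L;
         E = {v. \<exists>r'. v \<in> set (xleg T (r', Suc c)) \<and> a \<le> v};
         kk = (if E = {} then None else Some (Min E));
         rt = (case kk of None \<Rightarrow> colheight T (Suc c) + 1
                 | Some k \<Rightarrow> (SOME r'. k \<in> set (xleg T (r', Suc c))));
         oldL = xleg T (rt, Suc c);
         oldA = arm T (rt, Suc c)
     in if rt \<noteq> r then
          T((r, c) := Some (xleg T (r, c), remove1 a A),
            (rt, Suc c) := Some (case kk of None \<Rightarrow> ([a], [])
                                  | Some k \<Rightarrow> (insort a (remove1 k oldL), insort k oldA)))
        else
          T((r, c) := Some (filter (\<lambda>x. x \<notin> set mv) (xleg T (r, c)), remove1 a A),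
            (r, Suc c) := Some (a # sort (tl oldL @ mv),
                                (case kk of None \<Rightarrow> oldA | Some k \<Rightarrow> insort k oldA)))))"

definition V :: "hvt \<Rightarrow> hvt" where
  "V T = (Vb ^^ (LEAST d. 1 \<le> d \<and>
            (dom ((Vb ^^ d) T) \<noteq> dom ((Vb ^^ (d - 1)) T) \<or> (Vb ^^ d) T = (Vb ^^ (d - 1)) T))) T"

type_synonym rec_tab = "nat \<times> nat \<Rightarrow> int option"

definition uncrowd_step :: "hvt \<times> rec_tab \<Rightarrow> hvt \<times> rec_tab" where
  "uncrowd_step PQ = (case PQ of (P, Q) \<Rightarrow>
     (let P' = V P;
          nc = (THE x. x \<in> dom P' - dom P);
          c = Max (arm_cols P)
      in (P', Q(nc := Some (int (snd nc) - int c)))))"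

definition uncrowd :: "hvt \<Rightarrow> hvt \<times> rec_tab" where
  "uncrowd T = (uncrowd_step ^^ arm_excess T) (T, (\<lambda>_. None))"

definition Ptab :: "hvt \<Rightarrow> hvt" where "Ptab T = fst (uncrowd T)"
definition Qtab :: "hvt \<Rightarrow> rec_tab" where "Qtab T = snd (uncrowd T)"

end

theory Submission
  imports Defs "HOL-Library.Multiset"
begin

text \<open>
  A single bumping step already commutes with the crystal operators, and the crystal operators change
  neither the shape nor the number of arm entries in any column.  Hence all bumping sequences of \<open>T\<close> and
  \<open>f_i(T)\<close> run in parallel, with the same stopping times and the same recorded columns; for \<open>e_i\<close> one uses
  that it is the partial inverse of \<open>f_i\<close>.

  The commutation is checked on columns.  The sign word of a column reduces to some minuses followed by
  some pluses, so the column in which \<open>f_i\<close> acts is the first one at which the height of the sign path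
  (a plus is an up step) attains its strict minimum, and inside that column \<open>f_i\<close> is determined: it raises
  an \<open>i\<close> of the arm, or else the \<open>i\<close> of the leg, unless this would violate a row condition with the next
  column, which is exactly case (S).  A bumping step from column \<open>c\<close> to column \<open>c + 1\<close> preserves the minimum
  of the path over the two columns, so that only a comparison of \<open>i\<close> with the bumping letters remains.
\<close>

section \<open>Columns\<close>

text \<open>The raised letter may itself be the bumping letter \<open>a\<close>, or it may be
  carried into the next column by the bump. Applied afterwards, bumping may therefore use another
  letter and the lowering move may act in another column, so commutation of a single step is claimed
  with both of them existentially quantified. The analysis stays finite because no column to the
  right of \<open>c\<close> has arm entries: column \<open>c + 1\<close> contributes at most one
  minus, and only letters between \<open>a\<close> and the bumped entry \<open>k\<close> are
  disturbed. If \<open>i\<close> and \<open>i + 1\<close> avoid this window, bumping does not see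
  them; otherwise \<open>a \<le> i \<le> k\<close> or \<open>a = i + 1\<close>, which leaves a few
  explicit situations. Sets of hook entries also absorb the geometry of the bump: whether
  \<open>a\<close> arrives in its own row is a question about counts of hook entries, and cells are
  inspected only when columns are translated back into tableaux.\<close>

text \<open>
  The column model rests on the observation that the entries of a column increase strictly from
  cell to cell, so its cells can be recovered from the set \<open>hk\<close> of hook entries: an entry \<open>v\<close> lies in
  the row \<open>row K v\<close> counting the hook entries that are at most \<open>v\<close>.  The column conditions of a
  tableau then hold automatically, and the row conditions between adjacent columns become \<open>adj\<close>.
\<close>

datatype column = Col (hk: "nat set") (lg: "nat set") (am: "nat multiset")

definition below :: "nat set \<Rightarrow> nat \<Rightarrow> nat" where
  "below H v = card {h \<in> H. h < v}"

abbreviation row :: "column \<Rightarrow> nat \<Rightarrow> nat" where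
  "row K v \<equiv> below (hk K) (Suc v)"

definition ents :: "column \<Rightarrow> nat set" where
  "ents K = lg K \<union> set_mset (am K)"

text \<open>The \<open>r\<close>-th smallest hook entry of \<open>K1\<close> sits in row
  \<open>r\<close>; it is at least \<open>v\<close> exactly when fewer than \<open>r\<close> hook
  entries of \<open>K1\<close> are below \<open>v\<close>, and this also holds if \<open>K1\<close>
  has no row \<open>r\<close>. Strictness moreover gives \<open>v\<close> a positive row, so every
  entry lies in some cell.\<close>

definition adj :: "column \<Rightarrow> column \<Rightarrow> bool" where
  "adj K K1 \<longleftrightarrow> (\<forall>v \<in> ents K. below (hk K1) v < row K v)"

definition wfcol :: "column \<Rightarrow> bool" where
  "wfcol K \<longleftrightarrow> finite (lg K) \<and> hk K \<subseteq> lg K \<and> 0 \<notin> ents K"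

definition valid :: "(nat \<Rightarrow> column) \<Rightarrow> bool" where
  "valid C \<longleftrightarrow> hk (C 0) = {} \<and> (\<exists>n. \<forall>c>n. hk (C c) = {}) \<and> (\<forall>c. wfcol (C c))
     \<and> (\<forall>c. 1 \<le> c \<longrightarrow> card (hk (C (Suc c))) \<le> card (hk (C c)))
     \<and> (\<forall>c. adj (C c) (C (Suc c)))"

section \<open>Counting hook entries below a threshold\<close>

lemma below_mono: "finite H \<Longrightarrow> v \<le> w \<Longrightarrow> below H v \<le> below H w"
  unfolding below_def by (rule card_mono) auto

lemma below_Suc: "finite H \<Longrightarrow> below H (Suc v) = below H v + of_bool (v \<in> H)"
proof -
  assume f: "finite H"
  have "{h \<in> H. h < Suc v} = (if v \<in> H then insert v {h \<in> H. h < v} else {h \<in> H. h < v})"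
    by (auto simp: less_Suc_eq)
  then show ?thesis using f by (auto simp: below_def)
qed

lemma below_insert:
  assumes "finite H" "x \<notin> H"
  shows "below (insert x H) v = below H v + of_bool (x < v)"
proof -
  have "{h \<in> insert x H. h < v} = (if x < v then insert x {h \<in> H. h < v} else {h \<in> H. h < v})"
    by auto
  then show ?thesis using assms by (auto simp: below_def)
qed

lemma below_swap:
  assumes "finite H" "y \<in> H" "x \<notin> H"
  shows "below (insert x (H - {y})) v + of_bool (y < v) = below H v + of_bool (x < v)"
proof -
  have "insert y (H - {y}) = H" using assms(2) by blast
  then show ?thesis using below_insert[of "H - {y}" y v] below_insert[of "H - {y}" x v] assms by simp
qed

lemma below_le_card: "finite H \<Longrightarrow> below H v \<le> card H"
  unfolding below_def by (rule card_mono) auto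

lemma below_eq_card: "(\<And>h. h \<in> H \<Longrightarrow> h < v) \<Longrightarrow> below H v = card H"
  unfolding below_def by (rule arg_cong[where f=card]) auto

lemma below_gap:
  assumes "finite H" "v \<le> w" shows "below H v = below H w \<longleftrightarrow> (\<forall>h\<in>H. \<not> (v \<le> h \<and> h < w))"
proof -
  have sub: "{h \<in> H. h < v} \<subseteq> {h \<in> H. h < w}" using assms(2) by (auto intro: less_le_trans)
  have fin: "finite {h \<in> H. h < w}" using assms(1) by simp
  have "below H v = below H w \<longleftrightarrow> {h \<in> H. h < v} = {h \<in> H. h < w}"
    unfolding below_def by (rule iffI, rule card_subset_eq[OF fin sub], assumption, erule arg_cong)
  also have "\<dots> \<longleftrightarrow> {h \<in> H. h < w} \<subseteq> {h \<in> H. h < v}" using sub by blast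
  also have "\<dots> \<longleftrightarrow> (\<forall>h\<in>H. \<not> (v \<le> h \<and> h < w))"
    unfolding subset_iff mem_Collect_eq not_le[symmetric] by blast
  finally show ?thesis .
qed

lemma below_strict: "finite H \<Longrightarrow> h \<in> H \<Longrightarrow> v \<le> h \<Longrightarrow> h < w \<Longrightarrow> below H v < below H w"
  using below_mono[of H "Suc h" w] below_mono[of H v h] by (simp add: below_Suc)

text \<open>
  Up to cancellation, the signs of a column are \<open>um\<close> minuses followed by \<open>up\<close> pluses, and \<open>dip\<close> is the
  height of the sign path after the minuses of a column.  Columns are numbered from 1, and the empty
  column 0 represents the start of the path.
\<close>

definition um :: "nat \<Rightarrow> column \<Rightarrow> nat" where
  "um i K = (of_bool (i \<in> lg K) + count (am K) i) - of_bool (Suc i \<in> lg K)"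

text \<open>The letters \<open>i\<close> and \<open>i + 1\<close> of a column are read in the order:
  \<open>i + 1\<close> of the leg, \<open>i\<close> of the leg, all \<open>i\<close> of the arms,
  all \<open>i + 1\<close> of the arms. Only the single plus of the leg precedes any minus, so one
  truncated subtraction describes all cancellation, here as well as in \<open>um\<close>.\<close>

definition up :: "nat \<Rightarrow> column \<Rightarrow> nat" where
  "up i K = count (am K) (Suc i) + (of_bool (Suc i \<in> lg K) - (of_bool (i \<in> lg K) + count (am K) i))"

definition hgt :: "nat \<Rightarrow> (nat \<Rightarrow> column) \<Rightarrow> nat \<Rightarrow> int" where
  "hgt i C d = (\<Sum>e<d. int (up i (C e)) - int (um i (C e)))"

definition dip :: "nat \<Rightarrow> (nat \<Rightarrow> column) \<Rightarrow> nat \<Rightarrow> int" where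
  "dip i C d = hgt i C d - int (um i (C d))"

text \<open>Column 0 has dip 0, so the comparison with \<open>e = 0\<close> makes the minimum
  negative; this encodes the existence of an unpaired minus.\<close>

definition fsel :: "nat \<Rightarrow> (nat \<Rightarrow> column) \<Rightarrow> nat \<Rightarrow> bool" where
  "fsel i C d \<longleftrightarrow> 1 \<le> d \<and> (\<forall>e<d. dip i C d < dip i C e) \<and> (\<forall>e. dip i C d \<le> dip i C e)"

text \<open>Far to the right all columns are empty and the dip is the total height, so the strict
  rise after \<open>d\<close> includes the existence of an unpaired plus.\<close>

definition esel :: "nat \<Rightarrow> (nat \<Rightarrow> column) \<Rightarrow> nat \<Rightarrow> bool" where
  "esel i C d \<longleftrightarrow> 1 \<le> d \<and> (\<forall>e>d. dip i C d < dip i C e) \<and> (\<forall>e. dip i C d \<le> dip i C e)"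

text \<open>
  \<open>spill\<close> says that raising an entry \<open>i\<close> of \<open>K\<close> breaks the row condition with the next column (case (S)).
  The other cases (M) and (N) need not be distinguished, since rows are implicit.
\<close>

definition spill :: "nat \<Rightarrow> column \<Rightarrow> column \<Rightarrow> bool" where
  "spill i K K1 \<longleftrightarrow> Suc i \<notin> hk K \<and> i \<in> hk K1 \<and> Suc (below (hk K1) i) = row K i"

definition f_move :: "nat \<Rightarrow> nat \<Rightarrow> (nat \<Rightarrow> column) \<Rightarrow> (nat \<Rightarrow> column)" where
  "f_move i d C = (let K = C d; K1 = C (Suc d) in
     if spill i K K1 then
       C(d := Col (hk K) (insert (Suc i) (lg K)) (am K),
         Suc d := Col (insert (Suc i) (hk K1 - {i})) (lg K1 - {i}) (am K1))
     else if i \<in># am K then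
       C(d := Col (hk K) (lg K) (add_mset (Suc i) (am K - {#i#})))
     else
       C(d := Col (if i \<in> hk K then insert (Suc i) (hk K - {i}) else hk K)
                  (insert (Suc i) (lg K - {i})) (am K)))"

text \<open>An entry \<open>i\<close> of the column cancels the plus of a leg entry
  \<open>i + 1\<close>, so the first branch describes the situation in which the leftmost unpaired
  plus belongs to an arm; with implicit rows it covers (M) and the arm case of (N) at once. The
  second branch is (S).\<close>

definition e_move :: "nat \<Rightarrow> nat \<Rightarrow> (nat \<Rightarrow> column) \<Rightarrow> (nat \<Rightarrow> column)" where
  "e_move i d C = (let K = C d; K0 = C (d - 1) in
     if i \<in> ents K \<or> Suc i \<notin> lg K then
       C(d := Col (hk K) (lg K) (add_mset i (am K - {#Suc i#})))
     else if Suc i \<in> lg K0 \<and> Suc i \<notin> hk K0 \<and> row K0 (Suc i) = row K (Suc i) then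
       C(d - 1 := Col (hk K0) (lg K0 - {Suc i}) (am K0),
         d := Col (insert i (hk K - {Suc i})) (insert i (lg K)) (am K))
     else
       C(d := Col (if Suc i \<in> hk K then insert i (hk K - {Suc i}) else hk K)
                  (insert i (lg K - {Suc i})) (am K)))"

lemma wfcolD:
  assumes "wfcol K"
  shows "finite (lg K)" "finite (hk K)" "h \<in> hk K \<Longrightarrow> h \<in> lg K" "0 \<notin> lg K" "0 \<notin># am K"
  using assms by (auto simp: wfcol_def ents_def intro: finite_subset)

lemma validD:
  assumes "valid C"
  shows "wfcol (C c)" "adj (C c) (C (Suc c))" "hk (C 0) = {}"
    "1 \<le> c \<Longrightarrow> card (hk (C (Suc c))) \<le> card (hk (C c))"
  using assms by (auto simp: valid_def)

lemma adjD:
  assumes "adj K K1"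
  shows "v \<in> lg K \<Longrightarrow> below (hk K1) v < row K v" "v \<in># am K \<Longrightarrow> below (hk K1) v < row K v"
  using assms by (auto simp: adj_def ents_def)

lemma valid_0: "valid C \<Longrightarrow> lg (C 0) = {} \<and> am (C 0) = {#}"
proof -
  assume v: "valid C"
  have "ents (C 0) = {}" using validD(2)[OF v, of 0] validD(3)[OF v]
    by (auto simp: adj_def below_def)
  then show ?thesis by (auto simp: ents_def)
qed

lemma um_0 [simp]: "valid C \<Longrightarrow> um i (C 0) = 0" and up_0 [simp]: "valid C \<Longrightarrow> up i (C 0) = 0"
  by (auto simp: um_def up_def valid_0)

lemma dip_0 [simp]: "valid C \<Longrightarrow> dip i C 0 = 0"
  by (simp add: dip_def hgt_def)

lemma dip_Suc: "dip i C (Suc d) = dip i C d + int (up i (C d)) - int (um i (C (Suc d)))"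
  by (simp add: dip_def hgt_def)

lemma hgt_upd:
  "hgt i (C(d := K)) e = hgt i C e + (if d < e then (int (up i K) - int (um i K)) - (int (up i (C d)) - int (um i (C d))) else 0)"
  by (induction e) (auto simp: hgt_def less_Suc_eq)

lemma dip_upd:
  "dip i (C(d := K)) e = (if e < d then dip i C e
     else if e = d then dip i C d + int (um i (C d)) - int (um i K)
     else dip i C e + (int (up i K) - int (um i K)) - (int (up i (C d)) - int (um i (C d))))"
  by (simp add: dip_def hgt_upd)

lemma fsel_um: assumes "fsel i C d" shows "um i (C d) > 0" "um i (C (Suc d)) \<le> up i (C d)"
proof -
  obtain e where e: "d = Suc e" using assms by (cases d) (auto simp: fsel_def)
  have "dip i C d < dip i C e" using assms e by (auto simp: fsel_def)
  then show "um i (C d) > 0" by (simp add: e dip_Suc)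
  have "dip i C d \<le> dip i C (Suc d)" using assms by (auto simp: fsel_def)
  then show "um i (C (Suc d)) \<le> up i (C d)" by (simp add: dip_Suc)
qed

lemma esel_up: assumes "valid C" "esel i C d" shows "up i (C d) > um i (C (Suc d))" "up i (C (d - 1)) \<le> um i (C d)" "up i (C d) > 0"
proof -
  obtain e where e: "d = Suc e" using assms by (cases d) (auto simp: esel_def)
  have "dip i C d \<le> dip i C e" using assms e by (auto simp: esel_def)
  then show "up i (C (d - 1)) \<le> um i (C d)" by (simp add: e dip_Suc)
  have "dip i C d < dip i C (Suc d)" using assms by (auto simp: esel_def)
  then show 1: "up i (C d) > um i (C (Suc d))" by (simp add: dip_Suc)
  then show "up i (C d) > 0" by simp
qed

text \<open>Raising \<open>i\<close> would break the row condition, so the column itself contains no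
  \<open>i + 1\<close> and, having an unpaired minus, no unpaired plus. By minimality of the dip the
  next column then has no unpaired minus: its hook entry \<open>i\<close> must be cancelled by an
  \<open>i + 1\<close> of its own leg, and its arms contain no \<open>i\<close>.\<close>

lemma spill_facts:
  assumes v: "valid C" and f: "fsel i C d" and s: "spill i (C d) (C (Suc d))"
  shows "Suc i \<notin> lg (C d)" "Suc i \<notin># am (C d)" "Suc i \<in> lg (C (Suc d))" "i \<notin># am (C (Suc d))"
    "Suc i \<notin> hk (C (Suc d))" "i \<in> lg (C (Suc d))"
proof -
  let ?K = "C d" and ?K1 = "C (Suc d)"
  note w = wfcolD[OF validD(1)[OF v]]
  have row: "row ?K (Suc i) = row ?K i" using s by (simp add: below_Suc w spill_def)
  have b1: "below (hk ?K1) (Suc i) = row ?K i" using s by (simp add: below_Suc w spill_def)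
  show x: "Suc i \<notin> lg ?K" "Suc i \<notin># am ?K"
    using adjD[OF validD(2)[OF v, of d], of "Suc i"] unfolding row b1 by auto
  have "up i ?K = 0" using x fsel_um(1)[OF f] by (auto simp: up_def um_def not_in_iff)
  then have u1: "um i ?K1 = 0" using fsel_um(2)[OF f] by simp
  show i1: "i \<in> lg ?K1" using s w(3)[of i "Suc d"] by (simp add: spill_def)
  have "Suc (count (am ?K1) i) \<le> of_bool (Suc i \<in> lg ?K1)" using u1 i1 by (simp add: um_def)
  then show "Suc i \<in> lg ?K1" "i \<notin># am ?K1" by (auto simp: of_bool_def not_in_iff split: if_splits)
  show "Suc i \<notin> hk ?K1"
  proof
    assume a: "Suc i \<in> hk ?K1"
    have d1: "1 \<le> d" using f by (simp add: fsel_def)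
    have "row ?K1 (Suc i) = Suc (row ?K i)" using a b1 by (simp add: below_Suc w)
    then have "Suc (row ?K i) \<le> card (hk ?K)"
      using below_le_card[OF w(2), of "Suc d" "Suc (Suc i)"] validD(4)[OF v d1] by simp
    then obtain h where h: "h \<in> hk ?K" "\<not> h < Suc i"
      using below_eq_card[of "hk ?K" "Suc i"] by (metis Suc_n_not_le_n)
    \<comment> \<open>If \<open>i + 1\<close> opened a cell of the next column, \<open>m\<close>
      would be the hook entry of the cell to the left of that cell; it exceeds \<open>i + 1\<close>,
      against the row condition.\<close>
    define m where "m = Min {h \<in> hk ?K. \<not> h < Suc i}"
    have fin: "finite {h \<in> hk ?K. \<not> h < Suc i}" using w(2) by simp
    have "m \<in> {h \<in> hk ?K. \<not> h < Suc i}" unfolding m_def using h by (intro Min_in[OF fin]) auto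
    then have m: "m \<in> hk ?K" "Suc i \<le> m" by auto
    have mm: "\<And>h. h \<in> hk ?K \<Longrightarrow> Suc i \<le> h \<Longrightarrow> m \<le> h" unfolding m_def using fin by (auto intro!: Min_le)
    have ne: "m \<noteq> Suc i" using m x w(3)[of m d] by auto
    have "below (hk ?K) m = row ?K i"
      using below_gap[OF w(2), of "Suc i" m d] m(2) mm by (metis not_le)
    then have "row ?K m = Suc (row ?K i)" using m by (simp add: below_Suc w)
    moreover have "below (hk ?K1) m \<ge> Suc (row ?K i)"
      using below_strict[OF w(2)[of "Suc d"] a, of "Suc i" m] b1 ne m by simp
    moreover have "below (hk ?K1) m < row ?K m"
      using adjD(1)[OF validD(2)[OF v, of d], of m] m w(3)[of m d] by auto
    ultimately show False by simp
  qed
qed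

lemma card_swap: "finite H \<Longrightarrow> y \<in> H \<Longrightarrow> x \<notin> H \<Longrightarrow> card (insert x (H - {y})) = card H"
  by (metis card_Suc_Diff1 card_insert_disjoint finite_Diff Diff_iff)

text \<open>No integer lies strictly between \<open>i\<close> and \<open>i + 1\<close>, so only the
  threshold \<open>i + 1\<close> is affected, which means that among all letters only
  \<open>i\<close> changes its row. The truncated subtraction is exact because \<open>i\<close> is
  counted at that threshold.\<close>

lemma below_flip:
  assumes "finite H" "i \<in> H" "Suc i \<notin> H"
  shows "below (insert (Suc i) (H - {i})) v = below H v - of_bool (v = Suc i)"
proof -
  have "below H (Suc i) > 0" using assms by (auto simp: below_Suc)
  then show ?thesis using below_swap[OF assms, of v]
    by (cases "v = Suc i") (auto simp: of_bool_def split: if_splits)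
qed

lemma below_flip':
  assumes "finite H" "Suc i \<in> H" "i \<notin> H"
  shows "below (insert i (H - {Suc i})) v = below H v + of_bool (v = Suc i)"
  using below_swap[OF assms, of v]
  by (cases "v = Suc i") (auto simp: of_bool_def split: if_splits)

section \<open>The moves preserve validity and invert each other\<close>

lemma adj_le: "adj K K1 \<Longrightarrow> (\<And>v. below (hk K1') v \<le> below (hk K1) v) \<Longrightarrow> adj K K1'"
  unfolding adj_def using le_less_trans by blast

lemma valid_upd2:
  assumes v: "valid C" and d: "1 \<le> d" and w: "wfcol K" "wfcol K1"
    and c: "card (hk K1) \<le> card (hk K)" "card (hk K) = card (hk (C d))" "card (hk (C (Suc (Suc d)))) \<le> card (hk K1)"
    and a: "adj (C (d - 1)) K" "adj K K1" "adj K1 (C (Suc (Suc d)))"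
  shows "valid (C(d := K, Suc d := K1))"
proof -
  let ?C = "C(d := K, Suc d := K1)"
  obtain n where n: "\<forall>c>n. hk (C c) = {}" using v by (auto simp: valid_def)
  have "\<forall>c>max n (Suc d). hk (?C c) = {}" using n by auto
  then have "\<exists>n. \<forall>c>n. hk (?C c) = {}" by blast
  moreover have "adj (?C c) (?C (Suc c))" for c
    using a validD(2)[OF v, of c] by auto
  moreover have "card (hk (?C (Suc e))) \<le> card (hk (?C e))" if "1 \<le> e" for e
    using validD(4)[OF v that] c by auto
  ultimately show ?thesis using d w validD[OF v] by (auto simp: valid_def)
qed

lemma valid_upd1:
  assumes v: "valid C" and d: "1 \<le> d" and w: "wfcol K" and c: "card (hk K) = card (hk (C d))"
    and a0: "adj (C (d - 1)) K" and a1: "adj K (C (Suc d))"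
  shows "valid (C(d := K))"
proof -
  have "card (hk (C (Suc d))) \<le> card (hk (C d))" using validD(4)[OF v d] .
  then have "valid (C(d := K, Suc d := C (Suc d)))"
    using validD[OF v] c a0 a1 w by (intro valid_upd2[OF v d]) auto
  moreover have "C(d := K, Suc d := C (Suc d)) = C(d := K)" by auto
  ultimately show ?thesis by simp
qed

text \<open>The condition at stake is that of the new \<open>i + 1\<close> against the next column.
  Without \<open>spill\<close> it follows from the condition for \<open>i\<close>. With
  \<open>spill\<close> it fails by exactly one, and turning the hook entry \<open>i\<close> of the
  next column into \<open>i + 1\<close> lowers the offending count by one.\<close>

lemma valid_f_move:
  assumes v: "valid C" and f: "fsel i C d"
  shows "valid (f_move i d C)"
proof -
  let ?K = "C d" and ?K1 = "C (Suc d)" and ?J = "C (d - 1)"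
  note w = wfcolD[OF validD(1)[OF v]]
  have wf: "wfcol ?K" "wfcol ?K1" using validD(1)[OF v] by auto
  have d1: "1 \<le> d" using f by (simp add: fsel_def)
  have a0: "adj ?J ?K" using validD(2)[OF v, of "d - 1"] d1 by (cases d) auto
  have a1: "adj ?K ?K1" and a2: "adj ?K1 (C (Suc (Suc d)))" using validD(2)[OF v] by auto
  note u = fsel_um(1)[OF f]
  consider (S) "spill i ?K ?K1" | (A) "\<not> spill i ?K ?K1" "i \<in># am ?K"
    | (L) "\<not> spill i ?K ?K1" "i \<notin># am ?K" by blast
  then show ?thesis
  proof cases
    case S
    note s = spill_facts[OF v f S]
    have i1: "i \<in> hk ?K1" using S by (simp add: spill_def)
    let ?K' = "Col (hk ?K) (insert (Suc i) (lg ?K)) (am ?K)"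
    let ?K1' = "Col (insert (Suc i) (hk ?K1 - {i})) (lg ?K1 - {i}) (am ?K1)"
    note f_left = below_flip[OF w(2) i1 s(5)]
    have "valid (C(d := ?K', Suc d := ?K1'))"
    proof (rule valid_upd2[OF v d1])
      show "wfcol ?K'" "wfcol ?K1'" using wf s(3) by (auto simp: wfcol_def ents_def)
      show "adj ?J ?K'" using a0 by (simp add: adj_def)
      have "adj ?K ?K1'" by (rule adj_le[OF a1]) (simp add: f_left)
      moreover have "below (hk ?K1') (Suc i) < row ?K (Suc i)"
        using S by (auto simp: f_left below_Suc w spill_def)
      ultimately show "adj ?K' ?K1'" by (auto simp: adj_def ents_def)
      show "adj ?K1' (C (Suc (Suc d)))" using a2 s(4) f_left unfolding adj_def by (auto simp: ents_def)
    qed (use validD(4)[OF v d1] validD(4)[OF v, of "Suc d"] card_swap[OF w(2) i1 s(5)] a1 in auto)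
    then show ?thesis using S by (simp add: f_move_def Let_def)
  next
    case A
    let ?K' = "Col (hk ?K) (lg ?K) (add_mset (Suc i) (am ?K - {#i#}))"
    have "valid (C(d := ?K'))"
    proof (rule valid_upd1[OF v d1])
      show "wfcol ?K'" using wf by (auto simp: wfcol_def ents_def dest: in_diffD)
      show "adj ?J ?K'" using a0 by (simp add: adj_def)
      have "below (hk ?K1) (Suc i) < row ?K (Suc i)"
        using adjD(2)[OF a1 A(2)] A(1) by (auto simp: below_Suc w spill_def)
      then show "adj ?K' ?K1" using a1 by (auto simp: adj_def ents_def dest: in_diffD)
    qed auto
    then show ?thesis using A by (simp add: f_move_def Let_def)
  next
    case L
    have il: "i \<in> lg ?K" "Suc i \<notin> lg ?K" using u L by (auto simp: um_def not_in_iff split: if_splits)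
    have sh: "Suc i \<notin> hk ?K" using w(3) il by blast
    let ?H = "if i \<in> hk ?K then insert (Suc i) (hk ?K - {i}) else hk ?K"
    let ?K' = "Col ?H (insert (Suc i) (lg ?K - {i})) (am ?K)"
    have bH: "below ?H v = below (hk ?K) v - of_bool (i \<in> hk ?K \<and> v = Suc i)" for v
      using below_flip[OF w(2) _ sh] by simp
    have "valid (C(d := ?K'))"
    proof (rule valid_upd1[OF v d1])
      show "wfcol ?K'" using wf by (auto simp: wfcol_def ents_def)
      show "card (hk ?K') = card (hk ?K)" using card_swap[OF w(2) _ sh] by simp
      show "adj ?J ?K'" by (rule adj_le[OF a0]) (simp add: bH)
      have "below (hk ?K1) (Suc i) < row ?K (Suc i)"
        using adjD(1)[OF a1 il(1)] L(1) by (auto simp: below_Suc w spill_def)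
      then show "adj ?K' ?K1" using a1 L(2) bH by (auto simp: adj_def ents_def)
    qed
    then show ?thesis using L by (simp add: f_move_def Let_def)
  qed
qed

lemma column_eqI: "hk K = H \<Longrightarrow> lg K = L \<Longrightarrow> am K = A \<Longrightarrow> Col H L A = K"
  by (cases K) auto

lemma adj_ge:
  assumes "adj K L" "\<And>v. row K v \<le> row K' v"
    and "\<And>v. v \<in> ents K' \<Longrightarrow> v \<in> ents K \<or> below (hk L) v < row K' v"
  shows "adj K' L"
  using assms less_le_trans unfolding adj_def by blast

text \<open>Raising a letter lifts the dip of column \<open>d\<close> by 1 and all later dips by 2,
  so the first minimum becomes the last one. In case (S) the dips of \<open>d\<close> and
  \<open>d + 1\<close> agree and both rise by 1, which makes \<open>d + 1\<close> the column of the
  raising move.\<close>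

lemma e_move_f_move:
  assumes v: "valid C" and f: "fsel i C d"
  shows "\<exists>d'. esel i (f_move i d C) d' \<and> e_move i d' (f_move i d C) = C"
proof -
  let ?K = "C d" and ?L = "C (Suc d)" and ?J = "C (d - 1)"
  note w = wfcolD[OF validD(1)[OF v]]
  have d1: "1 \<le> d" using f by (simp add: fsel_def)
  have aJ: "adj ?J ?K" using validD(2)[OF v, of "d - 1"] d1 by (cases d) auto
  note u = fsel_um(1)[OF f]
  have le: "dip i C d \<le> dip i C e" for e using f by (simp add: fsel_def)
  have lt: "e < d \<Longrightarrow> dip i C d < dip i C e" for e using f by (simp add: fsel_def)
  consider (S) "spill i ?K ?L" | (A) "\<not> spill i ?K ?L" "i \<in># am ?K"
    | (B) "\<not> spill i ?K ?L" "i \<notin># am ?K" by blast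
  then show ?thesis
  proof cases
    case S
    note s = spill_facts[OF v f S]
    have il: "i \<in> hk ?L" "Suc i \<notin> hk ?K" using S by (auto simp: spill_def)
    let ?K' = "Col (hk ?K) (insert (Suc i) (lg ?K)) (am ?K)"
    let ?L' = "Col (insert (Suc i) (hk ?L - {i})) (lg ?L - {i}) (am ?L)"
    let ?C' = "C(d := ?K', Suc d := ?L')"
    have C': "f_move i d C = ?C'" using S by (simp add: f_move_def Let_def)
    have uK: "um i ?K = Suc (um i ?K')" "up i ?K' = 0" "up i ?K = 0"
      using s u by (auto simp: um_def up_def not_in_iff)
    have uL: "um i ?L = 0" "um i ?L' = 0" "up i ?L' = Suc (up i ?L)"
      using s by (auto simp: um_def up_def not_in_iff)
    have "dip i C (Suc d) = dip i C d" by (simp add: dip_Suc uK uL)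
    then have dp: "dip i ?C' e = (if e < d then dip i C e else if e \<le> Suc d then dip i C d + 1 else dip i C e + 2)" for e
      using uK uL by (auto simp: dip_upd)
    have "dip i ?C' (Suc d) \<le> dip i ?C' e \<and> (Suc d < e \<longrightarrow> dip i ?C' (Suc d) < dip i ?C' e)" for e
      using le[of e] lt[of e] by (auto simp: dp)
    then have "esel i ?C' (Suc d)" using d1 by (simp add: esel_def)
    moreover have "row ?L' (Suc i) = row ?K' (Suc i)"
      using S below_flip[OF w(2) il(1) s(5)] s(5) by (simp add: spill_def below_Suc w)
    then have "e_move i (Suc d) ?C' = C"
      using s il by (auto simp: e_move_def Let_def ents_def fun_eq_iff intro!: column_eqI)
    ultimately show ?thesis unfolding C' by blast
  next
    case A
    let ?K' = "Col (hk ?K) (lg ?K) (add_mset (Suc i) (am ?K - {#i#}))"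
    let ?C' = "C(d := ?K')"
    have C': "f_move i d C = ?C'" using A by (simp add: f_move_def Let_def)
    have c: "count (am ?K) i > 0" using A by simp
    have uK: "um i ?K = Suc (um i ?K')" "up i ?K' = Suc (up i ?K)"
      using c u by (auto simp: um_def up_def)
    have dp: "dip i ?C' e = (if e < d then dip i C e else if e = d then dip i C d + 1 else dip i C e + 2)" for e
      using uK by (auto simp: dip_upd)
    have "dip i ?C' d \<le> dip i ?C' e \<and> (d < e \<longrightarrow> dip i ?C' d < dip i ?C' e)" for e
      using le[of e] lt[of e] by (auto simp: dp)
    then have "esel i ?C' d" using d1 by (simp add: esel_def)
    moreover have "i \<in> ents ?K' \<or> Suc i \<notin> lg ?K'"
      using u c by (auto simp: um_def ents_def in_diff_count split: if_splits)
    then have "e_move i d ?C' = C"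
      using A(2) by (auto simp: e_move_def Let_def fun_eq_iff intro!: column_eqI)
    ultimately show ?thesis unfolding C' by blast
  next
    case B
    have il: "i \<in> lg ?K" "Suc i \<notin> lg ?K" using u B by (auto simp: um_def not_in_iff of_bool_def split: if_splits)
    have sh: "Suc i \<notin> hk ?K" using w(3) il by blast
    let ?H = "if i \<in> hk ?K then insert (Suc i) (hk ?K - {i}) else hk ?K"
    let ?K' = "Col ?H (insert (Suc i) (lg ?K - {i})) (am ?K)"
    let ?C' = "C(d := ?K')"
    have bH: "below ?H v = below (hk ?K) v - of_bool (i \<in> hk ?K \<and> v = Suc i)" for v
      using below_flip[OF w(2) _ sh] by simp
    have C': "f_move i d C = ?C'" using B by (simp add: f_move_def Let_def)
    have uK: "um i ?K = Suc (um i ?K')" "up i ?K' = Suc (up i ?K)"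
      using B il by (auto simp: um_def up_def not_in_iff)
    have dp: "dip i ?C' e = (if e < d then dip i C e else if e = d then dip i C d + 1 else dip i C e + 2)" for e
      using uK by (auto simp: dip_upd)
    have "dip i ?C' d \<le> dip i ?C' e \<and> (d < e \<longrightarrow> dip i ?C' d < dip i ?C' e)" for e
      using le[of e] lt[of e] by (auto simp: dp)
    then have "esel i ?C' d" using d1 by (simp add: esel_def)
    \<comment> \<open>The inverse must not take (S): a leg entry \<open>i + 1\<close> of the left
      column in this row would have violated the row condition already, since the hook entry of the
      old cell of \<open>i\<close> is at most \<open>i\<close>.\<close>
    moreover have "\<not> (Suc i \<in> lg ?J \<and> Suc i \<notin> hk ?J \<and> row ?J (Suc i) = row ?K' (Suc i))"
    proof
      assume a: "Suc i \<in> lg ?J \<and> Suc i \<notin> hk ?J \<and> row ?J (Suc i) = row ?K' (Suc i)"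
      have "row ?K' (Suc i) = row ?K i" using bH[of "Suc (Suc i)"] sh by (simp add: below_Suc w)
      then show False using a adjD(1)[OF aJ, of "Suc i"] by simp
    qed
    then have "e_move i d ?C' = C"
      using B(2) il sh d1 w(3)[of i d] by (auto simp: e_move_def Let_def ents_def fun_eq_iff intro!: column_eqI)
    ultimately show ?thesis unfolding C' by blast
  qed
qed

text \<open>Mirror image of the preceding argument: the dip of the column falls by 1 and all later
  dips by 2, so the last minimum becomes the first. Validity is part of the claim, with
  \<open>1 \<le> i\<close> keeping the new entry positive.\<close>

lemma f_move_e_move:
  assumes v: "valid C" and f: "esel i C d" and i: "1 \<le> i"
  shows "valid (e_move i d C) \<and> (\<exists>d'. fsel i (e_move i d C) d' \<and> f_move i d' (e_move i d C) = C)"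
proof -
  let ?K = "C d" and ?L = "C (Suc d)" and ?J = "C (d - 1)"
  note w = wfcolD[OF validD(1)[OF v]]
  have wf: "wfcol ?K" "wfcol ?L" "wfcol ?J" using validD(1)[OF v] by auto
  have d1: "1 \<le> d" using f by (simp add: esel_def)
  have aJ: "adj ?J ?K" using validD(2)[OF v, of "d - 1"] d1 by (cases d) auto
  have aL: "adj ?K ?L" using validD(2)[OF v] by auto
  note u = esel_up[OF v f]
  have le: "dip i C d \<le> dip i C e" for e using f by (simp add: esel_def)
  have lt: "e > d \<Longrightarrow> dip i C d < dip i C e" for e using f by (simp add: esel_def)
  consider (A) "i \<in> ents ?K \<or> Suc i \<notin> lg ?K"
    | (S) "i \<notin> ents ?K" "Suc i \<in> lg ?K" "Suc i \<in> lg ?J" "Suc i \<notin> hk ?J" "row ?J (Suc i) = row ?K (Suc i)"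
    | (B) "i \<notin> ents ?K" "Suc i \<in> lg ?K" "\<not> (Suc i \<in> lg ?J \<and> Suc i \<notin> hk ?J \<and> row ?J (Suc i) = row ?K (Suc i))"
    by blast
  then show ?thesis
  proof cases
    case A
    let ?K' = "Col (hk ?K) (lg ?K) (add_mset i (am ?K - {#Suc i#}))"
    let ?C' = "C(d := ?K')"
    have C': "e_move i d C = ?C'" using A by (simp add: e_move_def Let_def)
    have A': "i \<in> lg ?K \<or> count (am ?K) i > 0 \<or> Suc i \<notin> lg ?K" using A by (auto simp: ents_def)
    have c: "count (am ?K) (Suc i) > 0" using A' u(3) by (auto simp: up_def of_bool_def simp flip: count_greater_zero_iff split: if_splits)
    then have c': "Suc i \<in># am ?K" by simp
    have uK: "um i ?K' = Suc (um i ?K)" "up i ?K = Suc (up i ?K')"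
      using A' c by (auto simp: um_def up_def)
    have dp: "dip i ?C' e = (if e < d then dip i C e else if e = d then dip i C d - 1 else dip i C e - 2)" for e
      using uK by (auto simp: dip_upd)
    have "dip i ?C' d \<le> dip i ?C' e \<and> (e < d \<longrightarrow> dip i ?C' d < dip i ?C' e)" for e
      using le[of e] lt[of e] by (auto simp: dp)
    then have "fsel i ?C' d" using d1 by (simp add: fsel_def)
    moreover have b: "below (hk ?L) (Suc i) < row ?K (Suc i)" using adjD(2)[OF aL c'] .
    then have "\<not> spill i ?K' ?L" by (auto simp: spill_def below_Suc w)
    then have "f_move i d ?C' = C"
      using c' by (auto simp: f_move_def Let_def fun_eq_iff intro!: column_eqI)
    moreover have "valid ?C'"
    proof (rule valid_upd1[OF v d1])
      show "wfcol ?K'" using wf i by (auto simp: wfcol_def ents_def dest: in_diffD)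
      show "adj ?J ?K'" using aJ by (simp add: adj_def)
      have "below (hk ?L) i < row ?K i"
      proof (cases "i \<in> ents ?K")
        case True then show ?thesis using aL by (auto simp: adj_def)
      next
        case False
        then have "Suc i \<notin> hk ?K" using A w(3) by blast
        then show ?thesis using b by (auto simp: below_Suc w)
      qed
      then show "adj ?K' ?L" using aL by (auto simp: adj_def ents_def dest: in_diffD)
    qed simp
    ultimately show ?thesis unfolding C' by blast
  next
    case S
    have i0: "i \<notin> lg ?K" "i \<notin># am ?K" using S(1) by (auto simp: ents_def)
    have ih: "i \<notin> hk ?K" using i0 w(3) by blast
    have sh: "Suc i \<in> hk ?K" using adjD(1)[OF aJ S(3)] S(5) by (auto simp: below_Suc w split: if_splits)
    let ?J' = "Col (hk ?J) (lg ?J - {Suc i}) (am ?J)"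
    let ?K' = "Col (insert i (hk ?K - {Suc i})) (insert i (lg ?K)) (am ?K)"
    let ?C' = "C(d - 1 := ?J', d := ?K')"
    have C': "e_move i d C = ?C'" using S by (simp add: e_move_def Let_def)
    note f_left = below_flip'[OF w(2) sh ih]
    have uK: "um i ?K = 0" "um i ?K' = 0" "up i ?K = Suc (up i ?K')"
      using S(2) i0 by (auto simp: um_def up_def not_in_iff)
    have uJ0: "up i ?J = 0" using u uK by simp
    have J: "Suc i \<notin># am ?J" "i \<in> lg ?J \<or> count (am ?J) i > 0"
      using uJ0 S(3) by (auto simp: up_def not_in_iff of_bool_def split: if_splits)
    have uJ: "um i ?J' = Suc (um i ?J)" "up i ?J' = 0"
      using J S(3) by (auto simp: um_def up_def not_in_iff)
    have "lg (C 0) = {}" using valid_0[OF v] by simp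
    then obtain b where b: "d = Suc b" "1 \<le> b" using S(3) d1 by (cases d; cases "d - 1") auto
    have C'': "?C' = C(b := ?J', Suc b := ?K')" using b by simp
    have db: "dip i C d = dip i C b" using uJ0 uK b by (simp add: dip_Suc)
    have dp: "dip i ?C' e = (if e < b then dip i C e else if e = b \<or> e = d then dip i C b - 1 else dip i C e - 2)" for e
      unfolding C'' using uK uJ uJ0 db b by (auto simp: dip_upd)
    have "dip i ?C' b \<le> dip i ?C' e \<and> (e < b \<longrightarrow> dip i ?C' b < dip i ?C' e)" for e
      using le[of e] lt[of e] le[of b] db b(1) unfolding dp by auto
    then have "fsel i ?C' b" using d1 b by (simp add: fsel_def)
    moreover have "spill i ?J' ?K'"
      using S(4,5) sh ih f_left by (auto simp: spill_def below_Suc w)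
    then have "f_move i b ?C' = C"
      unfolding C'' using S(3,4) i0 ih sh b by (auto simp: f_move_def Let_def fun_eq_iff intro!: column_eqI)
    moreover have "valid (C(b := ?J', Suc b := ?K'))"
    proof (rule valid_upd2[OF v b(2)])
      show "wfcol ?J'" "wfcol ?K'" using wf i S(4) by (auto simp: wfcol_def ents_def)
      show "adj (C (b - 1)) ?J'" using validD(2)[OF v, of "b - 1"] b by (cases b) (auto simp: adj_def)
      show "adj ?J' ?K'" using aJ J(1) f_left by (auto simp: adj_def ents_def)
      have "below (hk ?L) i < row ?K (Suc i)"
        using adjD(1)[OF aL S(2)] below_mono[OF w(2), of i "Suc i" "Suc d"] by simp
      then have bi: "below (hk ?L) i < row ?K' i" using f_left sh by (simp add: below_Suc w)
      have "adj ?K' ?L"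
      proof (rule adj_ge[OF aL])
        show "row ?K x \<le> row ?K' x" for x by (simp add: f_left)
        show "x \<in> ents ?K \<or> below (hk ?L) x < row ?K' x" if "x \<in> ents ?K'" for x
          using that bi by (cases "x = i") (auto simp: ents_def)
      qed
      then show "adj ?K' (C (Suc (Suc b)))" using b(1) by simp
    qed (use validD(4)[OF v d1] validD(4)[OF v b(2)] card_swap[OF w(2) sh ih] b in auto)
    ultimately show ?thesis unfolding C' C''[symmetric] by blast
  next
    case B
    have i0: "i \<notin> lg ?K" "i \<notin># am ?K" using B(1) by (auto simp: ents_def)
    have ih: "i \<notin> hk ?K" using i0 w(3) by blast
    let ?H = "if Suc i \<in> hk ?K then insert i (hk ?K - {Suc i}) else hk ?K"
    let ?K' = "Col ?H (insert i (lg ?K - {Suc i})) (am ?K)"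
    let ?C' = "C(d := ?K')"
    have bH: "below ?H v = below (hk ?K) v + of_bool (Suc i \<in> hk ?K \<and> v = Suc i)" for v
      using below_flip'[OF w(2) _ ih] by simp
    have C': "e_move i d C = ?C'" by (simp only: e_move_def Let_def B if_False simp_thms)
    have uK: "um i ?K' = Suc (um i ?K)" "up i ?K = Suc (up i ?K')" "um i ?K = 0"
      using B i0 by (auto simp: um_def up_def not_in_iff)
    have dp: "dip i ?C' e = (if e < d then dip i C e else if e = d then dip i C d - 1 else dip i C e - 2)" for e
      using uK by (auto simp: dip_upd)
    have "dip i ?C' d \<le> dip i ?C' e \<and> (e < d \<longrightarrow> dip i ?C' d < dip i ?C' e)" for e
      using le[of e] lt[of e] by (auto simp: dp)
    then have "fsel i ?C' d" using d1 by (simp add: fsel_def)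
    moreover have rK: "row ?K' i = row ?K (Suc i)" using bH[of "Suc i"] by (auto simp: below_Suc w)
    have bL: "below (hk ?L) (Suc i) < row ?K (Suc i)" using adjD(1)[OF aL B(2)] .
    then have "\<not> spill i ?K' ?L" unfolding spill_def rK by (auto simp: below_Suc w)
    then have "f_move i d ?C' = C"
      using i0 B(2) ih by (auto simp: f_move_def Let_def fun_eq_iff intro!: column_eqI)
    moreover have "valid ?C'"
    proof (rule valid_upd1[OF v d1])
      show "wfcol ?K'" using wf i by (auto simp: wfcol_def ents_def)
      show "card (hk ?K') = card (hk ?K)" using card_swap[OF w(2) _ ih] by simp
      \<comment> \<open>Lowering a hook entry \<open>i + 1\<close> endangers only an
        \<open>i + 1\<close> of the left column. That column has no unpaired plus, so an
        \<open>i\<close> accompanies it. Either \<open>i + 1\<close> opens a higher row there, and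
        the condition for \<open>i\<close> suffices, or its row differs from the critical one, as
        (S) does not apply.\<close>
      have uJ: "up i ?J = 0" using u uK by simp
      have J: "Suc i \<notin># am ?J" "Suc i \<in> lg ?J \<Longrightarrow> i \<in> ents ?J"
        using uJ by (auto simp: up_def ents_def not_in_iff of_bool_def split: if_splits)
      have "below ?H v < row ?J v" if vJ: "v \<in> ents ?J" for v
      proof (cases "Suc i \<in> hk ?K \<and> v = Suc i")
        case True
        then have vl: "Suc i \<in> lg ?J" using vJ J by (auto simp: ents_def)
        have b1: "below (hk ?K) (Suc i) < row ?J (Suc i)" using adjD(1)[OF aJ vl] .
        have b2: "below (hk ?K) i < row ?J i" using aJ J(2)[OF vl] by (auto simp: adj_def)
        show ?thesis
        proof (cases "Suc i \<in> hk ?J")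
          case True2: True
          then show ?thesis using b2 True ih bH[of v] by (simp add: below_Suc w)
        next
          case False
          then have "row ?J (Suc i) \<noteq> row ?K (Suc i)" using B(3) vl by blast
          moreover have "row ?K (Suc i) = Suc (below (hk ?K) (Suc i))" using True by (simp add: below_Suc[of _ "Suc i"] w)
          ultimately show ?thesis using b1 True bH[of v] by simp
        qed
      next
        case False then show ?thesis using bH[of v] aJ vJ by (auto simp: adj_def)
      qed
      then show "adj ?J ?K'" by (simp add: adj_def)
      have bi: "below (hk ?L) i < row ?K' i"
        unfolding rK using bL below_mono[OF w(2), of i "Suc i" "Suc d"] by simp
      show "adj ?K' ?L"
      proof (rule adj_ge[OF aL])
        show "row ?K x \<le> row ?K' x" for x using bH[of "Suc x"] by simp
        show "x \<in> ents ?K \<or> below (hk ?L) x < row ?K' x" if "x \<in> ents ?K'" for x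
          using that bi by (cases "x = i") (auto simp: ents_def)
      qed
    qed
    ultimately show ?thesis unfolding C' by blast
  qed
qed

section \<open>Bumping on columns\<close>

text \<open>
  \<open>kset L a\<close> is empty or consists of the entry bumped by \<open>a\<close>; \<open>inrow\<close> is case (b), in which \<open>a\<close> arrives in
  its own row and takes the leg entries \<open>moved\<close> along.
\<close>

definition kset :: "column \<Rightarrow> nat \<Rightarrow> nat set" where
  "kset L a = {k \<in> lg L. a \<le> k \<and> (\<forall>v \<in> lg L. a \<le> v \<longrightarrow> k \<le> v)}"

text \<open>The bumped entry sits in row \<open>below (hk L) a\<close>, or one row higher if it is a
  hook entry; a new cell is also one row higher. By the row condition the row of \<open>a\<close>
  exceeds \<open>below (hk L) a\<close>, so the two rows can agree only in this way.\<close>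

definition inrow :: "column \<Rightarrow> column \<Rightarrow> nat \<Rightarrow> bool" where
  "inrow K L a \<longleftrightarrow> kset L a \<subseteq> hk L \<and> Suc (below (hk L) a) = row K a"

definition moved :: "column \<Rightarrow> column \<Rightarrow> nat \<Rightarrow> nat set" where
  "moved K L a = {x \<in> lg K. a < x \<and> row K x = row K a \<and> inrow K L a}"

definition btop :: "column \<Rightarrow> nat \<Rightarrow> nat set" where
  "btop L a = (if kset L a \<subseteq> hk L then insert a (hk L - kset L a) else hk L)"

definition src :: "column \<Rightarrow> column \<Rightarrow> nat \<Rightarrow> column" where
  "src K L a = Col (hk K) (lg K - moved K L a) (am K - {#a#})"

definition dst :: "column \<Rightarrow> column \<Rightarrow> nat \<Rightarrow> column" where
  "dst K L a = Col (btop L a) (insert a (lg L - kset L a) \<union> moved K L a) (am L + mset_set (kset L a))"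

definition bump :: "nat \<Rightarrow> nat \<Rightarrow> (nat \<Rightarrow> column) \<Rightarrow> (nat \<Rightarrow> column)" where
  "bump c a C = C(c := src (C c) (C (Suc c)) a, Suc c := dst (C c) (C (Suc c)) a)"

text \<open>Different cells of a column have disjoint entries, so the largest arm letter determines
  its cell and no row has to be recorded.\<close>

definition bsel :: "(nat \<Rightarrow> column) \<Rightarrow> nat \<Rightarrow> nat \<Rightarrow> bool" where
  "bsel C c a \<longleftrightarrow> a \<in># am (C c) \<and> (\<forall>x \<in># am (C c). x \<le> a) \<and> (\<forall>e>c. am (C e) = {#})"

lemma kset_cases:
  obtains "kset L a = {}" "\<And>v. v \<in> lg L \<Longrightarrow> v < a"
  | k where "kset L a = {k}" "k \<in> lg L" "a \<le> k" "\<And>v. v \<in> lg L \<Longrightarrow> a \<le> v \<Longrightarrow> k \<le> v"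
proof (cases "\<exists>v \<in> lg L. a \<le> v")
  case True
  define k where "k = (LEAST v. v \<in> lg L \<and> a \<le> v)"
  have k: "k \<in> lg L" "a \<le> k" using True LeastI_ex[of "\<lambda>v. v \<in> lg L \<and> a \<le> v"] unfolding k_def by blast+
  have m: "k \<le> v" if "v \<in> lg L" "a \<le> v" for v unfolding k_def by (rule Least_le) (use that in blast)
  have "kset L a = {k}" using k m by (auto simp: kset_def intro: antisym)
  then show ?thesis using that(2) k m by blast
next
  case False
  then have "kset L a = {}" by (auto simp: kset_def)
  then show ?thesis using that(1) False not_le by blast
qed

lemma ksetD: "k \<in> kset L a \<Longrightarrow> k \<in> lg L" "k \<in> kset L a \<Longrightarrow> a \<le> k"
    "k \<in> kset L a \<Longrightarrow> v \<in> lg L \<Longrightarrow> a \<le> v \<Longrightarrow> k \<le> v"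
  by (auto simp: kset_def)

lemma kset_unique: "k \<in> kset L a \<Longrightarrow> kset L a = {k}"
  by (auto simp: kset_def intro: antisym)

lemma ksetI: "k \<in> lg L \<Longrightarrow> a \<le> k \<Longrightarrow> (\<And>v. v \<in> lg L \<Longrightarrow> a \<le> v \<Longrightarrow> k \<le> v) \<Longrightarrow> k \<in> kset L a"
  by (simp add: kset_def)

lemma finite_kset [simp]: "finite (kset L a)"
  by (cases rule: kset_cases[of L a]) auto

lemma count_kset: "count (mset_set (kset L a)) x = of_bool (x \<in> kset L a)"
  by (simp add: count_mset_set')

text \<open>A missing bumped entry behaves like a hook entry at infinity, so that one formula covers
  the new cell and the replaced hook entry: the hook entry slides down from \<open>k\<close> to
  \<open>a\<close>.\<close>

lemma below_btop:
  assumes "wfcol L"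
  shows "below (btop L a) v = below (hk L) v + of_bool (kset L a \<subseteq> hk L \<and> a < v \<and> (\<forall>k \<in> kset L a. v \<le> k))"
proof (cases rule: kset_cases[of L a])
  case 1
  then have "a \<notin> hk L" using wfcolD(3)[OF assms] by blast
  then show ?thesis using 1(1) below_insert[OF wfcolD(2)[OF assms]] by (simp add: btop_def)
next
  case (2 k)
  show ?thesis
  proof (cases "k \<in> hk L \<and> k \<noteq> a")
    case True
    then have "a \<notin> hk L" using 2 wfcolD(3)[OF assms] by (metis le_antisym order_refl)
    then show ?thesis
      using 2 True below_swap[OF wfcolD(2)[OF assms], of k a v] by (auto simp: btop_def of_bool_def split: if_splits)
  next
    case False
    then show ?thesis using 2(1) by (auto simp: btop_def insert_absorb)
  qed
qed

text \<open>Otherwise the bumped hook entry would be smaller than \<open>x\<close>, and the count of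
  hook entries below \<open>x\<close> would reach the row of \<open>x\<close>, against the row
  condition. Hence the moved leg entries fit under the old entries of the cell that receives
  them.\<close>

lemma moved_bound:
  assumes "adj K L" "wfcol L" "x \<in> moved K L a" "h \<in> lg L" "a \<le> h" shows "x \<le> h"
proof (rule ccontr)
  assume n: "\<not> x \<le> h"
  from assms(4,5) obtain k where k: "k \<in> kset L a" "k \<le> h"
    by (cases rule: kset_cases[of L a]) force+
  have "k \<in> hk L" using assms(3) k by (auto simp: moved_def inrow_def)
  then have "below (hk L) a < below (hk L) x"
    using below_strict[OF wfcolD(2)[OF assms(2)], of k a x] k n ksetD(2)[OF k(1)] by auto
  moreover have "below (hk L) x < row K x" using assms(3) by (intro adjD(1)[OF assms(1)]) (auto simp: moved_def)
  ultimately show False using assms(3) by (auto simp: moved_def inrow_def)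
qed

text \<open>\<open>S\<close> and \<open>D\<close> are the columns that replace \<open>K\<close> and
  \<open>L\<close>; the column \<open>X\<close> after them matters only through row
  conditions.\<close>

locale bumping =
  fixes C :: "nat \<Rightarrow> column" and c a :: nat
  assumes v: "valid C" and b: "bsel C c a"
begin

abbreviation "K \<equiv> C c"
abbreviation "L \<equiv> C (Suc c)"
abbreviation "X \<equiv> C (Suc (Suc c))"
abbreviation "S \<equiv> src K L a"
abbreviation "D \<equiv> dst K L a"
abbreviation "B \<equiv> bump c a C"

lemma wK: "wfcol K" and wL: "wfcol L" and wX: "wfcol X"
  using validD(1)[OF v] by auto

lemmas fK = wfcolD(2)[OF wK] and fL = wfcolD(2)[OF wL] and fX = wfcolD(2)[OF wX]

lemma aK: "adj K L" and aL: "adj L X"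
  using validD(2)[OF v] by auto

lemma a_in: "a \<in># am K" and a_max: "x \<in># am K \<Longrightarrow> x \<le> a" and amL: "am L = {#}"
  using b by (auto simp: bsel_def)

lemma c1: "1 \<le> c"
  using a_in valid_0[OF v] by (cases c) auto

lemma aKa: "below (hk L) a < row K a"
  using adjD(2)[OF aK a_in] .

lemma no_gap: "(\<And>k. k \<in> kset L a \<Longrightarrow> w \<le> k) \<Longrightarrow> a \<le> w \<Longrightarrow> below (hk L) w = below (hk L) a"
proof -
  assume w: "\<And>k. k \<in> kset L a \<Longrightarrow> w \<le> k" "a \<le> w"
  have "\<not> (a \<le> h \<and> h < w)" if "h \<in> hk L" for h
    using wfcolD(3)[OF wL that] w(1) by (cases rule: kset_cases[of L a]) force+
  then show ?thesis using below_gap[OF fL w(2)] by auto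
qed

lemma movedD: "x \<in> moved K L a \<Longrightarrow> x \<in> lg K" "x \<in> moved K L a \<Longrightarrow> a < x" "x \<in> moved K L a \<Longrightarrow> row K x = row K a"
    "x \<in> moved K L a \<Longrightarrow> kset L a \<subseteq> hk L" "x \<in> moved K L a \<Longrightarrow> Suc (below (hk L) a) = row K a"
  by (auto simp: moved_def inrow_def)

lemma moved_le: "x \<in> moved K L a \<Longrightarrow> h \<in> lg L \<Longrightarrow> a \<le> h \<Longrightarrow> x \<le> h"
  by (rule moved_bound[OF aK wL])

lemma moved_down: assumes "x \<in> moved K L a" "y \<in> lg K" "a < y" "y \<le> x" shows "y \<in> moved K L a"
proof -
  have "row K a \<le> row K y" "row K y \<le> row K x" using assms below_mono[OF fK] by auto
  then show ?thesis using assms by (auto simp: moved_def)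
qed

text \<open>If \<open>a\<close> opens a new cell, its row exceeds the height of \<open>X\<close>;
  otherwise it enters a cell whose entry \<open>k\<close> already satisfies the condition, and with
  it every \<open>w\<close> up to \<open>k\<close>. Two variables are kept because the bound is
  applied to an entry of \<open>D\<close> itself and also to a raise, with \<open>y = i\<close> and
  \<open>w = i + 1\<close>.\<close>

lemma below_X:
  assumes "\<And>k. k \<in> kset L a \<Longrightarrow> w \<le> k" "a \<le> y"
  shows "below (hk X) w < row D y"
proof -
  have R: "row D y = row L y + of_bool (kset L a \<subseteq> hk L \<and> (\<forall>k \<in> kset L a. y < k))"
    using below_btop[OF wL, of a "Suc y"] assms(2) by (simp add: dst_def Suc_le_eq)
  show ?thesis
  proof (cases rule: kset_cases[of L a])
    case 1
    have "below (hk L) y = card (hk L)"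
      by (rule below_eq_card) (use 1 wfcolD(3)[OF wL] assms(2) in \<open>force\<close>)
    moreover have "below (hk X) w \<le> card (hk L)"
      using below_le_card[OF fX, of w] validD(4)[OF v, of "Suc c"] by simp
    ultimately show ?thesis using R 1 below_mono[OF fL, of y "Suc y"] by simp
  next
    case (2 k)
    have "below (hk X) w \<le> below (hk X) k" using below_mono[OF fX] assms(1) 2 by simp
    then have lt: "below (hk X) w < row L k" using adjD(1)[OF aL 2(2)] by simp
    show ?thesis
    proof (cases "y < k")
      case True
      have "below (hk L) k = below (hk L) a" by (rule no_gap) (use 2 in auto)
      then have "row L k = below (hk L) a + of_bool (k \<in> hk L)" by (simp add: below_Suc fL)
      moreover have "below (hk L) a \<le> row L y" using below_mono[OF fL] assms(2) by simp
      ultimately show ?thesis using R lt 2(1) True by simp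
    next
      case False
      then have "row L k \<le> row L y" using below_mono[OF fL] by simp
      then show ?thesis using R lt by simp
    qed
  qed
qed

lemma row_D_ge: "row L x \<le> row D x"
  using below_btop[OF wL, of a "Suc x"] by (simp add: dst_def)

lemma card_D: "card (hk D) = card (hk L) + of_bool (kset L a = {})"
proof (cases rule: kset_cases[of L a])
  case 1
  then have "a \<notin> hk L" using wfcolD(3)[OF wL] by blast
  then show ?thesis using 1 fL by (simp add: dst_def btop_def)
next
  case (2 k)
  then have "a \<notin> hk L \<or> k = a" using wfcolD(3)[OF wL] by (metis le_antisym order_refl)
  moreover have "insert a (hk L - {a}) = hk L" if "a \<in> hk L" using that by blast
  ultimately show ?thesis using 2 card_swap[OF fL, of k a] by (auto simp: dst_def btop_def)
qed

text \<open>The delicate condition is that between \<open>S\<close> and \<open>D\<close>: hook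
  counts of \<open>D\<close> grow on thresholds above \<open>a\<close> and up to \<open>k\<close>,
  so leg entries of \<open>K\<close> in this range need a spare row. Those without one are exactly
  the entries that case (b) moves.\<close>

lemma valid_bump: "valid B"
proof -
  have "adj (C (c - 1)) S"
    using validD(2)[OF v, of "c - 1"] c1 by (cases c) (auto simp: src_def adj_def)
  moreover have "adj S D"
    unfolding adj_def
  proof
    fix x assume x: "x \<in> ents S"
    then have xK: "below (hk L) x < row K x" using aK
      by (auto simp: adj_def src_def ents_def dest: in_diffD)
    show "below (hk D) x < row S x"
    proof (cases "kset L a \<subseteq> hk L \<and> a < x \<and> (\<forall>k \<in> kset L a. x \<le> k)")
      case True
      have nm: "x \<in> lg K" "x \<notin> moved K L a" using x a_max[of x] True by (auto simp: src_def ents_def dest: in_diffD)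
      have eq: "below (hk L) x = below (hk L) a" by (rule no_gap) (use True in auto)
      have "row K a \<le> row K x" using True below_mono[OF fK] by simp
      then have "Suc (below (hk L) a) < row K x" using aKa nm True by (force simp: moved_def inrow_def)
      then show ?thesis using True eq below_btop[OF wL, of a x] by (simp add: src_def dst_def)
    next
      case False
      have "below (btop L a) x = below (hk L) x"
        unfolding below_btop[OF wL] by (simp only: False of_bool_eq add_0_right)
      then show ?thesis using xK by (simp add: src_def dst_def)
    qed
  qed
  moreover have "adj D X"
    unfolding adj_def
  proof
    fix x assume x: "x \<in> ents D"
    then consider "x = a" | "x \<in> moved K L a" | "x \<in> kset L a" | "x \<in> lg L"
      by (auto simp: dst_def ents_def amL)
    then show "below (hk X) x < row D x"
    proof cases
      case 2
      then show ?thesis using below_X[of x x] moved_le[OF 2] movedD[OF 2] ksetD by (metis less_imp_le)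
    next
      case 4
      then show ?thesis using adjD(1)[OF aL 4] row_D_ge[of x] by simp
    qed (use below_X[of x x] ksetD in auto)
  qed
  moreover have wS: "wfcol S"
  proof -
    \<comment> \<open>A hook entry larger than \<open>a\<close> opens a row above that of
      \<open>a\<close>, so it is never moved.\<close>
    have "h \<notin> moved K L a" if "h \<in> hk K" for h
      using below_strict[OF fK that, of "Suc a" "Suc h"] by (auto simp: moved_def)
    then show ?thesis using wK by (auto simp: wfcol_def src_def ents_def dest: in_diffD)
  qed
  moreover have "wfcol D"
  proof -
    have "moved K L a \<subseteq> lg K" by (auto simp: moved_def)
    moreover have "a > 0" using a_in wfcolD(5)[OF wK] by (cases a) auto
    moreover have "hk L \<subseteq> lg L - kset L a" if "\<not> kset L a \<subseteq> hk L"
      using that wfcolD(3)[OF wL] by (cases rule: kset_cases[of L a]) auto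
    moreover have "0 \<notin> kset L a" using ksetD(1) wfcolD(4)[OF wL] by blast
    ultimately show ?thesis using wK wL finite_subset[of "moved K L a" "lg K"] 
      by (auto simp: wfcol_def dst_def ents_def btop_def amL)
  qed
  moreover have "card (hk D) \<le> card (hk K)" "card (hk L) \<le> card (hk D)"
  proof -
    note card_D
    moreover have "card (hk L) < card (hk K)" if "kset L a = {}"
    proof -
      have "below (hk L) a = card (hk L)"
        by (rule below_eq_card) (use that wfcolD(3)[OF wL] in \<open>cases rule: kset_cases[of L a]; force\<close>)
      then show ?thesis using aKa below_le_card[OF fK, of "Suc a"] by simp
    qed
    moreover have "card (hk L) \<le> card (hk K)" using validD(4)[OF v c1] .
    ultimately show "card (hk D) \<le> card (hk K)" "card (hk L) \<le> card (hk D)" by (auto simp: Suc_le_eq)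
  qed
  ultimately show ?thesis
    unfolding bump_def using validD(4)[OF v, of "Suc c"]
    by (intro valid_upd2[OF v c1]) (auto simp: src_def)
qed

lemma lg_S: "x \<in> lg S \<longleftrightarrow> x \<in> lg K \<and> x \<notin> moved K L a"
  and lg_D: "x \<in> lg D \<longleftrightarrow> x = a \<or> x \<in> lg L \<and> x \<notin> kset L a \<or> x \<in> moved K L a"
  and am_S: "count (am S) x = count (am K) x - of_bool (x = a)"
  and am_D: "count (am D) x = of_bool (x \<in> kset L a)"
  by (auto simp: src_def dst_def amL count_kset)

lemma cK: "a < x \<Longrightarrow> count (am K) x = 0" and cKa: "count (am K) a > 0"
  using a_max[of x] a_in by (auto simp: not_in_iff[symmetric])

lemma ksetL: "x \<in> lg L \<Longrightarrow> a \<le> x \<Longrightarrow> (\<And>y. y \<in> lg L \<Longrightarrow> a \<le> y \<Longrightarrow> \<not> y < x) \<Longrightarrow> x \<in> kset L a"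
  by (rule ksetI) (auto simp: not_less)

text \<open>The quantity in the first equation is the number of unpaired minuses of the two columns
  together, that is, the depth of the sign path over them; the second equation is equality of total
  heights, written without subtraction. Letters change only between \<open>a\<close> and the bumped
  entry, which leaves five positions of \<open>i\<close> relative to this window.\<close>

lemma bump_signs:
  shows "um i S + (um i D - up i S) = um i K + (um i L - up i K)"
    and "up i S + up i D + um i K + um i L = up i K + up i L + um i S + um i D"
proof -
  note m = um_def up_def lg_S lg_D am_S am_D amL
  obtain n where n: "count (am K) a = Suc n" using cKa gr0_implies_Suc by blast
  have mvle: "x \<in> moved K L a \<Longrightarrow> a \<le> h \<Longrightarrow> h < x \<Longrightarrow> h \<notin> lg L" for x h using moved_le[of x h] by auto
  consider (1) "Suc i < a" | (2) "a = Suc i" | (3) "a = i" | (4) "a < i" "\<exists>k \<in> kset L a. k < i"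
    | (5) "a < i" "\<forall>k \<in> kset L a. i \<le> k" by fastforce
  then have "um i S + (um i D - up i S) = um i K + (um i L - up i K) \<and>
      up i S + up i D + um i K + um i L = up i K + up i L + um i S + um i D"
  proof cases
    case 1
    then have "i \<notin> moved K L a" "Suc i \<notin> moved K L a" "i \<notin> kset L a" "Suc i \<notin> kset L a" "i \<noteq> a" "Suc i \<noteq> a"
      using movedD(2) ksetD(2) by fastforce+
    then show ?thesis by (simp add: m)
  next
    case 2
    then have "i \<notin> moved K L a" "Suc i \<notin> moved K L a" "i \<notin> kset L a" "i \<noteq> a" "Suc i = a"
      using movedD(2) ksetD(2) by fastforce+
    moreover have "Suc i \<in> kset L a \<longleftrightarrow> Suc i \<in> lg L" using 2 by (auto simp: kset_def)
    ultimately show ?thesis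
      by (cases "i \<in> lg K"; cases "Suc i \<in> lg K"; cases "i \<in> lg L"; cases "Suc i \<in> lg L"; simp add: m n)
  next
    case 3
    then have "i \<notin> moved K L a" "i = a" "Suc i \<noteq> a" using movedD(2) by fastforce+
    moreover have "i \<in> kset L a \<longleftrightarrow> i \<in> lg L" "Suc i \<in> kset L a \<longleftrightarrow> Suc i \<in> lg L \<and> i \<notin> lg L"
      using 3 by (force simp: kset_def le_Suc_eq Suc_le_eq order.strict_iff_order)+
    moreover have "Suc i \<in> moved K L a \<Longrightarrow> Suc i \<in> lg K \<and> i \<notin> lg L" using movedD(1) mvle 3 by auto
    moreover have "count (am K) (Suc i) = 0" using 3 cK by simp
    ultimately show ?thesis
      by (cases n; cases "Suc i \<in> moved K L a"; cases "i \<in> lg K"; cases "Suc i \<in> lg K"; cases "i \<in> lg L"; cases "Suc i \<in> lg L"; simp add: m n)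
  next
    case 4
    then obtain k where k: "k \<in> kset L a" "k < i" by blast
    then have "i \<notin> moved K L a" "Suc i \<notin> moved K L a" "i \<notin> kset L a" "Suc i \<notin> kset L a"
      using moved_le[OF _ ksetD(1,2)[OF k(1)], of i] moved_le[OF _ ksetD(1,2)[OF k(1)], of "Suc i"]
        kset_unique[OF k(1)] by auto
    then show ?thesis using 4 by (simp add: m)
  next
    case 5
    have ck: "count (am K) i = 0" "count (am K) (Suc i) = 0" using 5 cK by auto
    have ge: "i \<le> x" if "x \<in> lg L" "a \<le> x" for x
      using that 5(2) by (cases rule: kset_cases[of L a]) force+
    have "i \<in> kset L a \<longleftrightarrow> i \<in> lg L" using 5 ge by (auto simp: kset_def)
    moreover have "Suc i \<in> kset L a \<longleftrightarrow> Suc i \<in> lg L \<and> i \<notin> lg L"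
      using 5 ge by (auto simp: kset_def Suc_le_eq order.strict_iff_order)
    moreover have "i \<noteq> a" "Suc i \<noteq> a" using 5 by auto
    \<comment> \<open>The moved letters form an initial segment of the leg entries above
      \<open>a\<close> and do not pass an entry of \<open>L\<close>, so four patterns for
      \<open>i\<close> and \<open>i + 1\<close> remain.\<close>
    moreover have "i \<notin> moved K L a \<and> Suc i \<notin> moved K L a \<or> i \<in> moved K L a \<and> Suc i \<notin> moved K L a \<and> i \<in> lg K
      \<or> i \<notin> moved K L a \<and> Suc i \<in> moved K L a \<and> Suc i \<in> lg K \<and> i \<notin> lg L \<and> i \<notin> lg K
      \<or> i \<in> moved K L a \<and> Suc i \<in> moved K L a \<and> i \<in> lg K \<and> Suc i \<in> lg K \<and> i \<notin> lg L"
      using movedD(1) mvle[of "Suc i" i] moved_down[of "Suc i" i] 5 by auto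
    ultimately show ?thesis using ck
      by (elim disjE conjE; cases "i \<in> lg K"; cases "Suc i \<in> lg K"; cases "i \<in> lg L"; cases "Suc i \<in> lg L"; simp add: m)
  qed
  then show "um i S + (um i D - up i S) = um i K + (um i L - up i K)"
    and "up i S + up i D + um i K + um i L = up i K + up i L + um i S + um i D" by auto
qed

end

section \<open>Bumping commutes with the lowering move\<close>

text \<open>The effects of the lowering move on its column and on the next one are separated, so
  that commutation can be checked column by column.\<close>

definition f_left :: "nat \<Rightarrow> column \<Rightarrow> column \<Rightarrow> column" where
  "f_left i K L = (if spill i K L then Col (hk K) (insert (Suc i) (lg K)) (am K)
     else if i \<in># am K then Col (hk K) (lg K) (add_mset (Suc i) (am K - {#i#}))
     else Col (if i \<in> hk K then insert (Suc i) (hk K - {i}) else hk K)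
              (insert (Suc i) (lg K - {i})) (am K))"

definition f_right :: "nat \<Rightarrow> column \<Rightarrow> column \<Rightarrow> column" where
  "f_right i K L = (if spill i K L then Col (insert (Suc i) (hk L - {i})) (lg L - {i}) (am L) else L)"

lemma f_move_eq: "f_move i d C = C(d := f_left i (C d) (C (Suc d)), Suc d := f_right i (C d) (C (Suc d)))"
  by (auto simp: f_move_def Let_def f_left_def f_right_def fun_eq_iff)

lemma f_left_spill: "spill i K L \<Longrightarrow> f_left i K L = Col (hk K) (insert (Suc i) (lg K)) (am K)"
  and f_left_arm: "\<not> spill i K L \<Longrightarrow> i \<in># am K \<Longrightarrow> f_left i K L = Col (hk K) (lg K) (add_mset (Suc i) (am K - {#i#}))"
  and f_left_leg: "\<not> spill i K L \<Longrightarrow> i \<notin># am K \<Longrightarrow> f_left i K L =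
    Col (if i \<in> hk K then insert (Suc i) (hk K - {i}) else hk K) (insert (Suc i) (lg K - {i})) (am K)"
  by (simp_all add: f_left_def)

lemma f_right_spill: "spill i K L \<Longrightarrow> f_right i K L = Col (insert (Suc i) (hk L - {i})) (lg L - {i}) (am L)"
  and f_right_keep: "\<not> spill i K L \<Longrightarrow> f_right i K L = L"
  by (simp_all add: f_right_def)

lemma am_f_right [simp]: "am (f_right i K L) = am L"
  by (simp add: f_right_def)

text \<open>An \<open>i + 1\<close> already present, lying in the row of \<open>i\<close> if it is
  no hook entry, satisfies the very condition that a raised \<open>i\<close> would have to
  satisfy.\<close>

lemma no_spill: assumes "adj M X" "wfcol M" "wfcol X" "Suc i \<in> ents M" shows "\<not> spill i M X"
proof
  assume s: "spill i M X"
  have "below (hk X) (Suc i) < row M (Suc i)" using assms by (auto simp: adj_def)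
  then show False using s wfcolD(2)[OF assms(2)] wfcolD(2)[OF assms(3)] by (auto simp: spill_def below_Suc)
qed

lemma kset_cong:
  assumes "\<And>x. a \<le> x \<Longrightarrow> (\<And>k. k \<in> kset L a \<Longrightarrow> x \<le> k) \<Longrightarrow> x \<in> lg L' \<longleftrightarrow> x \<in> lg L"
  shows "kset L' a = kset L a"
proof (cases rule: kset_cases[of L a])
  case 1
  then have "x \<in> lg L' \<longleftrightarrow> x \<in> lg L" if "a \<le> x" for x using assms[OF that] by auto
  then show ?thesis by (auto simp: kset_def)
next
  case (2 k)
  then have "x \<in> lg L' \<longleftrightarrow> x \<in> lg L" if "a \<le> x" "x \<le> k" for x using assms[OF that(1)] that by auto
  then have "k \<in> kset L' a" using 2 by (intro ksetI) (auto, meson le_cases)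
  then show ?thesis using 2(1) kset_unique by metis
qed

context bumping
begin

lemma dip_B:
  "dip i B e = (if e = c then dip i C c + int (um i K) - int (um i S)
     else if e = Suc c then dip i C c + int (um i K) - int (um i S) + int (up i S) - int (um i D)
     else dip i C e)"
  using bump_signs(2)[of i] dip_Suc[of i C c]
  by (auto simp: bump_def dip_upd)

lemma min_dip_B: "min (dip i B c) (dip i B (Suc c)) = min (dip i C c) (dip i C (Suc c))"
  using bump_signs(1)[of i] dip_Suc[of i C c] by (auto simp: dip_B min_def)

lemma fsel_far:
  assumes "fsel i C d" "d \<noteq> c" "d \<noteq> Suc c" shows "fsel i B d"
proof -
  have d: "dip i B d = dip i C d" using assms by (simp add: dip_B)
  have "dip i C d \<le> dip i B e \<and> (e < d \<longrightarrow> dip i C d < dip i B e)" for e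
  proof (cases "e = c \<or> e = Suc c")
    case True
    have "dip i C d \<le> min (dip i C c) (dip i C (Suc c))" using assms by (auto simp: fsel_def)
    moreover have "dip i C d < min (dip i C c) (dip i C (Suc c))" if "e < d"
      using assms True that by (auto simp: fsel_def)
    ultimately show ?thesis using True unfolding min_dip_B[symmetric] by auto
  next
    case False
    then show ?thesis using assms by (auto simp: fsel_def dip_B)
  qed
  then show ?thesis using assms(1) d by (simp add: fsel_def)
qed

text \<open>The minimum over the two columns and all other dips are unchanged, so the move still
  acts in one of the two; the comparison decides where the minimum is reached first. This need not
  be the former column \<open>d\<close>.\<close>

lemma fsel_near:
  assumes "fsel i C d" "d = c \<or> d = Suc c"
  shows "fsel i B (if um i D \<le> up i S then c else Suc c)"
proof -
  let ?m = "min (dip i C c) (dip i C (Suc c))"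
  let ?d = "if um i D \<le> up i S then c else Suc c"
  have d: "dip i B ?d = ?m" unfolding min_dip_B[symmetric] by (auto simp: dip_B min_def)
  have m: "?m = dip i C d" using assms unfolding fsel_def by (metis min_def antisym)
  have "?m \<le> dip i B e \<and> (e < ?d \<longrightarrow> ?m < dip i B e)" for e
  proof (cases "e = c \<or> e = Suc c")
    case True
    have "?m \<le> dip i B e" using True unfolding min_dip_B[symmetric] by auto
    moreover have "?m < dip i B e" if "e < ?d"
    proof -
      have "e = c" "\<not> um i D \<le> up i S" using True that by (auto split: if_splits)
      then show ?thesis unfolding min_dip_B[symmetric] by (auto simp: dip_B)
    qed
    ultimately show ?thesis by blast
  next
    case False
    then have "e < ?d \<Longrightarrow> e < d" using assms(2) by (auto split: if_splits)
    then show ?thesis using assms(1) False unfolding m by (auto simp: fsel_def dip_B)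
  qed
  then show ?thesis using c1 d unfolding fsel_def by auto
qed

lemma near_c: assumes "fsel i C c" shows "um i K > 0" "um i L \<le> up i K"
  using fsel_um[OF assms] by auto

lemma near_Sc: assumes "fsel i C (Suc c)" shows "um i L > up i K"
proof -
  have "dip i C (Suc c) < dip i C c" using assms by (simp add: fsel_def)
  then show ?thesis by (simp add: dip_Suc)
qed

text \<open>Both \<open>a'\<close> and \<open>d'\<close> may differ from \<open>a\<close> and
  \<open>d\<close>: if the raised letter is \<open>a\<close> itself, \<open>i + 1\<close> takes its
  place as bumping letter, and if it has been carried to column \<open>c + 1\<close>, the move
  follows it.\<close>

definition commutes :: "nat \<Rightarrow> nat \<Rightarrow> bool" where
  "commutes i d \<longleftrightarrow> (\<exists>a' d'. bsel (f_move i d C) c a' \<and> fsel i B d' \<and> f_move i d' B = bump c a' (f_move i d C))"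

lemma S_simps [simp]: "hk S = hk K" "hk D = btop L a"
  by (simp_all add: src_def dst_def)

text \<open>The only interaction is (S) in column \<open>c - 1\<close>, which turns a hook entry
  \<open>i\<close> of \<open>K\<close> into \<open>i + 1\<close>. There the arms of \<open>K\<close>
  contain no \<open>i\<close>, so \<open>a \<noteq> i\<close>, and a hook entry is never moved;
  hence the bump takes place as before.\<close>

lemma commutes_far:
  assumes f: "fsel i C d" and d: "d \<noteq> c" "d \<noteq> Suc c"
  shows "commutes i d"
proof -
  have bs: "bsel (f_move i d C) c a"
    using b d by (auto simp: bsel_def f_move_eq f_left_def)
  have "f_move i d B = bump c a (f_move i d C)"
  proof (cases "Suc d = c")
    case True
    let ?J = "C d"
    have f_left: "f_left i ?J S = f_left i ?J K" by (simp add: f_left_def spill_def)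
    have eq: "f_right i ?J S = src (f_right i ?J K) L a \<and> D = dst (f_right i ?J K) L a"
    proof (cases "spill i ?J K")
      case False
      moreover have "\<not> spill i ?J S" using False unfolding spill_def by simp
      ultimately show ?thesis by (simp add: f_right_def)
    next
      case True': True
      have s: "Suc i \<in> lg K" "i \<notin># am K" "Suc i \<notin> hk K" "i \<in> lg K"
        using spill_facts[OF v f] True' True by auto
      have ih: "i \<in> hk K" using True' by (simp add: spill_def)
      let ?K' = "Col (insert (Suc i) (hk K - {i})) (lg K - {i}) (am K)"
      have r: "row ?K' x = row K x" if "x \<noteq> i" for x using below_flip[OF fK ih s(3)] that by simp
      have ai: "a \<noteq> i" using a_in s by auto
      have "\<not> (a < i \<and> row K i = row K a)" using below_strict[OF fK ih, of "Suc a" "Suc i"] by auto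
      then have nm: "i \<notin> moved K L a" by (auto simp: moved_def)
      have "x \<in> moved ?K' L a \<longleftrightarrow> x \<in> moved K L a" for x
        using r[of x] r[OF ai] nm by (cases "x = i") (auto simp: moved_def inrow_def)
      then have "moved ?K' L a = moved K L a" by blast
      moreover have "spill i ?J S" using True' by (simp add: spill_def)
      ultimately show ?thesis using True' by (auto simp: f_right_def src_def dst_def)
    qed
    show ?thesis using True d eq f_left unfolding bump_def f_move_eq by (auto simp: fun_eq_iff)
  next
    case False
    then show ?thesis using d unfolding bump_def f_move_eq by (auto simp: fun_eq_iff)
  qed
  then show ?thesis using bs fsel_far[OF f d] unfolding commutes_def by blast
qed

text \<open>One rule for each pattern that occurs: the two letters at the end of the name give the
  column of the move before and after bumping, \<open>c\<close> or its successor. A move in column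
  \<open>c + 1\<close> never passes to column \<open>c\<close>.\<close>

lemma commutes_cc:
  assumes "fsel i C c" "um i D \<le> up i S" "bsel (f_move i c C) c a'"
    "f_left i S D = src (f_left i K L) (f_right i K L) a'" "f_right i S D = dst (f_left i K L) (f_right i K L) a'"
  shows "commutes i c"
proof -
  have "fsel i B c" using fsel_near[OF assms(1)] assms(2) by simp
  moreover have "f_move i c B = bump c a' (f_move i c C)"
    using assms(4,5) unfolding bump_def f_move_eq by (auto simp: fun_eq_iff)
  ultimately show ?thesis using assms(3) unfolding commutes_def by blast
qed

lemma commutes_cS:
  assumes "fsel i C c" "\<not> um i D \<le> up i S" "bsel (f_move i c C) c a'" "\<not> spill i D X"
    "S = src (f_left i K L) (f_right i K L) a'" "f_left i D X = dst (f_left i K L) (f_right i K L) a'"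
  shows "commutes i c"
proof -
  have "fsel i B (Suc c)" using fsel_near[OF assms(1)] assms(2) by simp
  moreover have "f_right i D X = X" using assms(4) by (simp add: f_right_def)
  then have "f_move i (Suc c) B = bump c a' (f_move i c C)"
    using assms(5,6) unfolding bump_def f_move_eq by (auto simp: fun_eq_iff)
  ultimately show ?thesis using assms(3) unfolding commutes_def by blast
qed

lemma commutes_SS:
  assumes "fsel i C (Suc c)" "\<not> um i D \<le> up i S"
    "S = src K (f_left i L X) a" "f_left i D X = dst K (f_left i L X) a" "spill i D X \<longleftrightarrow> spill i L X"
  shows "commutes i (Suc c)"
proof -
  have "fsel i B (Suc c)" using fsel_near[OF assms(1)] assms(2) by simp
  moreover have "bsel (f_move i (Suc c) C) c a"
    using b by (auto simp: bsel_def f_move_eq f_left_def)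
  moreover have "f_right i D X = f_right i L X" using assms(5) by (simp add: f_right_def)
  then have "f_move i (Suc c) B = bump c a (f_move i (Suc c) C)"
    using assms(3,4) unfolding bump_def f_move_eq by (auto simp: fun_eq_iff)
  ultimately show ?thesis unfolding commutes_def by blast
qed

lemma adj_DX: "adj D X" and wD: "wfcol D"
  using validD[OF valid_bump] validD(2)[OF valid_bump, of "Suc c"] validD(1)[OF valid_bump, of "Suc c"]
  by (auto simp: bump_def)

lemma no_spill_D: "Suc i \<in> ents D \<Longrightarrow> \<not> spill i D X"
  using no_spill[OF adj_DX wD wX] .

lemma no_spill_K: "Suc i \<in> ents K \<Longrightarrow> \<not> spill i K L"
  using no_spill[OF aK wK wL] .

text \<open>Here \<open>i\<close> is smaller than the bumped entry, so \<open>below_X\<close> still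
  applies to \<open>w = i + 1\<close>.\<close>

lemma no_spill_D': "i \<notin> kset L a \<Longrightarrow> \<forall>k \<in> kset L a. i \<le> k \<Longrightarrow> a \<le> i \<Longrightarrow> \<not> spill i D X"
proof
  assume a: "i \<notin> kset L a" "\<forall>k \<in> kset L a. i \<le> k" "a \<le> i" and s: "spill i D X"
  have "below (hk X) (Suc i) < row D i"
    by (rule below_X) (use a in \<open>auto simp: Suc_le_eq order.strict_iff_order\<close>)
  then show False using s by (auto simp: spill_def below_Suc fX)
qed

lemma btop_below: "v \<le> a \<or> (\<exists>k \<in> kset L a. k < v) \<Longrightarrow> below (btop L a) v = below (hk L) v"
  unfolding below_btop[OF wL] by (auto simp: not_le)

lemma moved_kset_le: "x \<in> moved K L a \<Longrightarrow> k \<in> kset L a \<Longrightarrow> x \<le> k"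
  using moved_le ksetD by blast

lemma hk_not_moved: "h \<in> hk K \<Longrightarrow> h \<notin> moved K L a"
  using below_strict[OF fK, of h "Suc a" "Suc h"] by (auto simp: moved_def)

lemma row_flip_K: "i \<in> hk K \<Longrightarrow> Suc i \<notin> hk K \<Longrightarrow> x \<noteq> i \<Longrightarrow> below (insert (Suc i) (hk K - {i})) (Suc x) = row K x"
  using below_flip[OF fK] by simp

section \<open>Letters \<open>i\<close> and \<open>i + 1\<close> outside the window from
  \<open>a\<close> to the bumped entry\<close>

definition sep :: "nat \<Rightarrow> bool" where
  "sep i \<longleftrightarrow> Suc i < a \<or> (\<exists>k \<in> kset L a. k < i)"

lemma sepD:
  assumes "sep i"
  shows "i \<notin> kset L a" "Suc i \<notin> kset L a" "i \<noteq> a" "Suc i \<noteq> a" "i \<notin> moved K L a" "Suc i \<notin> moved K L a"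
    "below (btop L a) i = below (hk L) i" "below (btop L a) (Suc i) = below (hk L) (Suc i)"
    "i \<in> btop L a \<longleftrightarrow> i \<in> hk L" "Suc i \<in> btop L a \<longleftrightarrow> Suc i \<in> hk L"
proof -
  show 1: "i \<notin> kset L a" "Suc i \<notin> kset L a" "i \<noteq> a" "Suc i \<noteq> a"
    using assms ksetD(2)[of _ L a] kset_unique[of _ L a] unfolding sep_def by fastforce+
  show "i \<notin> moved K L a" "Suc i \<notin> moved K L a"
    using assms moved_kset_le[of i] moved_kset_le[of "Suc i"] movedD(2)[of i] movedD(2)[of "Suc i"] unfolding sep_def by force+
  have "x \<le> a \<or> (\<exists>k \<in> kset L a. k < x)" if "x = i \<or> x = Suc i" for x
    using assms that unfolding sep_def by (auto intro: less_SucI)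
  then show "below (btop L a) i = below (hk L) i" "below (btop L a) (Suc i) = below (hk L) (Suc i)"
    by (simp_all add: btop_below)
  show "i \<in> btop L a \<longleftrightarrow> i \<in> hk L" "Suc i \<in> btop L a \<longleftrightarrow> Suc i \<in> hk L"
    using 1 by (auto simp: btop_def)
qed

lemma sep_kset: assumes "sep i" "\<And>x. x \<noteq> i \<Longrightarrow> x \<noteq> Suc i \<Longrightarrow> x \<in> lg L' \<longleftrightarrow> x \<in> lg L"
  shows "kset L' a = kset L a"
proof (rule kset_cong)
  fix x assume "a \<le> x" "\<And>k. k \<in> kset L a \<Longrightarrow> x \<le> k"
  then have "x \<noteq> i" "x \<noteq> Suc i" using assms(1) unfolding sep_def by force+
  then show "x \<in> lg L' \<longleftrightarrow> x \<in> lg L" using assms(2) by blast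
qed

lemma sep_um: assumes "sep i" shows "um i D = um i L" "up i S = up i K"
  using sepD[OF assms] by (simp_all add: um_def up_def lg_D lg_S am_D am_S amL)

lemma commutes_sep_spill:
  assumes f: "fsel i C c" and se: "sep i" and sp: "spill i K L"
  shows "commutes i c"
proof -
  note s = spill_facts[OF v f sp]
  note d = sepD[OF se]
  have ih: "i \<in> hk L" and sK: "Suc i \<notin> hk K" using sp by (auto simp: spill_def)
  let ?K' = "Col (hk K) (insert (Suc i) (lg K)) (am K)"
  let ?L' = "Col (insert (Suc i) (hk L - {i})) (lg L - {i}) (am L)"
  have f_left: "f_left i K L = ?K'" and f_right: "f_right i K L = ?L'" using sp by (simp_all add: f_left_def f_right_def)
  have sp': "spill i S D" using sp d by (simp add: spill_def)
  have ks: "kset ?L' a = kset L a" by (rule sep_kset[OF se]) auto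
  have ir: "inrow ?K' ?L' a = inrow K L a"
    using below_flip[OF fL ih s(5)] d ks by (auto simp: inrow_def)
  \<comment> \<open>Otherwise the new leg entry \<open>i + 1\<close> would be moved too. But the
    bumped hook entry \<open>k\<close>, with \<open>a \<le> k < i\<close>, is counted below
    \<open>i\<close> and not below \<open>a\<close>, so \<open>spill\<close> and
    \<open>inrow\<close> would disagree about the row.\<close>
  have "\<not> (a < Suc i \<and> row K (Suc i) = row K a \<and> inrow K L a)"
  proof
    assume x: "a < Suc i \<and> row K (Suc i) = row K a \<and> inrow K L a"
    then obtain k where k: "k \<in> kset L a" "k < i" "k \<in> hk L" using se by (auto simp: sep_def inrow_def)
    have "below (hk L) a < below (hk L) i" using below_strict[OF fL k(3), of a i] k ksetD(2)[OF k(1)] by simp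
    then show False using x sp sK by (simp add: spill_def inrow_def below_Suc[OF fK, of "Suc i"])
  qed
  then have moved: "moved ?K' ?L' a = moved K L a" unfolding moved_def ir by auto
  have bt: "btop ?L' a = insert (Suc i) (btop L a - {i})"
    using d s(5) unfolding btop_def ks by auto
  have bs: "bsel (f_move i c C) c a"
    using b unfolding f_move_eq f_left f_right by (auto simp: bsel_def)
  show ?thesis
  proof (rule commutes_cc[OF f _ bs])
    show "um i D \<le> up i S" using sep_um[OF se] near_c(2)[OF f] by simp
    show "f_left i S D = src (f_left i K L) (f_right i K L) a"
      unfolding f_left_spill[OF sp'] unfolding f_left f_right src_def moved using d by auto
    show "f_right i S D = dst (f_left i K L) (f_right i K L) a"
      unfolding f_right_spill[OF sp'] unfolding f_left f_right dst_def moved ks bt using d by auto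
  qed
qed

lemma commutes_sep_next:
  assumes f: "fsel i C (Suc c)" and se: "sep i"
  shows "commutes i (Suc c)"
proof -
  note d = sepD[OF se]
  have u: "um i D = um i L" "up i S = up i K" using sep_um[OF se] by auto
  have n: "\<not> um i D \<le> up i S" using u near_Sc[OF f] by simp
  have uL: "i \<in> lg L" "Suc i \<notin> lg L" using near_Sc[OF f] by (auto simp: um_def amL of_bool_def split: if_splits)
  have sh: "Suc i \<notin> hk L" using uL wfcolD(3)[OF wL] by blast
  have sp: "spill i D X \<longleftrightarrow> spill i L X" using d by (simp add: spill_def)
  have iD: "i \<notin># am D" using d(1) by (simp add: dst_def amL)
  have ks: "kset (f_left i L X) a = kset L a" by (rule sep_kset[OF se]) (auto simp: f_left_def)
  have ir: "inrow K (f_left i L X) a = inrow K L a"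
  proof -
    have "kset L a \<subseteq> hk (f_left i L X) \<longleftrightarrow> kset L a \<subseteq> hk L" using d by (auto simp: f_left_def amL)
    moreover have "below (hk (f_left i L X)) a = below (hk L) a"
      using below_flip[OF fL _ sh] d by (auto simp: f_left_def amL)
    ultimately show ?thesis unfolding inrow_def ks by simp
  qed
  have moved: "moved K (f_left i L X) a = moved K L a" unfolding moved_def ir ..
  have "f_left i D X = dst K (f_left i L X) a"
  proof (cases "spill i L X")
    case True
    have e: "f_left i L X = Col (hk L) (insert (Suc i) (lg L)) (am L)" by (rule f_left_spill[OF True])
    have sD: "spill i D X" using True sp by simp
    have bt: "btop (f_left i L X) a = btop L a" unfolding btop_def ks by (simp add: e)
    show ?thesis
      unfolding f_left_spill[OF sD] dst_def[of K "f_left i L X"] moved ks bt using d by (auto simp: e dst_def)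
  next
    case False
    have iL: "i \<notin># am L" by (simp add: amL)
    have sD: "\<not> spill i D X" using False sp by simp
    note e = f_left_leg[OF False iL]
    have bt: "btop (f_left i L X) a = (if i \<in> btop L a then insert (Suc i) (btop L a - {i}) else btop L a)"
      using d sh unfolding btop_def ks by (auto simp: e)
    show ?thesis
      unfolding f_left_leg[OF sD iD] dst_def[of K "f_left i L X"] moved ks bt using d by (auto simp: e dst_def)
  qed
  moreover have "S = src K (f_left i L X) a" unfolding src_def moved ..
  ultimately show ?thesis using commutes_SS[OF f n _ _ sp] by blast
qed

text \<open>The case \<open>a = i + 1\<close> fits in here: moved letters exceed \<open>a\<close>,
  so neither \<open>i\<close> nor \<open>i + 1\<close> is moved; a raised arm entry becomes a second
  copy of \<open>a\<close>, which remains the bumping letter. The \<open>i + 1\<close> now in the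
  leg of \<open>D\<close> cancels a leg entry \<open>i\<close> there and keeps the move in column
  \<open>c\<close>.\<close>

lemma commutes_sep_nospill:
  assumes f: "fsel i C c" and se: "sep i \<or> a = Suc i" and sp: "\<not> spill i K L"
  shows "commutes i c"
proof -
  have d: "i \<noteq> a" "i \<notin> moved K L a" "Suc i \<notin> moved K L a" "i \<in> btop L a \<longleftrightarrow> i \<in> hk L"
      "below (btop L a) i = below (hk L) i" "i \<notin> kset L a"
    using se sepD[of i] movedD(2)[of i] movedD(2)[of "Suc i"] btop_below[of i] ksetD(2)[of i L a]
    by (auto simp: btop_def)
  have uu: "um i D \<le> up i S"
    using se
  proof
    assume "sep i" then show ?thesis using sep_um near_c(2)[OF f] by simp
  next
    assume a: "a = Suc i"
    have "um i D = 0" using d(6) by (simp add: um_def lg_D am_D a[symmetric])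
    then show ?thesis by simp
  qed
  have sp': "\<not> spill i S D" using sp d by (simp add: spill_def)
  have f_right: "f_right i K L = L" "f_right i S D = D" using sp sp' by (simp_all add: f_right_def)
  have iS: "i \<in># am S \<longleftrightarrow> i \<in># am K" using d(1) by (simp add: src_def in_diff_count flip: count_greater_zero_iff)
  have ak: "a \<in># am K - {#i#}" using a_in d(1) by (simp add: in_diff_count)
  have bs: "bsel (f_move i c C) c a"
  proof -
    have "Suc i \<le> a" if "i \<in># am K" using a_max[OF that] d(1) by simp
    then show ?thesis
      using b sp d(1) ak unfolding f_move_eq f_right by (auto simp: bsel_def f_left_def dest: in_diffD)
  qed
  show ?thesis
  proof (cases "i \<in># am K")
    case True
    have f_left: "f_left i K L = Col (hk K) (lg K) (add_mset (Suc i) (am K - {#i#}))"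
      using True sp by (simp add: f_left_def)
    have moved: "moved (f_left i K L) L a = moved K L a" unfolding f_left by (simp add: moved_def inrow_def)
    show ?thesis
    proof (rule commutes_cc[OF f uu bs])
      have "add_mset (Suc i) (am K - {#a#} - {#i#}) = add_mset (Suc i) (am K - {#i#}) - {#a#}"
        using ak by (simp add: add_mset_commute)
      then show "f_left i S D = src (f_left i K L) (f_right i K L) a"
        using True iS unfolding f_left_arm[OF sp' iffD2[OF iS True]] f_right src_def[of "f_left i K L"] moved
        by (simp add: f_left src_def)
      show "f_right i S D = dst (f_left i K L) (f_right i K L) a"
        unfolding f_right unfolding dst_def moved ..
    qed
  next
    case False
    have iS': "i \<notin># am S" using False iS by simp
    have il: "i \<in> lg K" "Suc i \<notin> lg K"
      using False near_c(1)[OF f] by (auto simp: um_def not_in_iff of_bool_def split: if_splits)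
    have sh: "Suc i \<notin> hk K" using il wfcolD(3)[OF wK] by blast
    let ?H = "if i \<in> hk K then insert (Suc i) (hk K - {i}) else hk K"
    have f_left: "f_left i K L = Col ?H (insert (Suc i) (lg K - {i})) (am K)"
      using False sp by (simp add: f_left_def)
    then have fls: "hk (f_left i K L) = ?H" "lg (f_left i K L) = insert (Suc i) (lg K - {i})" by simp_all
    have r: "below ?H (Suc x) = row K x" if "x \<noteq> i" for x using row_flip_K[OF _ sh that] by simp
    have ir: "inrow (f_left i K L) L a \<longleftrightarrow> inrow K L a" unfolding f_left by (simp add: inrow_def r d(1)[symmetric])
    \<comment> \<open>As \<open>i + 1\<close> is no hook entry, it shares the row of
      \<open>i\<close>; if it could be moved after the raise, \<open>i\<close> would have been moved
      before it.\<close>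
    have "\<not> (a < Suc i \<and> row K (Suc i) = row K a \<and> inrow K L a)"
    proof
      assume x: "a < Suc i \<and> row K (Suc i) = row K a \<and> inrow K L a"
      then have "i \<in> moved K L a" using d(1) il sh by (simp add: moved_def below_Suc[OF fK, of "Suc i"])
      then show False using d by simp
    qed
    then have "x \<in> moved (f_left i K L) L a \<longleftrightarrow> x \<in> moved K L a" for x
      using r[of x] r[of "Suc i"] r[of a] d(1,2,3)
      by (cases "x = i"; cases "x = Suc i") (auto simp: moved_def ir fls split del: if_split)
    then have moved: "moved (f_left i K L) L a = moved K L a" by blast
    show ?thesis
    proof (rule commutes_cc[OF f uu bs])
      show "f_left i S D = src (f_left i K L) (f_right i K L) a"
        unfolding f_left_leg[OF sp' iS'] f_right src_def[of "f_left i K L"] moved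
        using d by (auto simp: f_left src_def)
      show "f_right i S D = dst (f_left i K L) (f_right i K L) a"
        unfolding f_right unfolding dst_def moved ..
    qed
  qed
qed

section \<open>Letters inside the bumping window\<close>

lemma low_kset:
  assumes "a \<le> i" "\<forall>k \<in> kset L a. i \<le> k"
  shows "i \<in> kset L a \<longleftrightarrow> i \<in> lg L" "Suc i \<in> kset L a \<longleftrightarrow> Suc i \<in> lg L \<and> i \<notin> lg L"
    "x \<in> lg L \<Longrightarrow> a \<le> x \<Longrightarrow> i \<le> x"
proof -
  show ge: "i \<le> x" if "x \<in> lg L" "a \<le> x" for x
    using that assms(2) by (cases rule: kset_cases[of L a]) force+
  show "i \<in> kset L a \<longleftrightarrow> i \<in> lg L" using assms(1) ge by (auto simp: kset_def)
  show "Suc i \<in> kset L a \<longleftrightarrow> Suc i \<in> lg L \<and> i \<notin> lg L"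
    using assms(1) ge by (force simp: kset_def Suc_le_eq order.strict_iff_order)
qed

text \<open>The bumped entry is the hook entry \<open>i\<close> that (S) flips, and the bump stays
  in its row, with \<open>i\<close> either equal to \<open>a\<close> or moved along. Bumping first
  leaves an \<open>i\<close> in the arm of \<open>D\<close>, where the move raises it. Moving first
  puts \<open>i + 1\<close> into the leg of \<open>K\<close> and makes it a hook entry of
  \<open>L\<close>; then \<open>a\<close> bumps this \<open>i + 1\<close> and takes the new leg
  entry along.\<close>

lemma commutes_low_spill:
  assumes f: "fsel i C c" and ai: "a \<le> i" and ki: "\<forall>k \<in> kset L a. i \<le> k" and sp: "spill i K L"
  shows "commutes i c"
proof -
  note s = spill_facts[OF v f sp]
  note lk = low_kset[OF ai ki]
  have ih: "i \<in> hk L" and sK: "Suc i \<notin> hk K" and r: "Suc (below (hk L) i) = row K i"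
    using sp by (auto simp: spill_def)
  have ks: "kset L a = {i}" using lk(1) s(6) kset_unique by blast
  have ba: "below (hk L) i = below (hk L) a" by (rule no_gap) (use ks ai in auto)
  have "row K a \<le> row K i" using below_mono[OF fK] ai by simp
  then have ra: "row K a = row K i" using r ba aKa by simp
  then have ir: "inrow K L a" using r ba ks ih by (simp add: inrow_def)
  have am: "i \<in> lg K" if "i \<noteq> a"
    using near_c(1)[OF f] s(1) cK[of i] ai that by (auto simp: um_def of_bool_def split: if_splits)
  then have im: "i = a \<or> i \<in> moved K L a" using ra ir ai by (auto simp: moved_def)
  have sm: "Suc i \<notin> moved K L a" using s(1) by (simp add: moved_def)
  let ?K' = "Col (hk K) (insert (Suc i) (lg K)) (am K)"
  let ?L' = "Col (insert (Suc i) (hk L - {i})) (lg L - {i}) (am L)"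
  have f_left: "f_left i K L = ?K'" and f_right: "f_right i K L = ?L'" using sp by (simp_all add: f_left_def f_right_def)
  have "Suc i \<in> kset ?L' a"
    by (rule ksetI) (use s(3) ai lk(3) in \<open>auto simp: Suc_le_eq order.strict_iff_order\<close>)
  then have ks': "kset ?L' a = {Suc i}" by (rule kset_unique)
  have "inrow ?K' ?L' a" using ir below_flip[OF fL ih s(5)] ai by (simp add: inrow_def ks')
  moreover have "row K (Suc i) = row K a" using ra sK by (simp add: below_Suc[OF fK, of "Suc i"])
  ultimately have moved: "moved ?K' ?L' a = insert (Suc i) (moved K L a)" using ir ai by (auto simp: moved_def)
  have bt: "btop ?L' a = btop L a" using s(5) ih ks unfolding btop_def ks' by auto
  have sD: "Suc i \<in> lg D" "i \<in> lg D" using s(3) ks im by (auto simp: lg_D)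
  have amD: "am D = {#i#}" by (simp add: dst_def amL ks)
  then have iD: "i \<in># am D" by simp
  have bs: "bsel (f_move i c C) c a"
    using b unfolding f_move_eq f_left f_right by (auto simp: bsel_def)
  have nsp: "\<not> spill i D X" using no_spill_D sD by (simp add: ents_def)
  show ?thesis
  proof (rule commutes_cS[OF f _ bs nsp])
    have "um i D = 1" using sD amD by (simp add: um_def)
    moreover have "up i S = 0"
      using s(1,2) by (auto simp: up_def lg_S am_S not_in_iff)
    ultimately show "\<not> um i D \<le> up i S" by simp
    show "S = src (f_left i K L) (f_right i K L) a"
      using s(1) by (auto simp: f_left f_right src_def moved)
    show "f_left i D X = dst (f_left i K L) (f_right i K L) a"
    proof -
      have "insert a (lg L - {i}) \<union> moved K L a = insert a (lg L - {i} - {Suc i}) \<union> insert (Suc i) (moved K L a)"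
        using s(3) n_not_Suc_n[of i] by blast
      then show ?thesis
        unfolding f_left_arm[OF nsp iD] amD f_left f_right unfolding dst_def moved bt ks' ks by (simp add: amL)
    qed
  qed
qed

text \<open>Column \<open>L\<close> has no arms, so its unpaired minus is a leg entry
  \<open>i\<close>, and this is the bumped entry. Without (S) towards \<open>X\<close>, the bump
  expels \<open>i + 1\<close> after the raise, while before the raise it puts \<open>i\<close> into
  the arm, where it is raised. With (S) the \<open>i\<close> stays in \<open>L\<close> and is bumped
  either way.\<close>

lemma commutes_low_next:
  assumes f: "fsel i C (Suc c)" and ai: "a \<le> i" and ki: "\<forall>k \<in> kset L a. i \<le> k"
  shows "commutes i (Suc c)"
proof -
  note lk = low_kset[OF ai ki]
  have uL: "i \<in> lg L" "Suc i \<notin> lg L" and uK: "up i K = 0"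
    using near_Sc[OF f] by (auto simp: um_def amL of_bool_def split: if_splits)
  have sh: "Suc i \<notin> hk L" using uL wfcolD(3)[OF wL] by blast
  have ks: "kset L a = {i}" using lk(1) uL kset_unique by blast
  have sm: "Suc i \<notin> moved K L a" using moved_kset_le[of "Suc i" i] ks by auto
  have sb: "Suc i \<notin> btop L a" using sh ai by (auto simp: btop_def)
  have rD: "below (btop L a) (Suc i) = below (hk L) (Suc i)" by (rule btop_below) (simp add: ks)
  have sp: "spill i D X \<longleftrightarrow> spill i L X" using sh sb rD by (simp add: spill_def)
  have amD: "am D = {#i#}" by (simp add: dst_def amL ks)
  then have iD: "i \<in># am D" by simp
  have sD: "Suc i \<notin> lg D" using uL ai sm by (auto simp: lg_D)
  have n: "\<not> um i D \<le> up i S"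
  proof -
    have cz: "count (am K) (Suc i) = 0" using cK ai by simp
    show ?thesis
    proof (cases "i \<in> lg D")
      case True
      then show ?thesis using sD amD cz by (auto simp: um_def up_def am_S)
    next
      case False
      then have "i \<notin> moved K L a" "i \<noteq> a" by (auto simp: lg_D)
      then have "up i S = up i K" using cz sm by (simp add: up_def am_S lg_S)
      then show ?thesis using uK False amD sD by (simp add: um_def)
    qed
  qed
  show ?thesis
  proof (cases "spill i L X")
    case True
    have f_left: "f_left i L X = Col (hk L) (insert (Suc i) (lg L)) (am L)" using True by (simp add: f_left_def)
    have ks': "kset (f_left i L X) a = kset L a"
      by (rule kset_cong) (use ks f_left in auto)
    have moved: "moved K (f_left i L X) a = moved K L a" unfolding moved_def inrow_def ks' by (simp add: f_left)
    have bt: "btop (f_left i L X) a = btop L a" unfolding btop_def ks' by (simp add: f_left)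
    have "f_left i D X = dst K (f_left i L X) a"
      using True sp unfolding f_left_spill[OF iffD2[OF sp True]] dst_def[of K "f_left i L X"] moved bt ks'
      by (auto simp: f_left dst_def ks)
    moreover have "S = src K (f_left i L X) a" unfolding src_def moved ..
    ultimately show ?thesis using commutes_SS[OF f n _ _ sp] by blast
  next
    case False
    let ?H = "if i \<in> hk L then insert (Suc i) (hk L - {i}) else hk L"
    have f_left: "f_left i L X = Col ?H (insert (Suc i) (lg L - {i})) (am L)"
      using False by (simp add: f_left_def amL)
    have "Suc i \<in> kset (f_left i L X) a"
      by (rule ksetI) (use ai lk(3) in \<open>auto simp: f_left Suc_le_eq order.strict_iff_order\<close>)
    then have ks': "kset (f_left i L X) a = {Suc i}" by (rule kset_unique)
    have bl: "below ?H a = below (hk L) a" using below_flip[OF fL _ sh] ai by simp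
    have hm: "Suc i \<in> ?H \<longleftrightarrow> i \<in> hk L" using sh by simp
    have "inrow K (f_left i L X) a = inrow K L a"
      using bl hm unfolding inrow_def ks' ks by (simp add: f_left)
    then have moved: "moved K (f_left i L X) a = moved K L a" by (simp add: moved_def)
    have bt: "btop (f_left i L X) a = btop L a" using sh unfolding btop_def ks' ks by (auto simp: f_left)
    have nsp: "\<not> spill i D X" using False sp by simp
    have "f_left i D X = dst K (f_left i L X) a"
      using uL unfolding f_left_arm[OF nsp iD] amD dst_def[of K "f_left i L X"] moved bt ks'
      by (simp add: f_left dst_def ks amL)
    moreover have "S = src K (f_left i L X) a" unfolding src_def moved ..
    ultimately show ?thesis using commutes_SS[OF f n _ _ sp] by blast
  qed
qed

text \<open>Arm entries are at most \<open>a < i\<close>, so the raised \<open>i\<close> is a leg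
  entry of \<open>K\<close>. If the bump does not move it, everything happens in column
  \<open>c\<close>. If the bump does, the move follows it to column \<open>c + 1\<close>, and in the
  other order \<open>i + 1\<close> is moved in its place.\<close>

lemma commutes_low_leg:
  assumes f: "fsel i C c" and ai: "a < i" and ki: "\<forall>k \<in> kset L a. i \<le> k" and sp: "\<not> spill i K L"
  shows "commutes i c"
proof -
  note lk = low_kset[OF less_imp_le[OF ai] ki]
  have cz: "count (am K) i = 0" "count (am K) (Suc i) = 0" using cK ai by auto
  have iK: "i \<in> lg K" "Suc i \<notin> lg K" and amK: "i \<notin># am K"
    using near_c(1)[OF f] cz by (auto simp: um_def not_in_iff of_bool_def split: if_splits)
  have uL: "i \<in> lg L \<Longrightarrow> Suc i \<in> lg L"
    using near_c(2)[OF f] iK cz by (auto simp: um_def up_def amL of_bool_def split: if_splits)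
  have sh: "Suc i \<notin> hk K" using iK wfcolD(3)[OF wK] by blast
  have sm: "Suc i \<notin> moved K L a" using iK by (simp add: moved_def)
  let ?H = "if i \<in> hk K then insert (Suc i) (hk K - {i}) else hk K"
  note f_left = f_left_leg[OF sp amK]
  have fls: "hk (f_left i K L) = ?H" "lg (f_left i K L) = insert (Suc i) (lg K - {i})" unfolding f_left by simp_all
  have f_right: "f_right i K L = L" by (rule f_right_keep[OF sp])
  have r: "below ?H (Suc x) = row K x" if "x \<noteq> i" for x using row_flip_K[OF _ sh that] by simp
  have ra: "below ?H (Suc a) = row K a" using r ai by simp
  have ir: "inrow (f_left i K L) L a \<longleftrightarrow> inrow K L a" unfolding inrow_def fls ra ..
  have rs: "row K (Suc i) = row K i" using sh by (simp add: below_Suc[OF fK, of "Suc i"])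
  have m1: "x \<in> moved (f_left i K L) L a \<longleftrightarrow> (if x = Suc i then i \<in> moved K L a else x \<noteq> i \<and> x \<in> moved K L a)" for x
    using r[of x] r[of "Suc i"] ra rs ai iK
    by (cases "x = i"; cases "x = Suc i") (auto simp: moved_def ir fls split del: if_split)
  have moved: "moved (f_left i K L) L a = (if i \<in> moved K L a then insert (Suc i) (moved K L a - {i}) else moved K L a)"
    by (rule set_eqI) (auto simp: m1 sm)
  have bs: "bsel (f_move i c C) c a"
    using b unfolding f_move_eq f_left f_right by (auto simp: bsel_def)
  show ?thesis
  proof (cases "i \<in> moved K L a")
    case False
    have iD: "i \<notin> lg D" using False lk(1) ai by (auto simp: lg_D)
    have nsp: "\<not> spill i S D" using iD wfcolD(3)[OF wD, of i] by (auto simp: spill_def)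
    have uD: "um i D \<le> up i S"
    proof -
      have "Suc i \<in> lg D" if "i \<in> lg L" using uL[OF that] lk that by (simp add: lg_D)
      then have "um i D = 0" using iD lk(1) by (simp add: um_def am_D)
      then show ?thesis by simp
    qed
    have iS: "i \<notin># am S" using amK by (auto simp: src_def dest: in_diffD)
    show ?thesis
    proof (rule commutes_cc[OF f uD bs])
      show "f_left i S D = src (f_left i K L) (f_right i K L) a"
        unfolding f_left_leg[OF nsp iS] f_right src_def[of "f_left i K L"] moved
        using False sm by (auto simp: f_left src_def)
      show "f_right i S D = dst (f_left i K L) (f_right i K L) a"
        unfolding f_right f_right_keep[OF nsp] unfolding dst_def moved using False by simp
    qed
  next
    case True
    \<comment> \<open>An \<open>i\<close> in \<open>L\<close> would be the bumped hook entry in the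
      row of the raised \<open>i\<close>, which is case (S).\<close>
    have iL: "i \<notin> lg L"
    proof
      assume "i \<in> lg L"
      then have k: "kset L a = {i}" using lk(1) kset_unique by blast
      have "i \<in> hk L" using movedD(4)[OF True] k by simp
      moreover have "below (hk L) i = below (hk L) a" by (rule no_gap) (use k ai in auto)
      ultimately show False using sp sh movedD(3,5)[OF True] by (simp add: spill_def)
    qed
    have ik: "i \<notin> hk K" using hk_not_moved True by blast
    have iD: "i \<in> lg D" "Suc i \<notin> lg D" "i \<notin># am D"
      using True sm ai lk iL by (auto simp: lg_D dst_def amL)
    have nsp: "\<not> spill i D X" by (rule no_spill_D') (use lk iL ki ai in auto)
    have ib: "i \<notin> btop L a" using iL wfcolD(3)[OF wL] ai by (auto simp: btop_def)
    show ?thesis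
    proof (rule commutes_cS[OF f _ bs nsp])
      have "um i D > 0" using iD by (simp add: um_def)
      moreover have "up i S = 0" using iK cz by (simp add: up_def lg_S am_S)
      ultimately show "\<not> um i D \<le> up i S" by simp
      have "lg K - moved K L a = insert (Suc i) (lg K - {i}) - insert (Suc i) (moved K L a - {i})"
        using True iK by auto
      then show "S = src (f_left i K L) (f_right i K L) a"
        unfolding f_right src_def moved using True ik by (simp add: f_left)
      have "insert (Suc i) (insert a (lg L - kset L a) \<union> moved K L a - {i})
          = insert a (lg L - kset L a) \<union> insert (Suc i) (moved K L a - {i})"
        using iL ai by auto
      then show "f_left i D X = dst (f_left i K L) (f_right i K L) a"
        unfolding f_left_leg[OF nsp iD(3)] f_right unfolding dst_def moved using True ib by simp
    qed
  qed
qed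

text \<open>The raised letter is the bumping letter, so in the other order \<open>i + 1\<close>
  bumps. If \<open>L\<close> contains \<open>i\<close>, it also contains \<open>i + 1\<close>, and
  the two bumps expel \<open>i\<close> and \<open>i + 1\<close> respectively without changing the
  leg. Otherwise both have the same bumped entry, if any. If bumping with \<open>i\<close> has
  dragged a leg entry \<open>i + 1\<close> along, the move on the result is case (S) and hands this
  \<open>i + 1\<close> back to column \<open>c\<close>; if not, it raises the \<open>i\<close> now
  in \<open>D\<close>.\<close>

lemma commutes_eq_arm:
  assumes f: "fsel i C c" and ai: "a = i" and sp: "\<not> spill i K L"
  shows "commutes i c"
proof -
  have ki: "\<forall>k \<in> kset L a. i \<le> k" using ksetD(2) ai by blast
  have ai': "a \<le> i" using ai by simp
  note lk = low_kset[OF ai' ki]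
  have cz: "count (am K) (Suc i) = 0" using cK ai by auto
  have amK: "i \<in># am K" using a_in ai by simp
  obtain n where n: "count (am K) i = Suc n" using cKa ai gr0_implies_Suc by blast
  have ni: "i \<noteq> Suc i" by simp
  have uK: "up i K = 0" using cz n by (simp add: up_def)
  have im: "i \<notin> moved K L a" using movedD(2) ai by blast
  have cS: "count (am S) i = n" "count (am S) (Suc i) = 0" unfolding am_S using n cz ai by simp_all
  have uS: "up i S = 0" if "Suc i \<notin> moved K L a"
    using near_c(1)[OF f] that n im unfolding up_def um_def lg_S cS by (auto simp: of_bool_def split: if_splits)
  have uL: "i \<in> lg L \<Longrightarrow> Suc i \<in> lg L"
    using near_c(2)[OF f] uK by (auto simp: um_def amL of_bool_def split: if_splits)
  note f_left = f_left_arm[OF sp amK]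
  have f_right: "f_right i K L = L" by (rule f_right_keep[OF sp])
  have bs: "bsel (f_move i c C) c (Suc i)"
    using b ai unfolding f_move_eq f_left f_right by (auto simp: bsel_def dest: in_diffD intro: le_SucI)
  let ?moved = "moved K L (Suc i)"
  have S': "src (f_left i K L) (f_right i K L) (Suc i) = Col (hk K) (lg K - ?moved) (am K - {#i#})"
    unfolding f_right f_left by (simp add: src_def moved_def inrow_def)
  have D': "dst (f_left i K L) (f_right i K L) (Suc i) =
      Col (btop L (Suc i)) (insert (Suc i) (lg L - kset L (Suc i)) \<union> ?moved) (mset_set (kset L (Suc i)))"
    unfolding f_right f_left by (simp add: dst_def amL moved_def inrow_def)
  show ?thesis
  proof (cases "i \<in> lg L")
    case True
    note sL = uL[OF True]
    have k: "kset L a = {i}" using lk(1) True kset_unique by blast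
    have "Suc i \<in> kset L (Suc i)" by (rule ksetI) (use sL in auto)
    then have k': "kset L (Suc i) = {Suc i}" by (rule kset_unique)
    have m: "moved K L a = {}" using moved_kset_le[of _ i] k ai movedD(2) by force
    have m': "?moved = {}" using moved_bound[OF aK wL _ sL, of _ "Suc i"] by (fastforce simp: moved_def)
    have bt: "btop L a = hk L" "btop L (Suc i) = hk L" using k k' ai by (auto simp: btop_def)
    have Dd: "D = Col (hk L) (lg L) {#i#}" unfolding dst_def bt k m amL using True ai by auto
    have nsp: "\<not> spill i D X" by (rule no_spill_D) (use sL in \<open>simp add: Dd ents_def\<close>)
    show ?thesis
    proof (rule commutes_cS[OF f _ bs nsp])
      show "\<not> um i D \<le> up i S" using uS m True sL by (simp add: Dd um_def)
      show "S = src (f_left i K L) (f_right i K L) (Suc i)" unfolding S' m' unfolding src_def m using ai by simp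
      show "f_left i D X = dst (f_left i K L) (f_right i K L) (Suc i)"
        using nsp sL unfolding D' k' m' bt by (auto simp: f_left_arm Dd)
    qed
  next
    case False
    have ih: "i \<notin> hk L" using False wfcolD(3)[OF wL] by blast
    have iZ: "i \<notin> kset L a" using lk(1) False by simp
    have k': "kset L (Suc i) = kset L a"
      using False ai by (force simp: kset_def Suc_le_eq order.strict_iff_order)
    have b': "below (hk L) (Suc i) = below (hk L) i" using ih by (simp add: below_Suc fL)
    \<comment> \<open>If \<open>i + 1\<close> is a hook entry of \<open>K\<close>, bumping with it
      starts one row higher and neither letter moves anything; otherwise the rows of
      \<open>i\<close> and \<open>i + 1\<close> agree.\<close>
    have m': "?moved = moved K L a - {Suc i}"
    proof (cases "Suc i \<in> hk K")
      case True
      have r1: "row K (Suc i) = Suc (row K i)" using True by (simp add: below_Suc[OF fK, of "Suc i"])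
      then have "\<not> inrow K L (Suc i)" using aKa ai b' by (simp add: inrow_def)
      moreover have "moved K L a = {}"
      proof -
        have "row K (Suc i) \<le> row K x" if "a < x" for x using below_mono[OF fK] ai that by simp
        then show ?thesis using r1 ai by (fastforce simp: moved_def)
      qed
      ultimately show ?thesis by (simp add: moved_def)
    next
      case F2: False
      then have r1: "row K (Suc i) = row K i" by (simp add: below_Suc[OF fK, of "Suc i"])
      have "inrow K L (Suc i) = inrow K L a" by (simp add: inrow_def k' b' r1 ai)
      then show ?thesis using r1 ai by (auto simp: moved_def)
    qed
    have bt': "btop L (Suc i) = (if i \<in> btop L a then insert (Suc i) (btop L a - {i}) else btop L a)"
      using ih ai iZ unfolding btop_def k' by auto
    have iD: "i \<in> lg D" "i \<notin># am D" "Suc i \<in> lg D \<longleftrightarrow> Suc i \<in> moved K L a"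
      using ai iZ lk False by (auto simp: lg_D dst_def amL)
    have lD: "insert (Suc i) (lg L - kset L (Suc i)) \<union> ?moved = insert (Suc i) (lg D - {i})"
      unfolding k' m' using False im ai by (auto simp: dst_def)
    have aD: "am D = mset_set (kset L (Suc i))" unfolding k' by (simp add: dst_def amL)
    show ?thesis
    proof (cases "Suc i \<in> moved K L a")
      case T: True
      have sh: "Suc i \<notin> hk K" using hk_not_moved T by blast
      have ib: "i \<in> btop L a" using movedD(4)[OF T] ai by (simp add: btop_def)
      have "below (btop L a) i = below (hk L) i" using btop_below ai by simp
      then have sp': "spill i S D" unfolding spill_def S_simps using sh ib movedD(5)[OF T] ai by simp
      show ?thesis
      proof (rule commutes_cc[OF f _ bs])
        have "um i D = 0" using iD T by (simp add: um_def not_in_iff)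
        then show "um i D \<le> up i S" by simp
        show "f_left i S D = src (f_left i K L) (f_right i K L) (Suc i)"
          unfolding S' m' f_left_spill[OF sp'] using T movedD(1)[OF T] ai by (auto simp: src_def)
        have "insert (Suc i) (lg D - {i}) = lg D - {i}" using T iD(3) by auto
        then show "f_right i S D = dst (f_left i K L) (f_right i K L) (Suc i)"
          unfolding D' lD bt' f_right_spill[OF sp'] aD using ib by simp
      qed
    next
      case F: False
      have nsp: "\<not> spill i D X" by (rule no_spill_D') (use iZ ki ai in auto)
      show ?thesis
      proof (rule commutes_cS[OF f _ bs nsp])
        show "\<not> um i D \<le> up i S" using uS[OF F] iD F by (simp add: um_def)
        show "S = src (f_left i K L) (f_right i K L) (Suc i)"
          unfolding S' m' using F ai by (simp add: src_def)
        show "f_left i D X = dst (f_left i K L) (f_right i K L) (Suc i)"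
          unfolding D' lD bt' f_left_leg[OF nsp iD(2)] aD by simp
      qed
    qed
  qed
qed

theorem commutes_all:
  assumes f: "fsel i C d" shows "commutes i d"
proof -
  consider "d \<noteq> c" "d \<noteq> Suc c" | "d = c" | "d = Suc c" by blast
  then show ?thesis
  proof cases
    case 1 then show ?thesis using commutes_far[OF f] by blast
  next
    case 2
    then have f: "fsel i C c" using f by simp
    consider "sep i \<or> a = Suc i" | "a \<le> i" "\<forall>k \<in> kset L a. i \<le> k"
      unfolding sep_def by fastforce
    then have "commutes i c"
    proof cases
      case A: 1
      show ?thesis
      proof (cases "spill i K L")
        case True
        then have "a \<noteq> Suc i" using no_spill_K[of i] a_in by (auto simp: ents_def)
        then show ?thesis using A True commutes_sep_spill[OF f] by blast
      next
        case False
        then show ?thesis using commutes_sep_nospill[OF f A] by blast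
      qed
    next
      case A: 2
      then show ?thesis
        using commutes_low_spill[OF f A] commutes_low_leg[OF f _ A(2)] commutes_eq_arm[OF f]
        by (cases "spill i K L"; cases "a = i") auto
    qed
    then show ?thesis using 2 by simp
  next
    case 3
    then have f: "fsel i C (Suc c)" using f by simp
    \<comment> \<open>An arm entry \<open>i + 1\<close> of \<open>K\<close> is an unpaired plus that
      would cancel the only possible minus of \<open>L\<close>, which has no arms.\<close>
    have "a \<noteq> Suc i"
    proof
      assume a: "a = Suc i"
      then have "count (am K) (Suc i) \<ge> 1" using cKa by (simp del: count_greater_zero_iff add: Suc_le_eq)
      then have "up i K \<ge> 1" unfolding up_def by linarith
      moreover have "um i L \<le> 1" by (simp add: um_def amL)
      ultimately show False using near_Sc[OF f] by simp
    qed
    then consider "sep i" | "a \<le> i" "\<forall>k \<in> kset L a. i \<le> k"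
      unfolding sep_def by fastforce
    then have "commutes i (Suc c)"
      using commutes_sep_next[OF f] commutes_low_next[OF f] by cases auto
    then show ?thesis using 3 by simp
  qed
qed

end

section \<open>Reduction of sign words\<close>

definition sign_sum :: "(nat \<times> bool) list \<Rightarrow> int" where
  "sign_sum xs = (\<Sum>x\<leftarrow>xs. if snd x then 1 else -1)"

lemma sign_sum_simps [simp]: "sign_sum [] = 0" "sign_sum (x # xs) = (if snd x then 1 else -1) + sign_sum xs" "sign_sum (xs @ ys) = sign_sum xs + sign_sum ys"
  by (simp_all add: sign_sum_def)

text \<open>In terms of heights, a word has no unpaired plus if no suffix has a positive sum, and no
  unpaired minus if no prefix has a negative one. Both forms survive the insertion of an adjacent
  cancelling pair.\<close>

definition ends_lowest :: "(nat \<times> bool) list \<Rightarrow> bool" where "ends_lowest u \<longleftrightarrow> (\<forall>k. sign_sum u \<le> sign_sum (take k u))"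
definition nonneg :: "(nat \<times> bool) list \<Rightarrow> bool" where "nonneg v \<longleftrightarrow> (\<forall>k. 0 \<le> sign_sum (take k v))"

lemma cancel_once_Some:
  "cancel_once xs = Some ys \<Longrightarrow> \<exists>p a b q. xs = p @ a # b # q \<and> snd a \<and> \<not> snd b \<and> ys = p @ q"
proof (induction xs arbitrary: ys rule: cancel_once.induct)
  case (1 x y zs)
  show ?case
  proof (cases "snd x \<and> \<not> snd y")
    case True
    then show ?thesis using 1(2) by (intro exI[of _ "[]"]) auto
  next
    case False
    then obtain ys' where y: "cancel_once (y # zs) = Some ys'" "ys = x # ys'"
      using 1(2) by (auto split: if_splits)
    obtain p a b q where "y # zs = p @ a # b # q" "snd a" "\<not> snd b" "ys' = p @ q"
      using 1(1)[OF False y(1)] by blast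
    then show ?thesis using y(2) by (intro exI[of _ "x # p"]) auto
  qed
qed auto

lemma cancel_once_None:
  "cancel_once xs = None \<Longrightarrow> \<exists>m p. xs = m @ p \<and> (\<forall>x \<in> set m. \<not> snd x) \<and> (\<forall>x \<in> set p. snd x)"
proof (induction xs rule: cancel_once.induct)
  case (1 x y zs)
  from 1(2) have n: "\<not> (snd x \<and> \<not> snd y)" "cancel_once (y # zs) = None" by (auto split: if_splits)
  obtain m p where mp: "y # zs = m @ p" "\<forall>x \<in> set m. \<not> snd x" "\<forall>x \<in> set p. snd x"
    using 1(1)[OF n] by blast
  show ?case
  proof (cases "snd x")
    case True
    then have "m = []" using n(1) mp(1,2) by (cases m) auto
    then show ?thesis using mp True by (intro exI[of _ "[]"] exI[of _ "x # p"]) auto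
  next
    case False
    then show ?thesis using mp by (intro exI[of _ "x # m"] exI[of _ p]) auto
  qed
next
  case "2_1" then show ?case by simp
next
  case ("2_2" x)
  then show ?case
    by (cases "snd x") (intro exI[of _ "[]"] exI[of _ "[x]"], simp, intro exI[of _ "[x]"] exI[of _ "[]"], simp)
qed

definition cancel_step :: "(nat \<times> bool) list \<Rightarrow> (nat \<times> bool) list" where
  "cancel_step ys = (case cancel_once ys of None \<Rightarrow> ys | Some zs \<Rightarrow> zs)"

text \<open>Running the cancellations backwards inserts adjacent pairs, so a property stable under
  such insertions spreads from the reduced word to the original one.\<close>

lemma reduce_signs_backward:
  assumes "\<And>p a b q. P (p @ q) \<Longrightarrow> snd a \<Longrightarrow> \<not> snd b \<Longrightarrow> P (p @ a # b # q)" "P (reduce_signs xs)"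
  shows "P xs"
proof -
  have s: "P (cancel_step ys) \<Longrightarrow> P ys" for ys
    using assms(1) cancel_once_Some[of ys] by (cases "cancel_once ys") (auto simp: cancel_step_def)
  have "P ((cancel_step ^^ n) ys) \<Longrightarrow> P ys" for n ys
    by (induction n arbitrary: ys) (auto simp: funpow_swap1 intro: s)
  then show ?thesis using assms(2) unfolding reduce_signs_def cancel_step_def[abs_def, symmetric] by blast
qed

lemma reduce_signs_None: "cancel_once (reduce_signs xs) = None"
proof -
  \<comment> \<open>Each effective step removes two letters, so as many iterations as the word has
    letters suffice to exhaust all pairs.\<close>
  have "length ((cancel_step ^^ n) xs) + 2 * n \<le> length xs \<or> cancel_once ((cancel_step ^^ n) xs) = None" for n
  proof (induction n)
    case (Suc n)
    show ?case
    proof (cases "cancel_once ((cancel_step ^^ n) xs)")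
      case None
      then have "cancel_step ((cancel_step ^^ n) xs) = (cancel_step ^^ n) xs" by (simp add: cancel_step_def[of "(cancel_step ^^ n) xs"])
      then show ?thesis using None by simp
    next
      case (Some ys)
      then have "cancel_step ((cancel_step ^^ n) xs) = ys" by (simp add: cancel_step_def[of "(cancel_step ^^ n) xs"])
      then show ?thesis using Suc Some cancel_once_Some[OF Some] by auto
    qed
  qed simp
  from this[of "length xs"] have "(cancel_step ^^ length xs) xs = [] \<or> cancel_once ((cancel_step ^^ length xs) xs) = None"
    by auto
  then show ?thesis unfolding reduce_signs_def cancel_step_def[abs_def, symmetric] by auto
qed

text \<open>An inserted pair of plus and minus adds a peak to the path, so no new minimum can
  appear.\<close>

lemma sign_sum_take_insert:
  assumes "snd a" "\<not> snd b"
  shows "\<exists>k'. sign_sum (take k' (p @ q)) \<le> sign_sum (take k (p @ a # b # q))"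
proof -
  consider "k \<le> length p" | "k = Suc (length p)" | "Suc (Suc (length p)) \<le> k" by linarith
  then show ?thesis
  proof cases
    case 1 then show ?thesis by (intro exI[of _ k]) simp
  next
    case 2 then show ?thesis using assms by (intro exI[of _ "length p"]) simp
  next
    case 3
    then obtain m where "k = Suc (Suc (length p + m))" by (metis add_Suc le_Suc_ex)
    then show ?thesis using assms by (intro exI[of _ "length p + m"]) simp
  qed
qed

lemma ends_lowest_insert: assumes "ends_lowest (p @ q)" "snd a" "\<not> snd b" shows "ends_lowest (p @ a # b # q)"
proof -
  have "sign_sum (p @ q) \<le> sign_sum (take k (p @ a # b # q))" for k
  proof -
    obtain k' where "sign_sum (take k' (p @ q)) \<le> sign_sum (take k (p @ a # b # q))"
      using sign_sum_take_insert[OF assms(2,3)] by blast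
    moreover have "sign_sum (p @ q) \<le> sign_sum (take k' (p @ q))" using assms(1) unfolding ends_lowest_def by blast
    ultimately show ?thesis by linarith
  qed
  then show ?thesis using assms(2,3) by (simp add: ends_lowest_def)
qed

lemma nonneg_insert: assumes "nonneg (p @ q)" "snd a" "\<not> snd b" shows "nonneg (p @ a # b # q)"
proof -
  have "0 \<le> sign_sum (take k (p @ a # b # q))" for k
  proof -
    obtain k' where "sign_sum (take k' (p @ q)) \<le> sign_sum (take k (p @ a # b # q))"
      using sign_sum_take_insert[OF assms(2,3)] by blast
    moreover have "0 \<le> sign_sum (take k' (p @ q))" using assms(1) unfolding nonneg_def by blast
    ultimately show ?thesis by linarith
  qed
  then show ?thesis using assms(2,3) by (simp add: nonneg_def)
qed

text \<open>
  The last unpaired minus and the first unpaired plus are characterised by the heights around them.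
  This is evident in the reduced word and is carried backwards through the cancellations.
\<close>

definition split_at :: "nat \<times> bool \<Rightarrow> (nat \<times> bool) list \<Rightarrow> bool" where
  "split_at x xs \<longleftrightarrow> (\<exists>u v. xs = u @ x # v \<and> ends_lowest u \<and> nonneg v)"

text \<open>The marked letter survives every cancellation, so an inserted pair lies entirely to its
  left or entirely to its right.\<close>

lemma split_at_insert:
  assumes "split_at x (p @ q)" "snd a" "\<not> snd b" shows "split_at x (p @ a # b # q)"
proof -
  obtain u v where uv: "p @ q = u @ x # v" "ends_lowest u" "nonneg v" using assms(1) by (auto simp: split_at_def)
  from uv(1) consider r where "p = u @ r" "r @ q = x # v" | r where "u = p @ r" "q = r @ x # v"
    by (auto simp: append_eq_append_conv2)
  then show ?thesis
  proof cases
    case (1 r)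
    show ?thesis
    proof (cases r)
      case Nil
      then show ?thesis using 1 uv ends_lowest_insert[of p "[]" a b] assms unfolding split_at_def
        by (intro exI[of _ "u @ [a, b]"] exI[of _ v]) auto
    next
      case (Cons y r')
      then show ?thesis using 1 uv nonneg_insert[of r' q a b] assms unfolding split_at_def
        by (intro exI[of _ u] exI[of _ "r' @ a # b # q"]) auto
    qed
  next
    case (2 r)
    then show ?thesis using uv ends_lowest_insert[of p r a b] assms unfolding split_at_def
      by (intro exI[of _ "p @ a # b # r"] exI[of _ v]) auto
  qed
qed

lemma ends_lowest_minus: "\<forall>x \<in> set m. \<not> snd x \<Longrightarrow> ends_lowest m"
proof -
  assume a: "\<forall>x \<in> set m. \<not> snd x"
  have "sign_sum (drop k m) \<le> 0" for k
  proof -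
    have "\<forall>x \<in> set xs. \<not> snd x \<Longrightarrow> sign_sum xs \<le> 0" for xs by (induction xs) auto
    then show ?thesis using a by (meson in_set_dropD)
  qed
  then show ?thesis unfolding ends_lowest_def by (metis add_le_same_cancel1 append_take_drop_id sign_sum_simps(3))
qed

lemma nonneg_plus: "\<forall>x \<in> set m. snd x \<Longrightarrow> nonneg m"
proof -
  assume a: "\<forall>x \<in> set m. snd x"
  have "\<forall>x \<in> set xs. snd x \<Longrightarrow> 0 \<le> sign_sum xs" for xs by (induction xs) auto
  then show ?thesis using a unfolding nonneg_def by (meson in_set_takeD)
qed

lemma reduced_form:
  obtains m p where "reduce_signs xs = m @ p" "\<forall>x \<in> set m. \<not> snd x" "\<forall>x \<in> set p. snd x"
    "filter (\<lambda>x. \<not> snd x) (reduce_signs xs) = m" "filter snd (reduce_signs xs) = p"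
proof -
  obtain m p where "reduce_signs xs = m @ p" "\<forall>x \<in> set m. \<not> snd x" "\<forall>x \<in> set p. snd x"
    using cancel_once_None[OF reduce_signs_None] by blast
  then show ?thesis using that[of m p] by simp
qed

lemma last_minus:
  assumes "filter (\<lambda>x. \<not> snd x) (reduce_signs xs) \<noteq> []"
  shows "split_at (last (filter (\<lambda>x. \<not> snd x) (reduce_signs xs))) xs"
    "\<not> snd (last (filter (\<lambda>x. \<not> snd x) (reduce_signs xs)))"
proof -
  obtain m p where mp: "reduce_signs xs = m @ p" "\<forall>x \<in> set m. \<not> snd x" "\<forall>x \<in> set p. snd x"
    "filter (\<lambda>x. \<not> snd x) (reduce_signs xs) = m" by (rule reduced_form)
  have m: "m = butlast m @ [last m]" using assms mp(4) by simp
  have "split_at (last m) (m @ p)"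
    unfolding split_at_def using mp m ends_lowest_minus[of "butlast m"] nonneg_plus
    by (intro exI[of _ "butlast m"] exI[of _ p]) (auto dest: in_set_butlastD)
  then have "split_at (last m) xs"
    using reduce_signs_backward[of "split_at (last m)"] split_at_insert mp(1) by metis
  then show "split_at (last (filter (\<lambda>x. \<not> snd x) (reduce_signs xs))) xs"
    "\<not> snd (last (filter (\<lambda>x. \<not> snd x) (reduce_signs xs)))"
    using mp(2,4) m by (simp, metis last_in_set assms)
qed

lemma no_minus: "filter (\<lambda>x. \<not> snd x) (reduce_signs xs) = [] \<Longrightarrow> nonneg xs"
proof -
  assume e: "filter (\<lambda>x. \<not> snd x) (reduce_signs xs) = []"
  obtain m p where mp: "reduce_signs xs = m @ p" "\<forall>x \<in> set p. snd x"
    "filter (\<lambda>x. \<not> snd x) (reduce_signs xs) = m" by (rule reduced_form)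
  then have "nonneg (reduce_signs xs)" using e nonneg_plus by simp
  then show ?thesis using reduce_signs_backward[of nonneg] nonneg_insert by blast
qed

lemma first_plus:
  assumes "filter snd (reduce_signs xs) \<noteq> []"
  shows "split_at (hd (filter snd (reduce_signs xs))) xs" "snd (hd (filter snd (reduce_signs xs)))"
proof -
  obtain m p where mp: "reduce_signs xs = m @ p" "\<forall>x \<in> set m. \<not> snd x" "\<forall>x \<in> set p. snd x"
    "filter snd (reduce_signs xs) = p" by (rule reduced_form)
  have p: "p = hd p # tl p" using assms mp(4) by simp
  have "split_at (hd p) (m @ p)"
    unfolding split_at_def using mp p ends_lowest_minus nonneg_plus[of "tl p"]
    by (intro exI[of _ m] exI[of _ "tl p"]) (auto dest: list.set_sel(2)[rotated])
  then have "split_at (hd p) xs"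
    using reduce_signs_backward[of "split_at (hd p)"] split_at_insert mp(1) by metis
  then show "split_at (hd (filter snd (reduce_signs xs))) xs" "snd (hd (filter snd (reduce_signs xs)))"
    using mp(3,4) p by (simp, metis hd_in_set assms)
qed

lemma no_plus: "filter snd (reduce_signs xs) = [] \<Longrightarrow> ends_lowest xs"
proof -
  assume e: "filter snd (reduce_signs xs) = []"
  obtain m p where mp: "reduce_signs xs = m @ p" "\<forall>x \<in> set m. \<not> snd x"
    "filter snd (reduce_signs xs) = p" by (rule reduced_form)
  then have "ends_lowest (reduce_signs xs)" using e ends_lowest_minus by simp
  then show ?thesis using reduce_signs_backward[of ends_lowest] ends_lowest_insert by blast
qed

section \<open>Prefix heights of a word\<close>

definition ht :: "nat \<Rightarrow> (nat \<times> 'a) list \<Rightarrow> int" where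
  "ht i w = (\<Sum>x\<leftarrow>w. if fst x = Suc i then 1 else if fst x = i then -1 else 0)"

lemma ht_simps [simp]: "ht i [] = 0"
  "ht i (x # xs) = (if fst x = Suc i then 1 else if fst x = i then -1 else 0) + ht i xs"
  "ht i (xs @ ys) = ht i xs + ht i ys"
  by (simp_all add: ht_def)

text \<open>\<open>signs\<close> restricted to a list of positions, with absolute positions kept, so
  that splitting an index interval splits the sign word.\<close>

definition sg :: "nat \<Rightarrow> (nat \<times> (nat \<times> nat) \<times> bool) list \<Rightarrow> nat list \<Rightarrow> (nat \<times> bool) list" where
  "sg i w js = [(j, fst (w ! j) = Suc i). j \<leftarrow> js, fst (w ! j) = i \<or> fst (w ! j) = Suc i]"

lemma sg_append: "sg i w (js @ ks) = sg i w js @ sg i w ks"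
  by (simp add: sg_def)

lemma sign_sum_sg: "n \<le> length w \<Longrightarrow> sign_sum (sg i w [0..<n]) = ht i (take n w)"
  by (induction n) (auto simp: sg_append take_Suc_conv_app_nth, auto simp: sg_def)

lemma sg_split:
  assumes "sg i w [0..<n] = u @ (j, s) # v"
  shows "j < n" "s = (fst (w ! j) = Suc i)" "fst (w ! j) = i \<or> fst (w ! j) = Suc i"
    "u = sg i w [0..<j]" "v = sg i w [Suc j..<n]"
proof -
  have mem: "(j, s) \<in> set (sg i w [0..<n])" using assms by simp
  then show j: "j < n" "s = (fst (w ! j) = Suc i)" "fst (w ! j) = i \<or> fst (w ! j) = Suc i"
    by (auto simp: sg_def split: if_splits)
  have "[0..<n] = [0..<j] @ j # [Suc j..<n]"
    using j(1) by (metis le0 upt_add_eq_append upt_conv_Cons le_add_diff_inverse less_imp_le_nat add_0)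
  then have e: "sg i w [0..<j] @ (j, s) # sg i w [Suc j..<n] = u @ (j, s) # v"
    using assms j(2,3) sg_append[of i w "[0..<j]" "j # [Suc j..<n]"] by (auto simp: sg_def)
  \<comment> \<open>Every position occurs at most once, so the decomposition at
    \<open>(j, s)\<close> is unique.\<close>
  have d: "distinct (map fst (sg i w [0..<n]))"
  proof -
    have "map fst (sg i w js) = filter (\<lambda>j. fst (w ! j) = i \<or> fst (w ! j) = Suc i) js" for js
      by (induction js) (auto simp: sg_def)
    then show ?thesis by simp
  qed
  have nu: "(j, s) \<notin> set u" "(j, s) \<notin> set v" using d unfolding assms by (auto simp: rev_image_eqI)
  have "(j, s) \<notin> set (sg i w [0..<j])" "(j, s) \<notin> set (sg i w [Suc j..<n])" by (auto simp: sg_def)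
  then show "u = sg i w [0..<j]" "v = sg i w [Suc j..<n]"
    using e nu by (metis append_Cons_eq_iff)+
qed

lemma signs_sg: "signs i w = sg i w [0..<length w]"
  by (simp add: signs_def sg_def)

lemma sg_prefix: "m \<le> n \<Longrightarrow> \<exists>k. sg i w [a..<m] = take k (sg i w [a..<n])"
proof -
  assume mn: "m \<le> n"
  have "sg i w [a..<n] = sg i w [a..<m] @ sg i w [max a m..<n]"
  proof (cases "a \<le> m")
    case True
    then have "[a..<n] = [a..<m] @ [m..<n]" using mn by (metis le_add_diff_inverse upt_add_eq_append)
    then show ?thesis using True sg_append by (simp add: max_def)
  qed (simp add: sg_def)
  then show ?thesis by (metis append_eq_conv_conj)
qed

text \<open>From here on an unpaired sign is handled through prefix heights of the word, which can
  be summed column by column.\<close>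

lemma split_at_signs:
  assumes "split_at (j, s) (signs i w)"
  shows "j < length w" "s = (fst (w ! j) = Suc i)" "fst (w ! j) = (if s then Suc i else i)"
    "j' \<le> j \<Longrightarrow> ht i (take j w) \<le> ht i (take j' w)"
    "j < j' \<Longrightarrow> ht i (take (Suc j) w) \<le> ht i (take j' w)"
proof -
  let ?n = "length w"
  obtain u v where uv: "sg i w [0..<?n] = u @ (j, s) # v" "ends_lowest u" "nonneg v"
    using assms unfolding split_at_def signs_sg by blast
  note s = sg_split[OF uv(1)]
  show j: "j < length w" "s = (fst (w ! j) = Suc i)" "fst (w ! j) = (if s then Suc i else i)" using s by auto
  show "ht i (take j w) \<le> ht i (take j' w)" if le: "j' \<le> j"
  proof -
    obtain k where k: "sg i w [0..<j'] = take k u" using sg_prefix[OF le, of i w 0] s(4) by metis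
    have "sign_sum u \<le> sign_sum (take k u)" using uv(2) by (simp add: ends_lowest_def)
    then show ?thesis using sign_sum_sg[of j w i] sign_sum_sg[of j' w i] le j(1) s(4) k by simp
  qed
  show "ht i (take (Suc j) w) \<le> ht i (take j' w)" if "j < j'"
  proof -
    let ?m = "min j' ?n"
    obtain k where k: "sg i w [Suc j..<?m] = take k v" using sg_prefix[of ?m ?n i w "Suc j"] s(5) by fastforce
    have jm: "Suc j \<le> ?m" using that j(1) by simp
    have "[0..<?m] = [0..<Suc j] @ [Suc j..<?m]"
      by (metis upt_add_eq_append[of 0 "Suc j" "?m - Suc j"] le_add_diff_inverse[OF jm] le0)
    then have "sign_sum (sg i w [0..<?m]) = sign_sum (sg i w [0..<Suc j]) + sign_sum (take k v)"
      unfolding k[symmetric] by (simp only: sg_append sign_sum_simps)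
    moreover have "0 \<le> sign_sum (take k v)" using uv(3) by (simp add: nonneg_def)
    moreover have "take ?m w = take j' w" by (simp add: min_def)
    ultimately show ?thesis using sign_sum_sg[of "Suc j" w i] sign_sum_sg[of ?m w i] j(1) by simp
  qed
qed

lemma nonneg_signs: assumes "nonneg (signs i w)" shows "0 \<le> ht i (take n w)"
proof -
  let ?m = "min n (length w)"
  obtain k where k: "sg i w [0..<?m] = take k (signs i w)"
    using sg_prefix[of ?m "length w" i w 0] unfolding signs_sg by fastforce
  have "take ?m w = take n w" by (simp add: min_def)
  then show ?thesis using sign_sum_sg[of ?m w i] k assms[unfolded nonneg_def, rule_format, of k] by simp
qed

lemma ends_lowest_signs: assumes "ends_lowest (signs i w)" shows "ht i w \<le> ht i (take n w)"
proof -
  let ?m = "min n (length w)"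
  obtain k where k: "sg i w [0..<?m] = take k (signs i w)"
    using sg_prefix[of ?m "length w" i w 0] unfolding signs_sg by fastforce
  have "take ?m w = take n w" by (simp add: min_def)
  then show ?thesis using sign_sum_sg[of ?m w i] sign_sum_sg[of "length w" w i] k assms[unfolded ends_lowest_def, rule_format, of k]
    by (simp add: signs_sg)
qed

section \<open>Reading words of column models\<close>

definition cell_leg :: "column \<Rightarrow> nat \<Rightarrow> nat list" where
  "cell_leg K r = sorted_list_of_set {v \<in> lg K. row K v = r}"

definition cell_arm :: "column \<Rightarrow> nat \<Rightarrow> nat list" where
  "cell_arm K r = sorted_list_of_multiset {#v \<in># am K. row K v = r#}"

definition conc :: "(nat \<Rightarrow> column) \<Rightarrow> hvt" where
  "conc C = (\<lambda>(r, c). if 1 \<le> r \<and> r \<le> card (hk (C c)) then Some (cell_leg (C c) r, cell_arm (C c) r) else None)"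

lemma row_bounds: assumes "valid C" "v \<in> ents (C c)" shows "1 \<le> row (C c) v" "row (C c) v \<le> card (hk (C c))"
proof -
  have "below (hk (C (Suc c))) v < row (C c) v"
    using validD(2)[OF assms(1), of c] assms(2) by (simp add: adj_def)
  then show "1 \<le> row (C c) v" by simp
  show "row (C c) v \<le> card (hk (C c))"
    using below_le_card[OF wfcolD(2)[OF validD(1)[OF assms(1)]]] .
qed

lemma set_cell_leg: "valid C \<Longrightarrow> set (cell_leg (C c) r) = {v \<in> lg (C c). row (C c) v = r}"
  using wfcolD(1)[OF validD(1)] by (simp add: cell_leg_def)

lemma mset_cell_arm: "mset (cell_arm K r) = {#v \<in># am K. row K v = r#}"
  by (simp add: cell_arm_def)

lemma set_cell_arm: "set (cell_arm K r) = {v \<in> set_mset (am K). row K v = r}"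
  using arg_cong[OF mset_cell_arm, of set_mset K r] by simp

lemma cell_leg_out: "valid C \<Longrightarrow> \<not> (1 \<le> r \<and> r \<le> card (hk (C c))) \<Longrightarrow> cell_leg (C c) r = []"
proof -
  assume v: "valid C" and r: "\<not> (1 \<le> r \<and> r \<le> card (hk (C c)))"
  have "{v \<in> lg (C c). row (C c) v = r} = {}" using row_bounds[OF v, of _ c] r by (auto simp: ents_def)
  then show ?thesis unfolding cell_leg_def by (simp only: sorted_list_of_set_empty)
qed

lemma cell_arm_out: "valid C \<Longrightarrow> \<not> (1 \<le> r \<and> r \<le> card (hk (C c))) \<Longrightarrow> cell_arm (C c) r = []"
proof -
  assume v: "valid C" and r: "\<not> (1 \<le> r \<and> r \<le> card (hk (C c)))"
  have "set (cell_arm (C c) r) = {}" unfolding set_cell_arm using row_bounds[OF v, of _ c] r by (auto simp: ents_def)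
  then show ?thesis by simp
qed

lemma xleg_conc: "valid C \<Longrightarrow> xleg (conc C) (r, c) = cell_leg (C c) r"
  by (auto simp: xleg_def conc_def dest: cell_leg_out[of C r c])

lemma arm_conc: "valid C \<Longrightarrow> arm (conc C) (r, c) = cell_arm (C c) r"
  by (auto simp: arm_def conc_def dest: cell_arm_out[of C r c])

lemma dom_conc: "dom (conc C) = {(r, c). 1 \<le> r \<and> r \<le> card (hk (C c))}"
  by (auto simp: conc_def split: if_splits)

lemma colheight_conc: "colheight (conc C) c = card (hk (C c))"
proof -
  have "{r. (r, c) \<in> dom (conc C)} = {1..card (hk (C c))}" by (auto simp: dom_conc)
  then show ?thesis by (simp add: colheight_def)
qed

lemma finite_dom_conc: assumes "valid C" shows "finite (dom (conc C))"
proof -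
  obtain n where n: "\<forall>c>n. hk (C c) = {}" using assms by (auto simp: valid_def)
  have "dom (conc C) \<subseteq> (\<Union>c\<in>{..n}. {1..card (hk (C c))} \<times> {c})"
    using n by (auto simp: dom_conc not_le[symmetric])
  then show ?thesis by (rule finite_subset) auto
qed

lemma hk_beyond: assumes "valid C" "c > ncols (conc C)" shows "hk (C c) = {}"
proof (rule ccontr)
  assume "hk (C c) \<noteq> {}"
  then have "card (hk (C c)) > 0" using wfcolD(2)[OF validD(1)[OF assms(1)]] by (simp add: card_gt_0_iff)
  then have m: "(1, c) \<in> dom (conc C)" by (simp add: dom_conc Suc_le_eq)
  then have "c \<le> Max (snd ` dom (conc C))" using finite_dom_conc[OF assms(1)] by (intro Max_ge) force+
  then show False using m assms(2) by (auto simp: ncols_def split: if_splits)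
qed

definition legw :: "column \<Rightarrow> nat \<Rightarrow> (nat \<times> (nat \<times> nat) \<times> bool) list" where
  "legw K c = concat (map (\<lambda>r. map (\<lambda>v. (v, (r, c), False)) (rev (cell_leg K r))) (rev [1..<card (hk K) + 1]))"

definition armw :: "column \<Rightarrow> nat \<Rightarrow> (nat \<times> (nat \<times> nat) \<times> bool) list" where
  "armw K c = sort_key fst (concat (map (\<lambda>r. map (\<lambda>v. (v, (r, c), True)) (cell_arm K r)) [1..<card (hk K) + 1]))"

definition cw :: "(nat \<Rightarrow> column) \<Rightarrow> nat \<Rightarrow> (nat \<times> (nat \<times> nat) \<times> bool) list" where
  "cw C c = legw (C c) c @ armw (C c) c"

lemma col_word_conc: "valid C \<Longrightarrow> col_word (conc C) c = cw C c"
  by (simp add: col_word_def colheight_conc xleg_conc arm_conc cw_def legw_def armw_def)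

lemma set_legw: "valid C \<Longrightarrow> x \<in> set (legw (C c) c) \<Longrightarrow> \<exists>v \<in> lg (C c). x = (v, (row (C c) v, c), False)"
  by (auto simp: legw_def set_cell_leg)

lemma set_armw: "x \<in> set (armw (C c) c) \<Longrightarrow> \<exists>v \<in># am (C c). x = (v, (row (C c) v, c), True)"
  by (auto simp: armw_def set_cell_arm)

text \<open>Entries increase strictly from cell to cell up the column, so reading the cells and
  their extended legs downwards lists the whole leg set in decreasing order.\<close>

lemma legw_letters:
  assumes "valid C"
  shows "map fst (legw (C c) c) = rev (sorted_list_of_set (lg (C c)))"
proof -
  let ?K = "C c"
  have fK: "finite (hk ?K)" "finite (lg ?K)" using wfcolD[OF validD(1)[OF assms]] by auto
  have "map fst (legw ?K c) = concat (map (\<lambda>r. rev (cell_leg ?K r)) (rev [1..<card (hk ?K) + 1]))"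
    by (simp add: legw_def map_concat o_def)
  also have "\<dots> = rev (concat (map (cell_leg ?K) [1..<card (hk ?K) + 1]))"
    by (simp add: rev_concat rev_map o_def)
  also have "concat (map (cell_leg ?K) [1..<card (hk ?K) + 1]) = sorted_list_of_set (lg ?K)"
  proof (rule strict_sorted_equal)
    have s: "set (concat (map (cell_leg ?K) [1..<n + 1])) = {v \<in> lg ?K. 1 \<le> row ?K v \<and> row ?K v \<le> n}" for n
      by (auto simp: set_cell_leg[OF assms] less_Suc_eq_le)
    have "sorted_wrt (<) (concat (map (cell_leg ?K) [1..<n + 1]))" for n
    proof (induction n)
      case (Suc n)
      have "x < y" if "x \<in> set (concat (map (cell_leg ?K) [1..<n + 1]))" "y \<in> set (cell_leg ?K (Suc n))" for x y
      proof (rule ccontr)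
        assume "\<not> x < y"
        then have "row ?K y \<le> row ?K x" using below_mono[OF fK(1)] by simp
        then show False using that unfolding s set_cell_leg[OF assms] by simp
      qed
      moreover have "sorted_wrt (<) (cell_leg ?K (Suc n))" by (simp add: cell_leg_def)
      ultimately show ?case using Suc by (auto simp: sorted_wrt_append)
    qed simp
    then show "sorted_wrt (<) (concat (map (cell_leg ?K) [1..<card (hk ?K) + 1]))" .
    show "sorted_wrt (<) (sorted_list_of_set (lg ?K))" by simp
    show "set (concat (map (cell_leg ?K) [1..<card (hk ?K) + 1])) = set (sorted_list_of_set (lg ?K))"
      using s row_bounds[OF assms, of _ c] fK by (auto simp: ents_def)
  qed
  finally show ?thesis .
qed

lemma armw_letters:
  assumes "valid C"
  shows "map fst (armw (C c) c) = sorted_list_of_multiset (am (C c))"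
proof -
  let ?K = "C c"
  let ?xs = "concat (map (\<lambda>r. map (\<lambda>v. (v, (r, c), True)) (cell_arm ?K r)) [1..<card (hk ?K) + 1])"
  have "mset (concat (map (cell_arm ?K) [1..<n + 1])) = {#v \<in># am ?K. 1 \<le> row ?K v \<and> row ?K v \<le> n#}" for n
  proof (induction n)
    case 0
    have "{#v \<in># am ?K. 1 \<le> row ?K v \<and> row ?K v \<le> 0#} = {#}" by (rule multiset_eqI) simp
    then show ?case by simp
  next
    case (Suc n)
    then show ?case by (auto simp: mset_cell_arm intro!: multiset_eqI)
  qed
  then have "mset (concat (map (cell_arm ?K) [1..<card (hk ?K) + 1])) = {#v \<in># am ?K. 1 \<le> row ?K v \<and> row ?K v \<le> card (hk ?K)#}" .
  also have "\<dots> = am ?K"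
  proof (rule multiset_eqI)
    fix x
    show "count {#v \<in># am ?K. 1 \<le> row ?K v \<and> row ?K v \<le> card (hk ?K)#} x = count (am ?K) x"
      using row_bounds[OF assms, of x c] by (cases "x \<in># am ?K") (auto simp: ents_def not_in_iff)
  qed
  finally have m: "mset (map fst ?xs) = am ?K" by (simp add: map_concat o_def)
  \<comment> \<open>The order that \<open>sort_key\<close> gives to equal letters of different cells
    is invisible after projecting to the letters.\<close>
  have "map fst (armw ?K c) = sort (map fst ?xs)"
    unfolding armw_def by (rule properties_for_sort[symmetric]) (simp_all only: mset_map mset_sort sorted_sort_key)
  also have "\<dots> = sorted_list_of_multiset (am ?K)" unfolding m[symmetric] by (simp only: sorted_list_of_multiset_mset)
  finally show ?thesis .
qed

lemma ht_count: "ht i w = int (count (mset (map fst w)) (Suc i)) - int (count (mset (map fst w)) i)"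
  by (induction w) auto

lemma cw_letters:
  "valid C \<Longrightarrow> map fst (cw C c) = rev (sorted_list_of_set (lg (C c))) @ sorted_list_of_multiset (am (C c))"
  by (simp add: cw_def legw_letters armw_letters)

lemma length_legw: "valid C \<Longrightarrow> length (legw (C c) c) = card (lg (C c))"
  using arg_cong[OF legw_letters, of C length c] by simp

lemma count_rev_leg: "finite A \<Longrightarrow> count (mset (rev (sorted_list_of_set A))) x = of_bool (x \<in> A)"
  using distinct_count_atmost_1[of "sorted_list_of_set A"] by simp

lemma ht_cw: "valid C \<Longrightarrow> ht i (cw C c) = int (up i (C c)) - int (um i (C c))"
  using wfcolD(1)[OF validD(1), of C c] unfolding ht_count cw_letters
  by (auto simp: count_rev_leg[simplified] um_def up_def of_bool_def)

lemma sorted_list_of_multiset_split: "sorted_list_of_multiset M = sorted_list_of_multiset {#x \<in># M. x \<le> i#} @ sorted_list_of_multiset {#x \<in># M. \<not> x \<le> (i::nat)#}"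
proof -
  let ?l = "sorted_list_of_multiset {#x \<in># M. x \<le> i#} @ sorted_list_of_multiset {#x \<in># M. \<not> x \<le> i#}"
  have "sorted ?l" by (auto simp: sorted_append)
  moreover have "mset ?l = M" by (simp add: multiset_partition[symmetric])
  ultimately show ?thesis by (metis sorted_list_of_multiset_mset sorted_sort_id)
qed

text \<open>At this position all minuses of the column have been read, but no plus of an arm; a
  nonzero \<open>um\<close> is attained here.\<close>

definition lowpos :: "nat \<Rightarrow> column \<Rightarrow> nat" where
  "lowpos i K = card (lg K) + size {#x \<in># am K. x \<le> i#}"

lemma ht_lowpos:
  assumes v: "valid C"
  shows "lowpos i (C c) \<le> length (cw C c)"
    "ht i (take (lowpos i (C c)) (cw C c)) = of_bool (Suc i \<in> lg (C c)) - of_bool (i \<in> lg (C c)) - int (count (am (C c)) i)"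
proof -
  let ?K = "C c"
  have f: "finite (lg ?K)" using wfcolD(1)[OF validD(1)[OF v]] .
  have l: "length (sorted_list_of_multiset M) = size M" for M :: "nat multiset"
    by (metis mset_sorted_list_of_multiset size_mset)
  have "length (cw C c) = card (lg ?K) + size (am ?K)"
    using arg_cong[OF cw_letters[OF v, of c], of length] by (simp add: l)
  then show "lowpos i ?K \<le> length (cw C c)" by (simp add: lowpos_def size_filter_mset_lesseq)
  have "map fst (take (lowpos i ?K) (cw C c)) =
      rev (sorted_list_of_set (lg ?K)) @ sorted_list_of_multiset {#x \<in># am ?K. x \<le> i#}"
    unfolding take_map[symmetric] cw_letters[OF v] sorted_list_of_multiset_split[of "am ?K" i] by (simp add: lowpos_def l)
  then show "ht i (take (lowpos i ?K) (cw C c)) = of_bool (Suc i \<in> lg ?K) - of_bool (i \<in> lg ?K) - int (count (am ?K) i)"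
    unfolding ht_count by (simp add: count_rev_leg[OF f, simplified])
qed

text \<open>The leg part is decreasing, so \<open>i + 1\<close> comes before \<open>i\<close>, and
  the height within it is -1 only if \<open>i\<close> occurs without \<open>i + 1\<close>.\<close>

lemma leg_prefix:
  assumes v: "valid C" and n: "n \<le> card (lg (C c))"
  shows "ht i (take n (cw C c)) \<ge> - of_bool (i \<in> lg (C c) \<and> Suc i \<notin> lg (C c))"
    "n < card (lg (C c)) \<Longrightarrow> fst (cw C c ! n) = i \<Longrightarrow>
      i \<in> lg (C c) \<and> ht i (take (Suc n) (cw C c)) = of_bool (Suc i \<in> lg (C c)) - 1"
    "n < card (lg (C c)) \<Longrightarrow> fst (cw C c ! n) = Suc i \<Longrightarrow> Suc i \<in> lg (C c) \<and> ht i (take n (cw C c)) = 0"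
proof -
  let ?K = "C c"
  let ?s = "rev (sorted_list_of_set (lg ?K))"
  have f: "finite (lg ?K)" using wfcolD(1)[OF validD(1)[OF v]] .
  have ls: "length ?s = card (lg ?K)" by simp
  have tk: "m \<le> card (lg ?K) \<Longrightarrow> map fst (take m (cw C c)) = take m ?s" for m
    unfolding take_map[symmetric] cw_letters[OF v] by simp
  have desc: "sorted_wrt (>) ?s" by (simp add: sorted_wrt_rev)
  have dist: "distinct ?s" by simp
  have cnt: "count (mset xs) x = of_bool (x \<in> set xs)" if "distinct xs" for xs and x :: nat
    using that distinct_count_atmost_1[of xs] by simp
  have ht: "ht i (take m (cw C c)) = of_bool (Suc i \<in> set (take m ?s)) - of_bool (i \<in> set (take m ?s))"
    if "m \<le> card (lg ?K)" for m
    unfolding ht_count tk[OF that] using dist by (subst (1 2) cnt) auto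
  have split: "?s = take m ?s @ drop m ?s" for m by simp
  have set: "set (take m ?s) \<union> set (drop m ?s) = lg ?K" for m
    using f by (metis append_take_drop_id set_append set_rev set_sorted_list_of_set)
  have gt: "x > y" if "x \<in> set (take m ?s)" "y \<in> set (drop m ?s)" for x y m
    using desc that by (metis split sorted_wrt_append)
  show "ht i (take n (cw C c)) \<ge> - of_bool (i \<in> lg ?K \<and> Suc i \<notin> lg ?K)"
    unfolding ht[OF n] using gt[of i n "Suc i"] set[of n] by auto
  { fix x assume n': "n < card (lg ?K)" and x: "fst (cw C c ! n) = x"
    have "n < length (cw C c)" using n' arg_cong[OF cw_letters[OF v, of c], of length] by simp
    then have "map fst (cw C c) ! n = x" using x by simp
    then have sn: "?s ! n = x" using n' unfolding cw_letters[OF v] by (simp add: nth_append)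
    have d: "drop n ?s = x # drop (Suc n) ?s" using sn n' ls Cons_nth_drop_Suc by metis
    have t: "take (Suc n) ?s = take n ?s @ [x]" using sn n' ls take_Suc_conv_app_nth by metis
    note d t }
  note dt = this
  show "i \<in> lg ?K \<and> ht i (take (Suc n) (cw C c)) = of_bool (Suc i \<in> lg ?K) - 1"
    if "n < card (lg ?K)" "fst (cw C c ! n) = i"
  proof -
    note d = dt[OF that]
    have "i \<in> set (take (Suc n) ?s)" unfolding d(2) by simp
    moreover have "Suc i \<in> set (take (Suc n) ?s) \<longleftrightarrow> Suc i \<in> lg ?K"
      using gt[of i "Suc n" "Suc i"] calculation set[of "Suc n"] by auto
    moreover have "i \<in> lg ?K" using set[of "Suc n"] calculation by blast
    ultimately show ?thesis using ht[of "Suc n"] that(1) by simp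
  qed
  show "Suc i \<in> lg ?K \<and> ht i (take n (cw C c)) = 0"
    if "n < card (lg ?K)" "fst (cw C c ! n) = Suc i"
  proof -
    note d = dt[OF that]
    have "Suc i \<in> set (drop n ?s)" unfolding d(1) by simp
    then have "i \<notin> set (take n ?s)" "Suc i \<notin> set (take n ?s)" "Suc i \<in> lg ?K"
      using gt[of i n "Suc i"] gt[of "Suc i" n "Suc i"] set[of n] by auto
    then show ?thesis using ht[OF n] by simp
  qed
qed

lemma arm_prefix:
  assumes v: "valid C" and n: "card (lg (C c)) \<le> n"
  shows "ht i (take n (cw C c)) \<ge> of_bool (Suc i \<in> lg (C c)) - of_bool (i \<in> lg (C c)) - int (count (am (C c)) i)"
proof -
  let ?K = "C c"
  let ?a = "sorted_list_of_multiset (am ?K)"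
  have f: "finite (lg ?K)" using wfcolD(1)[OF validD(1)[OF v]] .
  obtain m where m: "n = card (lg ?K) + m" using n le_Suc_ex by blast
  have t: "map fst (take n (cw C c)) = rev (sorted_list_of_set (lg ?K)) @ take m ?a"
    unfolding take_map[symmetric] cw_letters[OF v] by (simp add: m)
  have "mset (take m ?a) \<subseteq># am ?K"
    by (metis append_take_drop_id mset_append mset_sorted_list_of_multiset mset_subset_eq_add_left)
  then have "count (mset (take m ?a)) i \<le> count (am ?K) i" by (simp add: mset_subset_eq_count)
  then show ?thesis unfolding ht_count t by (simp add: count_rev_leg[OF f, simplified])
qed

lemma ht_prefix_ge: assumes v: "valid C" shows "ht i (take n (cw C c)) \<ge> - int (um i (C c))"
  using leg_prefix(1)[OF v, of n c i] arm_prefix[OF v, of c n i]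
  by (cases "n \<le> card (lg (C c))") (auto simp: um_def of_bool_def split: if_splits)

lemma ht_prefix_min: assumes v: "valid C" shows "\<exists>n \<le> length (cw C c). ht i (take n (cw C c)) = - int (um i (C c))"
proof (cases "um i (C c) = 0")
  case True
  then show ?thesis by (intro exI[of _ 0]) simp
next
  case False
  then show ?thesis
    using ht_lowpos[OF v, of i c] by (intro exI[of _ "lowpos i (C c)"]) (auto simp: um_def of_bool_def)
qed

section \<open>Columns in the concatenated word and the position of the acting letter\<close>

definition pre :: "(nat \<Rightarrow> column) \<Rightarrow> nat \<Rightarrow> (nat \<times> (nat \<times> nat) \<times> bool) list" where
  "pre C e = concat (map (cw C) [1..<e])"

lemma pre_1 [simp]: "pre C (Suc 0) = []"
  by (simp add: pre_def)

lemma pre_Suc: "1 \<le> e \<Longrightarrow> pre C (Suc e) = pre C e @ cw C e"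
  by (simp add: pre_def)

lemma pre_mono: assumes "1 \<le> e" "e \<le> e'" shows "\<exists>r. pre C e' = pre C e @ r"
  using assms(2,1) by (induction e' rule: dec_induct) (auto simp: pre_Suc)

lemma reading_word_conc: "valid C \<Longrightarrow> reading_word (conc C) = pre C (ncols (conc C) + 1)"
proof -
  assume "valid C"
  then have "col_word (conc C) = cw C" by (intro ext col_word_conc)
  then show ?thesis unfolding reading_word_def pre_def by (rule arg_cong)
qed

lemma cw_beyond: assumes "valid C" "e > ncols (conc C)" shows "cw C e = []"
  using hk_beyond[OF assms] by (simp add: cw_def legw_def armw_def)

text \<open>\<open>fsel\<close> and \<open>esel\<close> range over all columns, including the empty
  ones beyond the shape; the words of those are empty, so such prefixes are the whole word.\<close>

lemma pre_beyond: assumes "valid C" "e > ncols (conc C)" shows "pre C e = reading_word (conc C)"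
  unfolding reading_word_conc[OF assms(1)]
proof -
  have "ncols (conc C) + 1 \<le> e" using assms(2) by simp
  then show "pre C e = pre C (ncols (conc C) + 1)"
    by (induction rule: dec_induct) (auto simp: pre_Suc cw_beyond[OF assms(1)])
qed

lemma take_word:
  assumes "valid C" "1 \<le> e" "n \<le> length (cw C e)"
  shows "take (length (pre C e) + n) (reading_word (conc C)) = pre C e @ take n (cw C e)"
proof -
  define m where "m = max (Suc e) (ncols (conc C) + 1)"
  have "reading_word (conc C) = pre C m" using pre_beyond[OF assms(1), of m] by (simp add: m_def)
  moreover obtain r where "pre C m = pre C (Suc e) @ r" using pre_mono[of "Suc e" m C] by (auto simp: m_def)
  ultimately show ?thesis using assms by (simp add: pre_Suc)
qed

lemma ht_pre: assumes "valid C" "1 \<le> e" shows "ht i (pre C e) = hgt i C e"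
  using assms(2)
proof (induction rule: dec_induct)
  case base
  then show ?case using assms(1) by (simp add: hgt_def)
next
  case (step e)
  then show ?case using assms(1) by (simp add: pre_Suc hgt_def ht_cw)
qed

lemma ht_word: assumes "valid C" "1 \<le> e" "n \<le> length (cw C e)"
  shows "ht i (take (length (pre C e) + n) (reading_word (conc C))) = hgt i C e + ht i (take n (cw C e))"
  using take_word[OF assms] ht_pre[OF assms(1,2)] by simp

lemma dip_attained: assumes "valid C" "1 \<le> e"
  obtains n where "n \<le> length (cw C e)" "ht i (take (length (pre C e) + n) (reading_word (conc C))) = dip i C e"
proof -
  obtain n where "n \<le> length (cw C e)" "ht i (take n (cw C e)) = - int (um i (C e))"
    using ht_prefix_min[OF assms(1)] by blast
  then show ?thesis using that[of n] ht_word[OF assms, of n i] by (simp add: dip_def)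
qed

lemma length_pre: "1 \<le> e \<Longrightarrow> e < e' \<Longrightarrow> length (pre C e) + length (cw C e) \<le> length (pre C e')"
  using pre_mono[of "Suc e" e' C] by (auto simp: pre_Suc)

lemma locate:
  assumes v: "valid C" and j: "j < length (reading_word (conc C))"
  obtains e n where "1 \<le> e" "n < length (cw C e)" "j = length (pre C e) + n" "reading_word (conc C) ! j = cw C e ! n"
proof -
  let ?w = "reading_word (conc C)"
  define e where "e = (LEAST e. j < length (pre C (Suc e)))"
  have "j < length (pre C (Suc (ncols (conc C))))" using j reading_word_conc[OF v] by simp
  then have e: "j < length (pre C (Suc e))" unfolding e_def by (rule LeastI)
  have e1: "1 \<le> e" using e by (cases e) (auto simp: pre_def)
  have "\<not> j < length (pre C e)"
  proof
    assume "j < length (pre C e)"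
    then have "e \<le> e - 1" unfolding e_def using e1 by (intro Least_le) (auto simp: e_def)
    then show False using e1 by simp
  qed
  then obtain n where n: "j = length (pre C e) + n" using le_Suc_ex not_le by metis
  have nl: "n < length (cw C e)" using e n by (simp add: pre_Suc[OF e1])
  have t: "take (Suc j) ?w = pre C e @ take (Suc n) (cw C e)"
    using take_word[OF v e1, of "Suc n"] n nl by simp
  have "?w ! j = take (Suc j) ?w ! j" by simp
  also have "\<dots> = cw C e ! n" unfolding t using n by (simp add: nth_append)
  finally show ?thesis using that e1 nl n by blast
qed

lemma cw_nth:
  assumes v: "valid C" and n: "n < length (cw C e)" and x: "fst (cw C e ! n) = x"
  shows "cw C e ! n = (x, (row (C e) x, e), card (lg (C e)) \<le> n)"
    "card (lg (C e)) \<le> n \<Longrightarrow> x \<in># am (C e)" "n < card (lg (C e)) \<Longrightarrow> x \<in> lg (C e)"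
proof -
  have "if n < card (lg (C e)) then \<exists>y \<in> lg (C e). cw C e ! n = (y, (row (C e) y, e), False)
     else \<exists>y \<in># am (C e). cw C e ! n = (y, (row (C e) y, e), True)"
  proof (cases "n < card (lg (C e))")
    case True
    then have "cw C e ! n \<in> set (legw (C e) e)" by (simp add: cw_def nth_append length_legw[OF v])
    then show ?thesis using set_legw[OF v] True by simp
  next
    case False
    then have "cw C e ! n \<in> set (armw (C e) e)" using n by (simp add: cw_def nth_append length_legw[OF v])
    then show ?thesis using set_armw False by simp
  qed
  then show "cw C e ! n = (x, (row (C e) x, e), card (lg (C e)) \<le> n)"
    "card (lg (C e)) \<le> n \<Longrightarrow> x \<in># am (C e)" "n < card (lg (C e)) \<Longrightarrow> x \<in> lg (C e)"
    using x by (auto split: if_splits)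
qed

text \<open>Every column attains its dip at some prefix, so a height minimal among all prefixes is
  at most every dip; being reached inside column \<open>d\<close>, it is not below the dip of
  \<open>d\<close> either.\<close>

lemma lowest_position:
  fixes C :: "nat \<Rightarrow> column"
  defines "w \<equiv> reading_word (conc C)"
  assumes v: "valid C" and d: "1 \<le> d" "n \<le> length (cw C d)" and h: "h = hgt i C d + ht i (take n (cw C d))"
    and le: "\<And>j. h \<le> ht i (take j w)"
  shows "h = dip i C d" "h \<le> dip i C e"
proof -
  show dle: "h \<le> dip i C e" for e
  proof (cases "e = 0")
    case True then show ?thesis using le[of 0] v by simp
  next
    case False
    then show ?thesis using dip_attained[OF v, of e i] le unfolding w_def by (metis less_one not_le)
  qed
  show "h = dip i C d" using h dle[of d] ht_prefix_ge[OF v, of i d n] by (simp add: dip_def)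
qed

text \<open>Just after position \<open>j\<close> the path reaches its global minimum for the first
  time, so the column of \<open>j\<close> is the first one with minimal dip.\<close>

lemma fsel_position:
  fixes C :: "nat \<Rightarrow> column"
  defines "w \<equiv> reading_word (conc C)"
  assumes v: "valid C" and j: "j < length w" "fst (w ! j) = i"
    and le: "\<And>j'. j' \<le> j \<Longrightarrow> ht i (take j w) \<le> ht i (take j' w)"
    and gt: "\<And>j'. j < j' \<Longrightarrow> ht i (take (Suc j) w) \<le> ht i (take j' w)"
  shows "\<exists>d. fsel i C d \<and> w ! j = (i, (row (C d) i, d), i \<in># am (C d))"
proof -
  obtain d n where d: "1 \<le> d" "n < length (cw C d)" "j = length (pre C d) + n" "w ! j = cw C d ! n"
    using locate[OF v j(1)[unfolded w_def]] unfolding w_def by metis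
  define h where "h = ht i (take (Suc j) w)"
  have s: "ht i (take j w) = h + 1" using j by (simp add: h_def take_Suc_conv_app_nth)
  have hle: "h \<le> ht i (take j' w)" for j' using le[of j'] gt[of j'] s by (cases "j' \<le> j") (auto simp: h_def)
  have hlt: "h < ht i (take j' w)" if "j' \<le> j" for j' using le[OF that] s by simp
  have hn: "h = hgt i C d + ht i (take (Suc n) (cw C d))"
    using ht_word[OF v d(1), of "Suc n" i] d by (simp add: h_def w_def)
  have hd: "h = dip i C d" and dle: "h \<le> dip i C e" for e
    using lowest_position[OF v d(1) _ hn hle[unfolded w_def]] d(2) by auto
  have "h < dip i C e" if "e < d" for e
  proof (cases "e = 0")
    case True then show ?thesis using hlt[of 0] v by simp
  next
    case False
    then obtain m where m: "m \<le> length (cw C e)" "ht i (take (length (pre C e) + m) w) = dip i C e"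
      using dip_attained[OF v, of e i] unfolding w_def by (metis less_one not_le)
    have "length (pre C e) + m \<le> j" using length_pre[of e d C] that False m(1) d(3) by simp
    then show ?thesis using hlt m(2) by metis
  qed
  then have sel: "fsel i C d" using d(1) dle hd by (simp add: fsel_def)
  have x: "fst (cw C d ! n) = i" using j(2) d(4) by simp
  note c = cw_nth[OF v d(2) x]
  \<comment> \<open>If the letter came from the leg while an arm also contained \<open>i\<close>,
    the arm letters still to come would lead below the minimum.\<close>
  have "card (lg (C d)) \<le> n \<longleftrightarrow> i \<in># am (C d)"
  proof
    assume a: "i \<in># am (C d)"
    show "card (lg (C d)) \<le> n"
    proof (rule ccontr)
      assume "\<not> card (lg (C d)) \<le> n"
      then have n: "n < card (lg (C d))" by simp
      have "ht i (take (Suc n) (cw C d)) = of_bool (Suc i \<in> lg (C d)) - 1" "i \<in> lg (C d)"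
        using leg_prefix(2)[OF v _ n x] n by auto
      moreover have "h \<le> hgt i C d + ht i (take (lowpos i (C d)) (cw C d))"
        using hle[of "length (pre C d) + lowpos i (C d)"] ht_word[OF v d(1) ht_lowpos(1)[OF v]] by (simp add: w_def)
      ultimately have "count (am (C d)) i = 0" using hn ht_lowpos(2)[OF v, of i d] by simp
      then show False using a by (metis count_eq_zero_iff)
    qed
  qed (use c(2) in blast)
  then have "w ! j = (i, (row (C d) i, d), i \<in># am (C d))" using c(1) d(4) by simp
  then show ?thesis using sel by blast
qed

text \<open>Mirror image of the preceding lemma: just before position \<open>j\<close> the path is
  at its global minimum for the last time.\<close>

lemma esel_position:
  fixes C :: "nat \<Rightarrow> column"
  defines "w \<equiv> reading_word (conc C)"
  assumes v: "valid C" and j: "j < length w" "fst (w ! j) = Suc i"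
    and le: "\<And>j'. j' \<le> j \<Longrightarrow> ht i (take j w) \<le> ht i (take j' w)"
    and gt: "\<And>j'. j < j' \<Longrightarrow> ht i (take (Suc j) w) \<le> ht i (take j' w)"
  shows "\<exists>d. esel i C d \<and> w ! j = (Suc i, (row (C d) (Suc i), d), i \<in> ents (C d) \<or> Suc i \<notin> lg (C d))"
proof -
  obtain d n where d: "1 \<le> d" "n < length (cw C d)" "j = length (pre C d) + n" "w ! j = cw C d ! n"
    using locate[OF v j(1)[unfolded w_def]] unfolding w_def by metis
  define h where "h = ht i (take j w)"
  have s: "ht i (take (Suc j) w) = h + 1" using j by (simp add: h_def take_Suc_conv_app_nth)
  have hlt: "h < ht i (take j' w)" if "j < j'" for j' using gt[OF that] s by simp
  have hle: "h \<le> ht i (take j' w)" for j' using le[of j'] hlt[of j'] by (cases "j' \<le> j") (auto simp: h_def)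
  have hn: "h = hgt i C d + ht i (take n (cw C d))"
    using ht_word[OF v d(1), of n i] d by (simp add: h_def w_def)
  have hd: "h = dip i C d" and dle: "h \<le> dip i C e" for e
    using lowest_position[OF v d(1) _ hn hle[unfolded w_def]] d(2) by auto
  have "h < dip i C e" if "d < e" for e
  proof -
    have e1: "1 \<le> e" using that by simp
    obtain m where m: "m \<le> length (cw C e)" "ht i (take (length (pre C e) + m) w) = dip i C e"
      using dip_attained[OF v e1] unfolding w_def by metis
    have "j < length (pre C e) + m" using length_pre[of d e C] that d(1,2,3) by simp
    then show ?thesis using hlt m(2) by metis
  qed
  then have sel: "esel i C d" using d(1) dle hd by (simp add: esel_def)
  have x: "fst (cw C d ! n) = Suc i" using j(2) d(4) by simp
  note c = cw_nth[OF v d(2) x]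
  \<comment> \<open>If the letter comes from the leg, an \<open>i\<close> in the column would bring
    the path back to the minimum after \<open>j\<close>. If it comes from an arm, a leg entry
    \<open>i + 1\<close> without any \<open>i\<close> would have kept the path above its height at
    the start of the column, so not at the minimum.\<close>
  have "card (lg (C d)) \<le> n \<longleftrightarrow> i \<in> ents (C d) \<or> Suc i \<notin> lg (C d)"
  proof (cases "card (lg (C d)) \<le> n")
    case False
    then have n: "n < card (lg (C d))" by simp
    have z: "ht i (take n (cw C d)) = 0" "Suc i \<in> lg (C d)"
      using leg_prefix(3)[OF v _ n x] n by auto
    have "n < lowpos i (C d)" using n by (simp add: lowpos_def)
    then have "h < hgt i C d + ht i (take (lowpos i (C d)) (cw C d))"
      using hlt[of "length (pre C d) + lowpos i (C d)"] ht_word[OF v d(1) ht_lowpos(1)[OF v]] d(3) by (simp add: w_def)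
    then have "int (of_bool (i \<in> lg (C d)) + count (am (C d)) i) < 1"
      using hn z ht_lowpos(2)[OF v, of i d] by simp
    then have "i \<notin> ents (C d)" by (auto simp: ents_def not_in_iff of_bool_def split: if_splits)
    then show ?thesis using False z by simp
  next
    case True
    have "\<not> (i \<notin> ents (C d) \<and> Suc i \<in> lg (C d))"
    proof
      assume a: "i \<notin> ents (C d) \<and> Suc i \<in> lg (C d)"
      then have "ht i (take n (cw C d)) \<ge> 1"
        using arm_prefix[OF v True, of i] by (simp add: ents_def not_in_iff)
      moreover have "h \<le> hgt i C d"
        using hle[of "length (pre C d) + 0"] ht_word[OF v d(1), of 0 i] by (simp add: w_def)
      ultimately show False using hn by simp
    qed
    then show ?thesis using True by blast
  qed
  then have "w ! j = (Suc i, (row (C d) (Suc i), d), i \<in> ents (C d) \<or> Suc i \<notin> lg (C d))"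
    using c(1) d(4) by simp
  then show ?thesis using sel by blast
qed

lemma fsel_unpaired:
  assumes v: "valid C" and f: "fsel i C d"
  shows "filter (\<lambda>x. \<not> snd x) (unpaired i (conc C)) \<noteq> []"
proof
  assume "filter (\<lambda>x. \<not> snd x) (unpaired i (conc C)) = []"
  then have n: "nonneg (signs i (reading_word (conc C)))" unfolding unpaired_def by (rule no_minus)
  have d: "1 \<le> d" "dip i C d < dip i C 0" using f by (auto simp: fsel_def)
  obtain m where "ht i (take (length (pre C d) + m) (reading_word (conc C))) = dip i C d"
    using dip_attained[OF v d(1)] by metis
  then show False using nonneg_signs[OF n, of "length (pre C d) + m"] d(2) v by simp
qed

lemma esel_unpaired:
  assumes v: "valid C" and f: "esel i C d"
  shows "filter snd (unpaired i (conc C)) \<noteq> []"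
proof
  assume "filter snd (unpaired i (conc C)) = []"
  then have n: "ends_lowest (signs i (reading_word (conc C)))" unfolding unpaired_def by (rule no_plus)
  have d: "1 \<le> d" using f by (auto simp: esel_def)
  obtain m where m: "ht i (take (length (pre C d) + m) (reading_word (conc C))) = dip i C d"
    using dip_attained[OF v d(1)] by metis
  define e where "e = max d (ncols (conc C)) + 1"
  have e: "d < e" "e > ncols (conc C)" "1 \<le> e" by (auto simp: e_def)
  obtain k where k: "k \<le> length (cw C e)" "ht i (take (length (pre C e) + k) (reading_word (conc C))) = dip i C e"
    using dip_attained[OF v e(3)] by metis
  have "ht i (reading_word (conc C)) = dip i C e"
    using k cw_beyond[OF v e(2)] pre_beyond[OF v e(2)] by simp
  moreover have "dip i C d < dip i C e" using f e(1) by (simp add: esel_def)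
  ultimately show False using ends_lowest_signs[OF n, of "length (pre C d) + m"] m by simp
qed

lemma fsel_unique: "fsel i C d \<Longrightarrow> fsel i C d' \<Longrightarrow> d = d'"
  unfolding fsel_def by (metis linorder_neqE_nat not_le)

lemma esel_unique: "esel i C d \<Longrightarrow> esel i C d' \<Longrightarrow> d = d'"
  unfolding esel_def by (metis linorder_neqE_nat not_le)

lemma last_unpaired_minus:
  assumes v: "valid C" and ms: "filter (\<lambda>x. \<not> snd x) (unpaired i (conc C)) \<noteq> []"
  shows "\<exists>d. fsel i C d \<and> reading_word (conc C) ! fst (last (filter (\<lambda>x. \<not> snd x) (unpaired i (conc C))))
     = (i, (row (C d) i, d), i \<in># am (C d))"
proof -
  let ?x = "last (filter (\<lambda>x. \<not> snd x) (unpaired i (conc C)))"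
  have "split_at (fst ?x, False) (signs i (reading_word (conc C)))"
    using last_minus[OF ms[unfolded unpaired_def]] unfolding unpaired_def[symmetric] by (metis prod.collapse)
  note s = split_at_signs[OF this]
  show ?thesis by (rule fsel_position[OF v s(1)]) (use s in auto)
qed

lemma first_unpaired_plus:
  assumes v: "valid C" and ms: "filter snd (unpaired i (conc C)) \<noteq> []"
  shows "\<exists>d. esel i C d \<and> reading_word (conc C) ! fst (hd (filter snd (unpaired i (conc C))))
     = (Suc i, (row (C d) (Suc i), d), i \<in> ents (C d) \<or> Suc i \<notin> lg (C d))"
proof -
  let ?x = "hd (filter snd (unpaired i (conc C)))"
  have "split_at (fst ?x, True) (signs i (reading_word (conc C)))"
    using first_plus[OF ms[unfolded unpaired_def]] unfolding unpaired_def[symmetric] by (metis prod.collapse)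
  note s = split_at_signs[OF this]
  show ?thesis by (rule esel_position[OF v s(1)]) (use s in auto)
qed

section \<open>Crystal operators and bumping of column models\<close>

lemma sorted_list_of_set_eqI: "finite A \<Longrightarrow> sorted xs \<Longrightarrow> distinct xs \<Longrightarrow> set xs = A \<Longrightarrow> sorted_list_of_set A = xs"
  by (rule sorted_distinct_set_unique) simp_all

lemma sorted_list_of_set_insort: "finite A \<Longrightarrow> x \<notin> A \<Longrightarrow> sorted_list_of_set (insert x A) = insort x (sorted_list_of_set A)"
  by (rule sorted_list_of_set_eqI) (simp_all add: sorted_insort distinct_insort set_insort_key)

lemma sorted_list_of_set_remove1: "finite A \<Longrightarrow> sorted_list_of_set (A - {x}) = remove1 x (sorted_list_of_set A)"
  by (rule sorted_list_of_set_eqI) (simp_all add: sorted_remove1)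

lemma sorted_list_of_multiset_eqI: "sorted xs \<Longrightarrow> mset xs = M \<Longrightarrow> sorted_list_of_multiset M = xs"
  by (metis sorted_list_of_multiset_mset sorted_sort_id)

lemma sorted_list_of_multiset_remove1: "sorted_list_of_multiset (M - {#x#}) = remove1 x (sorted_list_of_multiset M)"
  by (rule sorted_list_of_multiset_eqI) (simp_all add: sorted_remove1)

section \<open>Effect of column updates on cells\<close>

lemma conc_col:
  assumes "card (hk K') = card (hk (C d))" "1 \<le> r" "r \<le> card (hk (C d))"
    and "\<And>s. s \<noteq> r \<Longrightarrow> cell_leg K' s = cell_leg (C d) s \<and> cell_arm K' s = cell_arm (C d) s"
  shows "conc (C(d := K')) = (conc C)((r, d) := Some (cell_leg K' r, cell_arm K' r))"
  using assms by (auto simp: conc_def fun_eq_iff)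

lemma cell_arm_arm:
  "cell_arm (Col H A (add_mset y (M - {#x#}))) s =
     (if below H (Suc y) = s then insort y else id)
       ((if below H (Suc x) = s then remove1 x else id) (cell_arm (Col H A M) s))"
  by (auto simp: cell_arm_def sorted_list_of_multiset_remove1[symmetric])

text \<open>With implicit rows, the same replacement of \<open>x\<close> by \<open>y\<close> stays
  in its cell (N) or changes the cell (M), according to whether the rows of \<open>x\<close> and
  \<open>y\<close> agree.\<close>

lemma conc_arm:
  assumes "1 \<le> row (C d) x" "row (C d) x \<le> card (hk (C d))" "1 \<le> row (C d) y" "row (C d) y \<le> card (hk (C d))"
  defines "K \<equiv> C d"
  shows "conc (C(d := Col (hk K) (lg K) (add_mset y (am K - {#x#})))) =
    (if row K y = row K x then (conc C)((row K x, d) := Some (cell_leg K (row K x), insort y (remove1 x (cell_arm K (row K x)))))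
     else (conc C)((row K x, d) := Some (cell_leg K (row K x), remove1 x (cell_arm K (row K x))),
                   (row K y, d) := Some (cell_leg K (row K y), insort y (cell_arm K (row K y)))))"
proof -
  have "cell_arm (Col (hk K) (lg K) (am K)) s = cell_arm K s" "cell_leg (Col (hk K) (lg K) M) s = cell_leg K s" for s M
    by (simp_all add: cell_arm_def cell_leg_def)
  then show ?thesis using assms(1-4) unfolding K_def[symmetric]
    by (auto simp: conc_def fun_eq_iff cell_arm_arm K_def)
qed

lemma cell_arm_cong:
  assumes "\<And>v. v \<in># am K \<Longrightarrow> below H (Suc v) = row K v"
  shows "cell_arm (Col H A (am K)) s = cell_arm K s"
proof -
  have "{#v \<in># am K. below H (Suc v) = s#} = {#v \<in># am K. row K v = s#}"
    by (rule filter_mset_cong) (simp_all add: assms)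
  then show ?thesis by (simp add: cell_arm_def)
qed

lemma conc_leg_col:
  assumes r: "1 \<le> r" "r \<le> card (hk (C d))" and c: "card H = card (hk (C d))"
    and arm: "\<And>v. v \<in># am (C d) \<Longrightarrow> below H (Suc v) = row (C d) v"
    and leg: "\<And>s. {v \<in> A. below H (Suc v) = s} = (if s = r then B else {v \<in> lg (C d). row (C d) v = s})"
  shows "conc (C(d := Col H A (am (C d)))) = (conc C)((r, d) := Some (sorted_list_of_set B, cell_arm (C d) r))"
proof -
  let ?K' = "Col H A (am (C d))"
  have "cell_arm ?K' s = cell_arm (C d) s" for s by (rule cell_arm_cong) (rule arm)
  moreover have "cell_leg ?K' s = (if s = r then sorted_list_of_set B else cell_leg (C d) s)" for s
    unfolding cell_leg_def column.sel leg by simp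
  ultimately show ?thesis using conc_col[of ?K' C d r] r c by simp
qed

lemma conc_leg:
  assumes K: "wfcol (C d)" and r: "1 \<le> row (C d) x" "row (C d) x \<le> card (hk (C d))" 
    and c: "card H = card (hk (C d))" "x \<in> lg (C d)" "y \<notin> lg (C d)"
    and row: "\<And>v. v \<in># am (C d) \<Longrightarrow> below H (Suc v) = row (C d) v"
      "\<And>v. v \<in> lg (C d) \<Longrightarrow> v \<noteq> x \<Longrightarrow> below H (Suc v) = row (C d) v" "below H (Suc y) = row (C d) x"
  shows "conc (C(d := Col H (insert y (lg (C d) - {x})) (am (C d)))) =
    (conc C)((row (C d) x, d) := Some (insort y (remove1 x (cell_leg (C d) (row (C d) x))), cell_arm (C d) (row (C d) x)))"
proof -
  let ?A = "{v \<in> lg (C d). row (C d) v = row (C d) x}"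
  have "conc (C(d := Col H (insert y (lg (C d) - {x})) (am (C d)))) =
    (conc C)((row (C d) x, d) := Some (sorted_list_of_set (insert y (?A - {x})), cell_arm (C d) (row (C d) x)))"
    by (rule conc_leg_col[where C=C and d=d, OF r c(1)]) (use row c(3) in auto)
  then show ?thesis using wfcolD(1)[OF K] c(3) by (simp add: cell_leg_def sorted_list_of_set_insort sorted_list_of_set_remove1)
qed

lemma conc_ins:
  assumes K: "wfcol (C d)" and r: "1 \<le> r" "r \<le> card (hk (C d))" 
    and c: "card H = card (hk (C d))" "y \<notin> lg (C d)"
    and row: "\<And>v. v \<in> ents (C d) \<Longrightarrow> below H (Suc v) = row (C d) v" "below H (Suc y) = r"
  shows "conc (C(d := Col H (insert y (lg (C d))) (am (C d)))) =
    (conc C)((r, d) := Some (insort y (cell_leg (C d) r), cell_arm (C d) r))"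
proof -
  have "conc (C(d := Col H (insert y (lg (C d))) (am (C d)))) =
    (conc C)((r, d) := Some (sorted_list_of_set (insert y {v \<in> lg (C d). row (C d) v = r}), cell_arm (C d) r))"
    by (rule conc_leg_col[where C=C and d=d, OF r c(1)]) (use row c(2) in \<open>auto simp: ents_def\<close>)
  then show ?thesis using wfcolD(1)[OF K] c(2) by (simp add: cell_leg_def sorted_list_of_set_insort)
qed

lemma conc_del:
  assumes K: "wfcol (C d)" and r: "1 \<le> r" "r \<le> card (hk (C d))" 
    and c: "card H = card (hk (C d))" "x \<in> lg (C d)" "x \<notin># am (C d)" "row (C d) x = r"
    and row: "\<And>v. v \<in> ents (C d) \<Longrightarrow> v \<noteq> x \<Longrightarrow> below H (Suc v) = row (C d) v"
  shows "conc (C(d := Col H (lg (C d) - {x}) (am (C d)))) =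
    (conc C)((r, d) := Some (remove1 x (cell_leg (C d) r), cell_arm (C d) r))"
proof -
  have m: "v \<in> ents (C d) \<and> v \<noteq> x" if "v \<in># am (C d)" for v using c(3) that by (auto simp: ents_def)
  have "conc (C(d := Col H (lg (C d) - {x}) (am (C d)))) =
    (conc C)((r, d) := Some (sorted_list_of_set ({v \<in> lg (C d). row (C d) v = r} - {x}), cell_arm (C d) r))"
    by (rule conc_leg_col[where C=C and d=d, OF r c(1)]) (use row m c(4) in \<open>auto simp: ents_def\<close>)
  then show ?thesis using wfcolD(1)[OF K] by (simp add: cell_leg_def sorted_list_of_set_remove1)
qed

lemma entries_conc: "valid C \<Longrightarrow> v \<in> entries (conc C) (r, c) \<longleftrightarrow> v \<in> ents (C c) \<and> row (C c) v = r"
  by (auto simp: entries_def xleg_conc arm_conc set_cell_leg set_cell_arm ents_def)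

lemma um_pos_ents: "um i K > 0 \<Longrightarrow> i \<in> ents K"
  by (rule ccontr) (simp add: um_def ents_def not_in_iff)

theorem f_op_conc:
  assumes v: "valid C" and f: "fsel i C d"
  shows "f_op i (conc C) = Some (conc (f_move i d C))"
proof -
  let ?K = "C d" and ?L = "C (Suc d)" and ?T = "conc C"
  let ?r = "row ?K i"
  note w = wfcolD[OF validD(1)[OF v]]
  have wf: "wfcol ?K" "wfcol ?L" using validD(1)[OF v] by auto
  have ms: "filter (\<lambda>x. \<not> snd x) (unpaired i ?T) \<noteq> []" by (rule fsel_unpaired[OF v f])
  obtain d' where "fsel i C d'" "reading_word ?T ! fst (last (filter (\<lambda>x. \<not> snd x) (unpaired i ?T)))
     = (i, (row (C d') i, d'), i \<in># am (C d'))"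
    using last_unpaired_minus[OF v ms] by blast
  then have pos: "reading_word ?T ! fst (last (filter (\<lambda>x. \<not> snd x) (unpaired i ?T))) = (i, (?r, d), i \<in># am ?K)"
    using fsel_unique[OF f] by auto
  have iK: "i \<in> ents ?K" using um_pos_ents[OF fsel_um(1)[OF f]] .
  note rb = row_bounds[OF v iK]
  have aK: "below (hk ?L) i < ?r" using validD(2)[OF v, of d] iK by (simp add: adj_def)
  \<comment> \<open>All entries of the cell above exceed \<open>i\<close>, so \<open>i + 1\<close>
    can lie there only if it is the hook entry.\<close>
  have c1: "Suc i \<in> entries ?T (Suc ?r, d) \<longleftrightarrow> Suc i \<in> hk ?K"
    using w(3)[of "Suc i" d] unfolding entries_conc[OF v] by (auto simp: below_Suc[OF w(2), of d "Suc i"] ents_def split: if_splits)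
  \<comment> \<open>By the row condition all entries of the cell to the right are at least
    \<open>i\<close>, so an \<open>i\<close> in its extended leg is its hook entry.\<close>
  have c2: "i \<in> set (xleg ?T (?r, Suc d)) \<longleftrightarrow> i \<in> hk ?L \<and> Suc (below (hk ?L) i) = ?r"
    using w(3)[of i "Suc d"] aK unfolding xleg_conc[OF v] set_cell_leg[OF v] by (auto simp: below_Suc[OF w(2), of "Suc d" i] split: if_splits)
  \<comment> \<open>\<open>spill\<close> excludes that \<open>i + 1\<close> is a hook entry, so (M)
    and (S) do not compete. An \<open>i + 1\<close> in the leg cancels the minus of a leg entry
    \<open>i\<close>, hence (M) occurs only in the arm branch of \<open>f_move\<close>.\<close>
  have fo: "f_op i ?T = (if Suc i \<in> hk ?K then
         Some (?T((?r, d) := Some (cell_leg ?K ?r, remove1 i (cell_arm ?K ?r)),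
                 (Suc ?r, d) := Some (cell_leg ?K (Suc ?r), insort (Suc i) (cell_arm ?K (Suc ?r)))))
       else if spill i ?K ?L then
         Some (?T((?r, Suc d) := Some (remove1 i (cell_leg ?L ?r), cell_arm ?L ?r),
                 (?r, d) := Some (insort (Suc i) (cell_leg ?K ?r), cell_arm ?K ?r)))
       else if i \<in># am ?K then
         Some (?T((?r, d) := Some (cell_leg ?K ?r, insort (Suc i) (remove1 i (cell_arm ?K ?r)))))
       else
         Some (?T((?r, d) := Some (insort (Suc i) (remove1 i (cell_leg ?K ?r)), cell_arm ?K ?r))))"
    unfolding f_op_def Let_def pos prod.case c1 c2
    unfolding xleg_conc[OF v] arm_conc[OF v] if_not_P[OF ms]
    by (cases "Suc i \<in> hk ?K") (simp_all only: spill_def if_True if_False simp_thms)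
  have Suc_bounds: "1 \<le> row ?K (Suc i)" "row ?K (Suc i) \<le> card (hk ?K)"
    using rb(1) below_mono[OF w(2), of "Suc i" "Suc (Suc i)" d] below_le_card[OF w(2), of d "Suc (Suc i)"] by auto
  note rs = below_Suc[OF w(2), of d "Suc i"]
  consider (S) "spill i ?K ?L" | (A) "\<not> spill i ?K ?L" "i \<in># am ?K"
    | (L) "\<not> spill i ?K ?L" "i \<notin># am ?K" by blast
  then show ?thesis
  proof cases
    case S
    note s = spill_facts[OF v f S]
    have ih: "i \<in> hk ?L" "Suc i \<notin> hk ?K" "Suc (below (hk ?L) i) = ?r" using S by (auto simp: spill_def)
    let ?K' = "Col (hk ?K) (insert (Suc i) (lg ?K)) (am ?K)"
    let ?L' = "Col (insert (Suc i) (hk ?L - {i})) (lg ?L - {i}) (am ?L)"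
    have 1: "conc (C(d := ?K')) = ?T((?r, d) := Some (insort (Suc i) (cell_leg ?K ?r), cell_arm ?K ?r))"
      by (rule conc_ins[where C=C and d=d, OF wf(1) rb]) (use s ih rs in auto)
    have rL: "row ?L i = ?r" using ih by (simp add: below_Suc w)
    have rbL: "?r \<le> card (hk ?L)" using row_bounds(2)[OF v, of i "Suc d"] rL s(6) by (simp add: ents_def)
    have "conc ((C(d := ?K'))(Suc d := Col (insert (Suc i) (hk ?L - {i})) (lg ((C(d := ?K')) (Suc d)) - {i}) (am ((C(d := ?K')) (Suc d)))))
       = (conc (C(d := ?K')))((?r, Suc d) := Some (remove1 i (cell_leg ((C(d := ?K')) (Suc d)) ?r), cell_arm ((C(d := ?K')) (Suc d)) ?r))"
    proof (rule conc_del[where C="C(d := ?K')" and d="Suc d", OF _ rb(1)])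
      show "below (insert (Suc i) (hk ?L - {i})) (Suc x) = row ((C(d := ?K')) (Suc d)) x"
        if "x \<noteq> i" for x using below_flip[OF w(2) ih(1) s(5)] that by simp
    qed (use wf rbL s rL card_swap[OF w(2) ih(1) s(5)] in auto)
    then have "conc (C(d := ?K', Suc d := ?L')) = (conc (C(d := ?K')))((?r, Suc d) := Some (remove1 i (cell_leg ?L ?r), cell_arm ?L ?r))"
      by simp
    then have "conc (f_move i d C) = ?T((?r, d) := Some (insort (Suc i) (cell_leg ?K ?r), cell_arm ?K ?r), (?r, Suc d) := Some (remove1 i (cell_leg ?L ?r), cell_arm ?L ?r))"
      using S 1 by (simp add: f_move_def Let_def)
    then show ?thesis unfolding fo using S ih by (simp add: fun_upd_twist)
  next
    case A
    show ?thesis unfolding fo using A conc_arm[of C d i "Suc i"] rb Suc_bounds rs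
      by (auto simp: f_move_def Let_def)
  next
    case L
    have il: "i \<in> lg ?K" "Suc i \<notin> lg ?K"
      using fsel_um(1)[OF f] L(2) by (auto simp: um_def not_in_iff of_bool_def split: if_splits)
    have sh: "Suc i \<notin> hk ?K" using il w(3) by blast
    let ?H = "if i \<in> hk ?K then insert (Suc i) (hk ?K - {i}) else hk ?K"
    have bH: "below ?H x = below (hk ?K) x - of_bool (i \<in> hk ?K \<and> x = Suc i)" for x
      using below_flip[OF w(2) _ sh] by simp
    have "conc (C(d := Col ?H (insert (Suc i) (lg ?K - {i})) (am ?K))) =
      ?T((?r, d) := Some (insort (Suc i) (remove1 i (cell_leg ?K ?r)), cell_arm ?K ?r))"
      by (rule conc_leg[where C=C and d=d, OF wf(1) rb]) (use il L card_swap[OF w(2) _ sh] bH rs sh in auto)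
    then show ?thesis unfolding fo using L sh by (simp add: f_move_def Let_def)
  qed
qed

lemma f_op_conc_D:
  assumes v: "valid C" and "f_op i (conc C) = Some T'"
  shows "\<exists>d. fsel i C d \<and> T' = conc (f_move i d C)"
proof -
  have "filter (\<lambda>x. \<not> snd x) (unpaired i (conc C)) \<noteq> []"
    using assms(2) by (auto simp: f_op_def Let_def)
  then obtain d where "fsel i C d" using last_unpaired_minus[OF v] by blast
  then show ?thesis using f_op_conc[OF v] assms(2) by auto
qed

lemma strict_sorted_cell_leg: "sorted_wrt (<) (cell_leg K r)"
  by (simp add: cell_leg_def)

lemma hook_row: "finite (hk K) \<Longrightarrow> h \<in> hk K \<Longrightarrow> row K v = row K h \<Longrightarrow> h \<le> v"
  using below_strict[of "hk K" h "Suc v" "Suc h"] by fastforce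

lemma row_hook: assumes "finite (hk K)" "row K v \<ge> 1" shows "\<exists>h \<in> hk K. h \<le> v \<and> row K h = row K v"
proof -
  let ?A = "{h \<in> hk K. h < Suc v}"
  have ne: "?A \<noteq> {}" using assms(2) by (metis below_def card.empty not_one_le_zero)
  have m: "Max ?A \<in> ?A" using Max_in[of ?A] ne assms(1) by simp
  have "\<forall>h \<in> hk K. \<not> (Suc (Max ?A) \<le> h \<and> h < Suc v)"
  proof (intro ballI notI)
    fix h assume h: "h \<in> hk K" "Suc (Max ?A) \<le> h \<and> h < Suc v"
    then have "h \<le> Max ?A" using assms(1) by (intro Max_ge) auto
    then show False using h(2) by linarith
  qed
  then have "row K (Max ?A) = row K v"
    using below_gap[OF assms(1), of "Suc (Max ?A)" "Suc v"] m by simp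
  then show ?thesis using m by (intro bexI[of _ "Max ?A"]) auto
qed

text \<open>Each row contains exactly one hook entry, and it is the smallest entry of its cell, so
  the head of the extended leg is the hook entry.\<close>

lemma set_tl_cell_leg:
  assumes v: "valid C"
  shows "set (tl (cell_leg (C c) r)) = {x \<in> lg (C c). row (C c) x = r \<and> x \<notin> hk (C c)}"
proof (cases "cell_leg (C c) r")
  case Nil
  then show ?thesis using set_cell_leg[OF v, of c r] by auto
next
  case (Cons h t)
  let ?K = "C c"
  have fin: "finite (hk ?K)" using wfcolD(2)[OF validD(1)[OF v]] .
  have st: "\<forall>x \<in> set t. h < x" using strict_sorted_cell_leg[of ?K r] Cons by simp
  have s: "insert h (set t) = {x \<in> lg ?K. row ?K x = r}" using set_cell_leg[OF v, of c r] Cons by simp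
  then have h: "h \<in> lg ?K" "row ?K h = r" by auto
  then have "1 \<le> row ?K h" using row_bounds(1)[OF v, of h c] by (simp add: ents_def)
  then obtain g where g: "g \<in> hk ?K" "g \<le> h" "row ?K g = r" using row_hook[OF fin] h by auto
  then have "g \<in> insert h (set t)" unfolding s using wfcolD(3)[OF validD(1)[OF v] g(1)] by simp
  then have gh: "g = h" using st g(2) by fastforce
  have "x \<notin> hk ?K" if "x \<in> set t" for x
  proof
    assume "x \<in> hk ?K"
    moreover have "row ?K x = r" using s that by auto
    ultimately have "x \<le> h" using hook_row[OF fin, of x h] h by simp
    then show False using st that by fastforce
  qed
  then show ?thesis using s g gh st Cons by fastforce
qed

theorem e_op_conc:
  assumes v: "valid C" and f: "esel i C d"
  shows "e_op i (conc C) = Some (conc (e_move i d C))"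
proof -
  let ?K = "C d" and ?J = "C (d - 1)" and ?T = "conc C"
  let ?r = "row ?K (Suc i)"
  note w = wfcolD[OF validD(1)[OF v]]
  have wf: "wfcol ?K" "wfcol ?J" using validD(1)[OF v] by auto
  have d1: "1 \<le> d" using f by (simp add: esel_def)
  have aJ: "adj ?J ?K" using validD(2)[OF v, of "d - 1"] d1 by (cases d) auto
  have ps: "filter snd (unpaired i ?T) \<noteq> []" by (rule esel_unpaired[OF v f])
  obtain d' where "esel i C d'" "reading_word ?T ! fst (hd (filter snd (unpaired i ?T)))
     = (Suc i, (row (C d') (Suc i), d'), i \<in> ents (C d') \<or> Suc i \<notin> lg (C d'))"
    using first_unpaired_plus[OF v ps] by blast
  then have pos: "reading_word ?T ! fst (hd (filter snd (unpaired i ?T)))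
     = (Suc i, (?r, d), i \<in> ents ?K \<or> Suc i \<notin> lg ?K)"
    using esel_unique[OF f] by auto
  have iK: "Suc i \<in> ents ?K"
    using esel_up(3)[OF v f] by (rule contrapos_pp) (simp add: up_def ents_def not_in_iff)
  note rb = row_bounds[OF v iK]
  note rs = below_Suc[OF w(2), of d "Suc i"]
  have c1: "1 < ?r \<and> i \<in> entries ?T (?r - 1, d) \<longleftrightarrow> i \<in> ents ?K \<and> Suc i \<in> hk ?K"
    using rs rb row_bounds(1)[OF v, of i d] unfolding entries_conc[OF v] by (auto split: if_splits)
  have c2: "1 < d \<and> Suc i \<in> set (tl (xleg ?T (?r, d - 1))) \<longleftrightarrow>
      Suc i \<in> lg ?J \<and> Suc i \<notin> hk ?J \<and> row ?J (Suc i) = ?r"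
    using d1 valid_0[OF v] unfolding xleg_conc[OF v] set_tl_cell_leg[OF v] by (cases "d = 1") auto
  \<comment> \<open>An \<open>i + 1\<close> to the left in the same row forces the hook entry of
    this cell to be at least \<open>i + 1\<close>, hence equal to it.\<close>
  have c3: "Suc i \<in> hk ?K" if "Suc i \<in> lg ?J \<and> Suc i \<notin> hk ?J \<and> row ?J (Suc i) = ?r"
    using adjD(1)[OF aJ, of "Suc i"] that rs by (auto split: if_splits)
  have eo: "e_op i ?T = (if i \<in> ents ?K \<and> Suc i \<in> hk ?K then
         Some (?T((?r, d) := Some (cell_leg ?K ?r, remove1 (Suc i) (cell_arm ?K ?r)),
                 (?r - 1, d) := Some (cell_leg ?K (?r - 1), insort i (cell_arm ?K (?r - 1)))))
       else if Suc i \<in> lg ?J \<and> Suc i \<notin> hk ?J \<and> row ?J (Suc i) = ?r then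
         Some (?T((?r, d - 1) := Some (remove1 (Suc i) (cell_leg ?J ?r), cell_arm ?J ?r),
                 (?r, d) := Some (insort i (cell_leg ?K ?r), cell_arm ?K ?r)))
       else if i \<in> ents ?K \<or> Suc i \<notin> lg ?K then
         Some (?T((?r, d) := Some (cell_leg ?K ?r, insort i (remove1 (Suc i) (cell_arm ?K ?r)))))
       else
         Some (?T((?r, d) := Some (insort i (remove1 (Suc i) (cell_leg ?K ?r)), cell_arm ?K ?r))))"
    unfolding e_op_def Let_def pos prod.case c1 c2
    unfolding xleg_conc[OF v] arm_conc[OF v] if_not_P[OF ps] ..
  consider (A) "i \<in> ents ?K \<or> Suc i \<notin> lg ?K"
    | (S) "i \<notin> ents ?K" "Suc i \<in> lg ?K" "Suc i \<in> lg ?J" "Suc i \<notin> hk ?J" "row ?J (Suc i) = ?r"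
    | (B) "i \<notin> ents ?K" "Suc i \<in> lg ?K" "\<not> (Suc i \<in> lg ?J \<and> Suc i \<notin> hk ?J \<and> row ?J (Suc i) = ?r)"
    by blast
  then show ?thesis
  proof cases
    case A
    have ib: "1 \<le> row ?K i" "row ?K i \<le> card (hk ?K)"
    proof -
      show "1 \<le> row ?K i"
      proof (cases "i \<in> ents ?K")
        case True then show ?thesis by (rule row_bounds(1)[OF v])
      next
        case False
        then have "Suc i \<notin> hk ?K" using A w(3) by blast
        then show ?thesis using rs rb by simp
      qed
      show "row ?K i \<le> card (hk ?K)" using below_le_card[OF w(2)] .
    qed
    \<comment> \<open>In the arm branch (S) is never reached: it would make \<open>i + 1\<close> a
      hook entry and thus a leg entry, so an \<open>i\<close> would be present and (M) would have
      applied before.\<close>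
    have ns: "\<not> (Suc i \<in> lg ?J \<and> Suc i \<notin> hk ?J \<and> row ?J (Suc i) = ?r)" if "\<not> (i \<in> ents ?K \<and> Suc i \<in> hk ?K)"
      using c3 A that w(3)[of "Suc i" d] by blast
    have hi: "i \<in> ents ?K" if "Suc i \<in> hk ?K" using A that w(3)[of "Suc i" d] by blast
    have e: "e_move i d C = C(d := Col (hk ?K) (lg ?K) (add_mset i (am ?K - {#Suc i#})))"
      using A by (simp add: e_move_def Let_def)
    show ?thesis
    proof (cases "Suc i \<in> hk ?K")
      case True
      then show ?thesis using eo hi[OF True] conc_arm[of C d "Suc i" i, OF rb ib] rs unfolding e by simp
    next
      case False
      then have ns': "\<not> (Suc i \<in> lg ?J \<and> Suc i \<notin> hk ?J \<and> row ?J (Suc i) = ?r)" using ns by blast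
      have "e_op i ?T = Some (?T((?r, d) := Some (cell_leg ?K ?r, insort i (remove1 (Suc i) (cell_arm ?K ?r)))))"
        unfolding eo if_not_P[OF ns'] using A False by simp
      then show ?thesis using conc_arm[of C d "Suc i" i, OF rb ib] rs False unfolding e by simp
    qed
  next
    case S
    have i0: "i \<notin> lg ?K" "i \<notin># am ?K" using S(1) by (auto simp: ents_def)
    have ih: "i \<notin> hk ?K" using i0 w(3) by blast
    have sh: "Suc i \<in> hk ?K" using c3 S by blast
    have ns: "Suc i \<notin># am ?J"
    proof -
      have "um i ?K = 0" using S(2) i0 by (auto simp: um_def not_in_iff)
      then have "up i ?J = 0" using esel_up(2)[OF v f] by simp
      then show ?thesis by (simp add: up_def not_in_iff)
    qed
    have "lg (C 0) = {}" using valid_0[OF v] by simp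
    then obtain b where b: "d = Suc b" using S(3) d1 by (cases d) auto
    have bd: "b \<noteq> d" "d - 1 = b" using b by auto
    note f_left = below_flip'[OF w(2) sh ih]
    let ?J' = "Col (hk ?J) (lg ?J - {Suc i}) (am ?J)"
    let ?K' = "Col (insert i (hk ?K - {Suc i})) (insert i (lg ?K)) (am ?K)"
    have rbJ: "?r \<le> card (hk ?J)" using row_bounds(2)[OF v, of "Suc i" "d - 1"] S by (simp add: ents_def)
    have 1: "conc (C(d - 1 := ?J')) = ?T((?r, d - 1) := Some (remove1 (Suc i) (cell_leg ?J ?r), cell_arm ?J ?r))"
      by (rule conc_del[where C=C and d="d - 1", OF wf(2) rb(1) rbJ]) (use S ns in auto)
    let ?C1 = "C(d - 1 := ?J')"
    have Cd: "?C1 d = ?K" using bd by simp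
    have "conc (?C1(d := Col (insert i (hk ?K - {Suc i})) (insert i (lg (?C1 d))) (am (?C1 d)))) =
       (conc ?C1)((?r, d) := Some (insort i (cell_leg (?C1 d) ?r), cell_arm (?C1 d) ?r))"
    proof (rule conc_ins[where C="?C1" and d=d])
      show "below (insert i (hk ?K - {Suc i})) (Suc x) = row (?C1 d) x" if "x \<in> ents (?C1 d)" for x
        using f_left that S(1) unfolding Cd by auto
      show "below (insert i (hk ?K - {Suc i})) (Suc i) = ?r" using f_left rs sh by simp
    qed (unfold Cd, use wf rb card_swap[OF w(2) sh ih] i0 in auto)
    then have "conc (e_move i d C) = ?T((?r, d - 1) := Some (remove1 (Suc i) (cell_leg ?J ?r), cell_arm ?J ?r),
        (?r, d) := Some (insort i (cell_leg ?K ?r), cell_arm ?K ?r))"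
      unfolding Cd 1 using S by (simp add: e_move_def Let_def)
    then show ?thesis unfolding eo using S by simp
  next
    case B
    have i0: "i \<notin> lg ?K" "i \<notin># am ?K" using B(1) by (auto simp: ents_def)
    have ih: "i \<notin> hk ?K" using i0 w(3) by blast
    let ?H = "if Suc i \<in> hk ?K then insert i (hk ?K - {Suc i}) else hk ?K"
    have bH: "below ?H x = below (hk ?K) x + of_bool (Suc i \<in> hk ?K \<and> x = Suc i)" for x
      using below_flip'[OF w(2) _ ih] by simp
    have cH: "card ?H = card (hk ?K)" using card_swap[OF w(2) _ ih] by simp
    have e: "e_move i d C = C(d := Col ?H (insert i (lg ?K - {Suc i})) (am ?K))"
      by (simp only: e_move_def Let_def B if_False simp_thms)
    have "conc (C(d := Col ?H (insert i (lg ?K - {Suc i})) (am ?K))) =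
      ?T((?r, d) := Some (insort i (remove1 (Suc i) (cell_leg ?K ?r)), cell_arm ?K ?r))"
      by (rule conc_leg[where C=C and d=d, OF wf(1) rb]) (use i0 B cH bH rs in auto)
    then show ?thesis unfolding eo e if_not_P[OF B(3)] using B by simp
  qed
qed

section \<open>Arm excess and the bumping step on tableaux\<close>

lemma arm_cols_conc: assumes v: "valid C" shows "arm_cols (conc C) = {c. am (C c) \<noteq> {#}}"
proof -
  have "(\<exists>r. cell_arm (C c) r \<noteq> []) \<longleftrightarrow> am (C c) \<noteq> {#}" for c
  proof
    assume "\<exists>r. cell_arm (C c) r \<noteq> []"
    then show "am (C c) \<noteq> {#}" by (auto simp: cell_arm_def)
  next
    assume "am (C c) \<noteq> {#}"
    then obtain x where "x \<in># am (C c)" by blast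
    then have "x \<in> set (cell_arm (C c) (row (C c) x))" by (simp add: set_cell_arm)
    then show "\<exists>r. cell_arm (C c) r \<noteq> []" by (metis empty_iff empty_set)
  qed
  then show ?thesis by (simp add: arm_cols_def arm_conc[OF v])
qed

lemma finite_am: assumes v: "valid C" shows "finite {c. am (C c) \<noteq> {#}}"
proof -
  obtain n where n: "\<forall>c>n. hk (C c) = {}" using v by (auto simp: valid_def)
  have "am (C c) = {#}" if "c > n" for c
  proof (rule ccontr)
    assume "am (C c) \<noteq> {#}"
    then obtain x where "x \<in> ents (C c)" by (auto simp: ents_def)
    then show False using row_bounds[OF v] n that by fastforce
  qed
  then have "{c. am (C c) \<noteq> {#}} \<subseteq> {..n}" by (auto simp: not_le[symmetric])
  then show ?thesis by (rule finite_subset) simp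
qed

lemma arm_excess_conc:
  assumes v: "valid C"
  shows "arm_excess (conc C) = (\<Sum>c | am (C c) \<noteq> {#}. size (am (C c)))"
proof -
  let ?A = "{c. am (C c) \<noteq> {#}}"
  let ?D = "SIGMA c:?A. {1..card (hk (C c))}"
  have inner: "(\<Sum>r\<in>{1..card (hk (C c))}. length (cell_arm (C c) r)) = size (am (C c))" for c
  proof -
    have "(\<Sum>r\<in>B. size {#v \<in># M. g v = r#}) = size M" if "finite B" "\<forall>v \<in># M. g v \<in> B"
      for B :: "nat set" and M and g :: "nat \<Rightarrow> nat"
      using that(2)
    proof (induction M)
      case (add x M)
      have "(\<Sum>r\<in>B. size {#v \<in># add_mset x M. g v = r#}) = (\<Sum>r\<in>B. size {#v \<in># M. g v = r#} + of_bool (g x = r))"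
        by (intro sum.cong) auto
      then show ?case using add that(1) by (simp add: sum.distrib)
    qed simp
    then have "(\<Sum>r\<in>{1..card (hk (C c))}. size {#v \<in># am (C c). row (C c) v = r#}) = size (am (C c))"
      using row_bounds[OF v, of _ c] by (simp add: ents_def)
    then show ?thesis by (simp flip: mset_cell_arm)
  qed
  have "arm_excess (conc C) = (\<Sum>(r, c)\<in>dom (conc C). length (cell_arm (C c) r))"
    unfolding arm_excess_def by (intro sum.cong) (auto simp: arm_conc[OF v])
  also have "\<dots> = (\<Sum>(r, c)\<in>{(r, c). (c, r) \<in> ?D}. length (cell_arm (C c) r))"
    using finite_dom_conc[OF v]
    by (intro sum.mono_neutral_right) (auto simp: dom_conc cell_arm_def)
  also have "\<dots> = (\<Sum>(c, r)\<in>?D. length (cell_arm (C c) r))"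
    by (rule sum.reindex_bij_witness[of _ "\<lambda>(c, r). (r, c)" "\<lambda>(r, c). (c, r)"]) auto
  also have "\<dots> = (\<Sum>c\<in>?A. \<Sum>r\<in>{1..card (hk (C c))}. length (cell_arm (C c) r))"
    using finite_am[OF v] by (subst sum.Sigma) auto
  finally show ?thesis unfolding inner .
qed

text \<open>The choices of column, cell, letter and leg entries enter as equations and are evaluated
  once; what remains depends on the bumped entry alone.\<close>

lemma Vb_unfold:
  assumes "arm_excess T \<noteq> 0" "Max (arm_cols T) = c"
    "(SOME r. arm T (r, c) \<noteq> [] \<and> (\<forall>r'. arm T (r', c) \<noteq> [] \<longrightarrow>
        Max (set (arm T (r', c))) \<le> Max (set (arm T (r, c))))) = r"
    "Max (set (arm T (r, c))) = a"
    "filter (\<lambda>x. a < x \<and> x \<le> Max (set (tl (xleg T (r, c))))) (tl (xleg T (r, c))) = m"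
    "{v. \<exists>r'. v \<in> set (xleg T (r', Suc c)) \<and> a \<le> v} = E"
  shows "Vb T = (let kk = (if E = {} then None else Some (Min E));
         rt = (case kk of None \<Rightarrow> colheight T (Suc c) + 1
                 | Some k \<Rightarrow> (SOME r'. k \<in> set (xleg T (r', Suc c))));
         oldL = xleg T (rt, Suc c);
         oldA = arm T (rt, Suc c)
     in if rt \<noteq> r then
          T((r, c) := Some (xleg T (r, c), remove1 a (arm T (r, c))),
            (rt, Suc c) := Some (case kk of None \<Rightarrow> ([a], [])
                                  | Some k \<Rightarrow> (insort a (remove1 k oldL), insort k oldA)))
        else
          T((r, c) := Some (filter (\<lambda>x. x \<notin> set m) (xleg T (r, c)), remove1 a (arm T (r, c))),
            (r, Suc c) := Some (a # sort (tl oldL @ m),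
                                (case kk of None \<Rightarrow> oldA | Some k \<Rightarrow> insort k oldA))))"
  unfolding Vb_def Let_def by (simp only: assms if_False)

context bumping
begin

abbreviation "T \<equiv> conc C"
abbreviation "r \<equiv> row K a"

lemma row_K_a: "1 \<le> r" "r \<le> card (hk K)"
  using row_bounds[OF v, of a c] a_in by (auto simp: ents_def)

lemma hook_le: "h \<in> hk K \<Longrightarrow> row K h = r \<Longrightarrow> h \<le> a"
  using hook_row[OF fK, of h a] by simp

lemma Max_arm: "arm T (r', c) \<noteq> [] \<Longrightarrow> Max (set (arm T (r', c))) \<le> a" and Max_arm_a: "Max (set (arm T (r, c))) = a"
    and arm_a: "arm T (r, c) \<noteq> []"
proof -
  have le: "x \<le> a" if "x \<in> set (cell_arm K s)" for x s using that a_max by (simp add: set_cell_arm)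
  have a: "a \<in> set (cell_arm K r)" using a_in by (simp add: set_cell_arm)
  show "arm T (r', c) \<noteq> [] \<Longrightarrow> Max (set (arm T (r', c))) \<le> a"
    unfolding arm_conc[OF v] using le[of _ r'] by simp
  show "Max (set (arm T (r, c))) = a"
    unfolding arm_conc[OF v] using le[of _ r] a by (intro Max_eqI) auto
  show "arm T (r, c) \<noteq> []" unfolding arm_conc[OF v] using a by (metis empty_iff empty_set)
qed

lemma top_arm: "(SOME r. arm T (r, c) \<noteq> [] \<and> (\<forall>r'. arm T (r', c) \<noteq> [] \<longrightarrow>
        Max (set (arm T (r', c))) \<le> Max (set (arm T (r, c))))) = r"
proof (rule some_equality)
  show "arm T (r, c) \<noteq> [] \<and> (\<forall>r'. arm T (r', c) \<noteq> [] \<longrightarrow> Max (set (arm T (r', c))) \<le> Max (set (arm T (r, c))))"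
    using Max_arm Max_arm_a arm_a by simp
next
  fix s assume s: "arm T (s, c) \<noteq> [] \<and> (\<forall>r'. arm T (r', c) \<noteq> [] \<longrightarrow> Max (set (arm T (r', c))) \<le> Max (set (arm T (s, c))))"
  then have "a \<le> Max (set (arm T (s, c)))" using arm_a Max_arm_a by metis
  then have "Max (set (arm T (s, c))) = a" using Max_arm s by (meson antisym)
  then have "a \<in> set (cell_arm K s)" using s Max_in[of "set (arm T (s, c))"] unfolding arm_conc[OF v] by simp
  then show "s = r" by (simp add: set_cell_arm)
qed

lemma arm_cols_Max: "Max (arm_cols T) = c"
  unfolding arm_cols_conc[OF v]
proof (rule Max_eqI[OF finite_am[OF v]])
  show "y \<le> c" if "y \<in> {c. am (C c) \<noteq> {#}}" for y using that b by (force simp: bsel_def not_le[symmetric])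
  show "c \<in> {c. am (C c) \<noteq> {#}}" using a_in by auto
qed

lemma arm_excess_pos: "arm_excess T \<noteq> 0"
proof -
  have "am K \<noteq> {#}" using a_in by auto
  then show ?thesis unfolding arm_excess_conc[OF v] using finite_am[OF v] by (auto simp: sum_eq_0_iff)
qed

text \<open>Every leg entry is at most the maximal one, and for an empty leg the filter runs over
  the empty list, so the value of \<open>Max {}\<close> never enters. A hook entry in the row of
  \<open>a\<close> is at most \<open>a\<close>, hence already excluded by
  \<open>a < x\<close>.\<close>

lemma set_moved:
  "set (filter (\<lambda>x. a < x \<and> x \<le> Max (set (tl (xleg T (r, c))))) (tl (xleg T (r, c)))) = {x \<in> lg K. a < x \<and> row K x = r}"
  (is "?A = ?B")
proof -
  have "?A = {x \<in> set (tl (xleg T (r, c))). a < x}" by (auto intro: Max_ge)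
  also have "\<dots> = {x \<in> lg K. row K x = r \<and> x \<notin> hk K \<and> a < x}"
    unfolding xleg_conc[OF v] set_tl_cell_leg[OF v] by auto
  also have "\<dots> = ?B" using hook_le by force
  finally show ?thesis .
qed

lemma set_E: "{x. \<exists>r'. x \<in> set (xleg T (r', Suc c)) \<and> a \<le> x} = {x \<in> lg L. a \<le> x}"
  by (auto simp: xleg_conc[OF v] set_cell_leg[OF v])

text \<open>Hook counts change only between \<open>a\<close> and the bumped entry, and no other
  entry of \<open>L\<close> lies there.\<close>

lemma row_D_other: "x \<in> lg L \<Longrightarrow> x \<notin> kset L a \<Longrightarrow> row D x = row L x"
  using below_btop[OF wL, of a "Suc x"] ksetL[of x]
  by (cases rule: kset_cases[of L a]) (auto simp: dst_def not_less_eq_eq less_Suc_eq_le Suc_le_eq, fastforce+)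

lemma cell_leg_src: "cell_leg S s = filter (\<lambda>x. x \<notin> moved K L a) (cell_leg K s)"
proof -
  have f: "finite {x \<in> lg K. row K x = s}" using wfcolD(1)[OF wK] by simp
  have "{x \<in> lg S. row S x = s} = {x \<in> lg K. row K x = s} \<inter> {x. x \<notin> moved K L a}" by (auto simp: src_def)
  then show ?thesis unfolding cell_leg_def
    using f by (intro sorted_list_of_set_eqI) (auto simp: sorted_filter distinct_filter sorted_wrt_filter)
qed

lemma cell_arm_src: "cell_arm S s = (if s = r then remove1 a (cell_arm K s) else cell_arm K s)"
  by (auto simp: cell_arm_def src_def sorted_list_of_multiset_remove1[symmetric])

text \<open>The row \<open>rt\<close> may be one above the old top of the column; the maximum treats
  the new cell and an existing one alike.\<close>

lemma conc_bump:
  assumes "1 \<le> rt" "rt \<le> Suc (card (hk L))" "card (hk D) = max rt (card (hk L))"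
    and "\<And>s. s \<noteq> rt \<Longrightarrow> cell_leg D s = cell_leg L s \<and> cell_arm D s = cell_arm L s"
  shows "conc B = T((r, c) := Some (filter (\<lambda>x. x \<notin> moved K L a) (cell_leg K r), remove1 a (cell_arm K r)),
     (rt, Suc c) := Some (cell_leg D rt, cell_arm D rt))"
proof -
  have m: "filter (\<lambda>x. x \<notin> moved K L a) (cell_leg K s) = cell_leg K s" if "s \<noteq> r" for s
    using that set_cell_leg[OF v, of c s] by (auto simp: filter_id_conv moved_def)
  have "conc B (x, y) = (T((r, c) := Some (filter (\<lambda>x. x \<notin> moved K L a) (cell_leg K r), remove1 a (cell_arm K r)),
     (rt, Suc c) := Some (cell_leg D rt, cell_arm D rt))) (x, y)" for x y
  proof -
    consider "y = c" | "y = Suc c" | "y \<noteq> c" "y \<noteq> Suc c" by blast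
    then show ?thesis
    proof cases
      case 1
      then show ?thesis using row_K_a m by (auto simp: conc_def bump_def cell_leg_src cell_arm_src)
    next
      case 2
      have "1 \<le> x \<and> x \<le> card (hk D) \<longleftrightarrow> x = rt \<or> 1 \<le> x \<and> x \<le> card (hk L)" using assms(1-3) by auto
      then show ?thesis using 2 assms(4) by (auto simp: conc_def bump_def)
    next
      case 3
      then show ?thesis by (auto simp: conc_def bump_def)
    qed
  qed
  then show ?thesis by auto
qed

theorem Vb_conc: "Vb T = conc B"
proof -
  define m where "m = filter (\<lambda>x. a < x \<and> x \<le> Max (set (tl (xleg T (r, c))))) (tl (xleg T (r, c)))"
  have sm: "set m = {x \<in> lg K. a < x \<and> row K x = r}" unfolding m_def by (rule set_moved)
  have m_sorted: "sorted m" "distinct m"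
    unfolding m_def xleg_conc[OF v]
    by (auto simp: cell_leg_def sorted_tl distinct_tl intro: sorted_wrt_filter)
  have caL: "cell_arm L s = []" for s by (simp add: cell_arm_def amL)
  have amD: "am D = mset_set (kset L a)" by (simp add: dst_def amL)
  have fD: "finite {x \<in> lg D. row D x = s}" for s using wfcolD(1)[of D] validD(1)[OF valid_bump, of "Suc c"] by (simp add: bump_def)
  have mvs: "moved K L a = (if inrow K L a then set m else {})" by (auto simp: moved_def sm)
  note V = Vb_unfold[OF arm_excess_pos arm_cols_Max top_arm Max_arm_a m_def[symmetric] set_E]
  \<comment> \<open>A moved entry \<open>x\<close> is at most \<open>k\<close>. Below
    \<open>k\<close> the new hook entry \<open>a\<close> accounts for the extra row, and for
    \<open>x = k\<close> the old hook entry \<open>k\<close> does.\<close>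
  have rowD_mv: "row D x = r" if "x \<in> moved K L a" for x
  proof -
    note x = movedD[OF that]
    have "row D x = row L x + of_bool (\<forall>k \<in> kset L a. x < k)"
      using below_btop[OF wL, of a "Suc x"] x by (simp add: dst_def Suc_le_eq)
    moreover have "below (hk L) x = below (hk L) a"
      by (rule no_gap) (use moved_le[OF that] ksetD x in auto)
    moreover have "x \<in> hk L \<longleftrightarrow> \<not> (\<forall>k \<in> kset L a. x < k)"
      using moved_le[OF that] ksetD x(2,4) wfcolD(3)[OF wL]
      by (cases rule: kset_cases[of L a]) (auto, (metis less_imp_le le_antisym not_le subsetD singletonI order.trans)+)
    ultimately show ?thesis using x(5) by (auto simp: below_Suc[OF fL, of x])
  qed
  show ?thesis
  proof (cases rule: kset_cases[of L a])
    case 1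
    have E: "{x \<in> lg L. a \<le> x} = {}" using 1 by (auto simp: not_le[symmetric])
    let ?rt = "Suc (card (hk L))"
    have ba: "below (hk L) x = card (hk L)" if "a \<le> x" for x
      by (rule below_eq_card) (use 1(2) wfcolD(3)[OF wL] that less_le_trans in blast)
    have aL: "a \<notin> hk L" using 1(2) wfcolD(3)[OF wL] by blast
    have ir: "inrow K L a \<longleftrightarrow> ?rt = r" using ba[of a] 1(1) by (simp add: inrow_def)
    have rDa: "row D a = ?rt" using below_btop[OF wL, of a "Suc a"] 1(1) ba[of "Suc a"] by (simp add: dst_def)
    have lD: "{x \<in> lg D. row D x = s} = (if s = ?rt then insert a (moved K L a) else {x \<in> lg L. row L x = s})" for s
    proof -
      have "row L x \<noteq> ?rt" for x using below_le_card[OF fL, of "Suc x"] by simp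
      then show ?thesis
        using rDa rowD_mv movedD(5) ba[of a] row_D_other 1(1) by (auto simp: lg_D)
    qed
    have clD: "cell_leg D s = (if s = ?rt then sorted_list_of_set (insert a (moved K L a)) else cell_leg L s)" for s
      unfolding cell_leg_def lD by simp
    have caD: "cell_arm D s = []" for s unfolding cell_arm_def amD 1(1) by simp
    have B: "conc B = T((r, c) := Some (filter (\<lambda>x. x \<notin> moved K L a) (cell_leg K r), remove1 a (cell_arm K r)),
     (?rt, Suc c) := Some (cell_leg D ?rt, cell_arm D ?rt))"
      by (rule conc_bump) (use card_D 1(1) clD caD caL in auto)
    have oL: "cell_leg L ?rt = []" by (rule cell_leg_out[OF v]) simp
    show ?thesis
    proof (cases "?rt = r")
      case True
      have "moved K L a = set m" using ir True mvs by simp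
      moreover have "sorted_list_of_set (insert a (set m)) = a # sort m"
        using m_sorted wfcolD(1)[OF wK] by (intro sorted_list_of_set_eqI) (auto simp: sm)
      ultimately show ?thesis unfolding V B clD caD E Let_def colheight_conc xleg_conc[OF v] arm_conc[OF v]
        using True oL by (simp add: caL)
    next
      case False
      then have "moved K L a = {}" using ir mvs by simp
      then show ?thesis unfolding V B clD caD E Let_def colheight_conc xleg_conc[OF v] arm_conc[OF v]
        using False by simp
    qed
  next
    case (2 k)
    have E: "{x \<in> lg L. a \<le> x} \<noteq> {}" using 2 by auto
    have Mk: "Min {x \<in> lg L. a \<le> x} = k" using 2 wfcolD(1)[OF wL] by (intro Min_eqI) auto
    let ?rt = "row L k"
    have rt: "(SOME r'. k \<in> set (xleg T (r', Suc c))) = ?rt"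
      by (rule some_equality) (use 2 in \<open>auto simp: xleg_conc[OF v] set_cell_leg[OF v]\<close>)
    have rb: "1 \<le> ?rt" "?rt \<le> card (hk L)"
      using row_bounds[OF v, of k "Suc c"] 2 by (auto simp: ents_def)
    have bk: "below (hk L) k = below (hk L) a" by (rule no_gap) (use 2 in auto)
    have rk: "?rt = below (hk L) a + of_bool (k \<in> hk L)" using bk by (simp add: below_Suc[OF fL, of k])
    have ir: "inrow K L a \<longleftrightarrow> ?rt = r" using rk 2(1) aKa by (auto simp: inrow_def)
    have rDa: "row D a = ?rt"
    proof -
      have "row D a = row L a + of_bool (k \<in> hk L \<and> a < k)"
        using below_btop[OF wL, of a "Suc a"] 2(1) by (simp add: dst_def Suc_le_eq)
      moreover have "a \<notin> hk L" if "a < k" using 2(4)[of a] that wfcolD(3)[OF wL, of a] by auto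
      ultimately show ?thesis using rk 2(3) by (cases "a = k") (auto simp: below_Suc[OF fL, of a])
    qed
    have rDk: "row D k = ?rt" using below_btop[OF wL, of a "Suc k"] 2(1) by (simp add: dst_def)
    have cell_arm: "cell_arm D s = (if s = ?rt then [k] else [])" for s
      using rDk unfolding cell_arm_def amD 2(1) by auto
    have lD: "{x \<in> lg D. row D x = s} = (if s = ?rt then insert a ({x \<in> lg L. row L x = s} - {k} \<union> moved K L a)
        else {x \<in> lg L. row L x = s})" for s
    proof -
      have "row D x = ?rt" if "x \<in> moved K L a" for x
        using rowD_mv[OF that] ir mvs that by (auto split: if_splits)
      then show ?thesis using rDa row_D_other 2(1) by (auto simp: lg_D)
    qed
    have clD: "cell_leg D s = cell_leg L s" if "s \<noteq> ?rt" for s unfolding cell_leg_def lD using that by simp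
    have B: "conc B = T((r, c) := Some (filter (\<lambda>x. x \<notin> moved K L a) (cell_leg K r), remove1 a (cell_arm K r)),
     (?rt, Suc c) := Some (cell_leg D ?rt, cell_arm D ?rt))"
      by (rule conc_bump) (use card_D 2(1) clD cell_arm caL rb in auto)
    show ?thesis
    proof (cases "?rt = r")
      case True
      have mm: "moved K L a = set m" using ir True mvs by simp
      have kh: "k \<in> hk L" using ir True 2(1) by (simp add: inrow_def)
      have tl: "set (tl (cell_leg L ?rt)) = {x \<in> lg L. row L x = ?rt} - {k}"
        unfolding set_tl_cell_leg[OF v] using kh hook_row[OF fL kh] hook_row[OF fL] by (auto intro: antisym)
      have tk: "x > k" if "x \<in> set (tl (cell_leg L ?rt))" for x
        using that hook_row[OF fL kh, of x] unfolding tl by fastforce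
      have "cell_leg D ?rt = a # sort (tl (cell_leg L ?rt) @ m)"
        unfolding cell_leg_def[of D]
      proof (rule sorted_list_of_set_eqI[OF fD])
        have "distinct (tl (cell_leg L ?rt))" "sorted (tl (cell_leg L ?rt))" by (auto simp: cell_leg_def distinct_tl sorted_tl)
        moreover have "set (tl (cell_leg L ?rt)) \<inter> set m = {}"
          using tk moved_le[of _ k] 2 unfolding mm[symmetric] by fastforce
        ultimately show "distinct (a # sort (tl (cell_leg L ?rt) @ m))" 
          using m_sorted tk 2(3) by (auto simp: sm, fastforce)
        show "sorted (a # sort (tl (cell_leg L ?rt) @ m))" using tk 2(3) by (auto simp: sm, fastforce)
        show "set (a # sort (tl (cell_leg L ?rt) @ m)) = {x \<in> lg D. row D x = ?rt}"
          unfolding lD using tl mm by auto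
      qed
      then show ?thesis unfolding V B cell_arm Let_def if_not_P[OF E] option.case Mk rt unfolding xleg_conc[OF v] arm_conc[OF v]
        using True mm by (simp add: caL)
    next
      case False
      have m0: "moved K L a = {}" using ir mvs False by simp
      have "cell_leg D ?rt = insort a (remove1 k (cell_leg L ?rt))"
        unfolding cell_leg_def[of D]
      proof (rule sorted_list_of_set_eqI[OF fD])
        have d: "distinct (cell_leg L ?rt)" "sorted (cell_leg L ?rt)" by (auto simp: cell_leg_def)
        have a0: "a \<notin> set (remove1 k (cell_leg L ?rt))"
          using d(1) 2(3) 2(4)[of a] set_cell_leg[OF v, of "Suc c"] by auto
        show "distinct (insort a (remove1 k (cell_leg L ?rt)))" using d a0 by (simp add: distinct_insort)
        show "sorted (insort a (remove1 k (cell_leg L ?rt)))" using d by (simp add: sorted_insort sorted_remove1)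
        show "set (insort a (remove1 k (cell_leg L ?rt))) = {x \<in> lg D. row D x = ?rt}"
          unfolding lD m0 using d by (simp add: set_insort_key set_cell_leg[OF v])
      qed
      then show ?thesis unfolding V B cell_arm Let_def if_not_P[OF E] option.case Mk rt unfolding xleg_conc[OF v] arm_conc[OF v]
        using False m0 by (simp add: caL)
    qed
  qed
qed

end

section \<open>Uncrowding commutes with the crystal operators\<close>

text \<open>The column conditions order the cells of a column strictly, so counting the hook entries
  up to \<open>x\<close> gives back the row of \<open>x\<close>; validity then restates the tableau
  conditions for adjacent columns.\<close>

lemma hvt_conc:
  assumes T: "is_hvt T"
  shows "\<exists>C. valid C \<and> T = conc C"
proof -
  define R where "R c = {r. (r, c) \<in> dom T}" for c
  define g where "g c r = hd (xleg T (r, c))" for c r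
  define C where "C c = Col (g c ` R c) (\<Union>r\<in>R c. set (xleg T (r, c))) (\<Sum>r\<in>R c. mset (arm T (r, c)))" for c
  have shape: "finite (dom T)" "\<And>r c. (r, c) \<in> dom T \<Longrightarrow> 1 \<le> r \<and> 1 \<le> c"
    "\<And>r c. (r, c) \<in> dom T \<Longrightarrow> 1 < r \<Longrightarrow> (r - 1, c) \<in> dom T"
    "\<And>r c. (r, c) \<in> dom T \<Longrightarrow> 1 < c \<Longrightarrow> (r, c - 1) \<in> dom T"
    using T by (auto simp: is_hvt_def is_shape_def)
  have finR: "finite (R c)" for c
    using finite_subset[of "R c" "fst ` dom T"] shape(1) unfolding R_def by force
  have down: "s \<in> R c" if "r \<in> R c" "1 \<le> s" "s \<le> r" for r s c
    using that(3,1,2)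
  proof (induction rule: inc_induct)
    case (step n)
    then have "Suc n \<in> R c" by simp
    then show ?case using shape(3)[of "Suc n" c] step.prems by (simp add: R_def)
  qed
  have R1: "1 \<le> r" if "r \<in> R c" for r c using shape(2) that unfolding R_def by blast
  have Rint: "R c = {1..card (R c)}" for c
  proof (cases "R c = {}")
    case False
    have "R c = {1..Max (R c)}"
    proof (intro set_eqI iffI)
      fix s assume "s \<in> R c"
      then show "s \<in> {1..Max (R c)}" using R1[of s c] Max_ge[OF finR] by simp
    next
      fix s assume "s \<in> {1..Max (R c)}"
      then show "s \<in> R c" using down[OF Max_in[OF finR False], of s] by simp
    qed
    then obtain m where m: "R c = {1..m}" by blast
    then show ?thesis by simp
  qed simp
  have ent: "entries T (r, c) = set (fst h) \<union> set (snd h)" "xleg T (r, c) = fst h" "arm T (r, c) = snd h"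
    if "T (r, c) = Some h" for r c h using that by (simp_all add: entries_def xleg_def arm_def)
  have es: "\<exists>h. T p = Some h" if "x \<in> entries T p" for x p
    using that by (cases "T p") (auto simp: entries_def xleg_def arm_def)
  have hook: "is_hook h" if "T p = Some h" for p h using T that unfolding is_hvt_def by blast
  have hk_in: "g c r \<in> set (xleg T (r, c))" "\<And>x. x \<in> entries T (r, c) \<Longrightarrow> g c r \<le> x" if "r \<in> R c" for r c
  proof -
    obtain h where h: "T (r, c) = Some h" using \<open>r \<in> R c\<close> by (auto simp: R_def)
    then have ih: "is_hook h" using hook by blast
    then obtain y ys where f: "fst h = y # ys" unfolding is_hook_def by (metis list.exhaust)
    show "g c r \<in> set (xleg T (r, c))" using h f by (simp add: g_def ent)
    show "g c r \<le> x" if "x \<in> entries T (r, c)" for x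
      using that ih f unfolding ent(1)[OF h] g_def ent(2)[OF h] is_hook_def by auto
  qed
  have col: "x < y" if xy: "x \<in> entries T (r, c)" "y \<in> entries T (r', c)" "r < r'" for x y r r' c
  proof -
    obtain A B where AB: "T (r, c) = Some A" "T (r', c) = Some B"
      using es[OF xy(1)] es[OF xy(2)] by blast
    have "hmax A < hmin B" using T AB xy(3) unfolding is_hvt_def by blast
    moreover have "x \<le> hmax A" "hmin B \<le> y"
      using xy(1,2) AB by (auto simp: hmax_def hmin_def ent intro!: Max_ge Min_le)
    ultimately show ?thesis by simp
  qed
  have rowle: "x \<le> y" if xy: "x \<in> entries T (r, c)" "y \<in> entries T (r, Suc c)" for x y r c
  proof -
    obtain A B where AB: "T (r, c) = Some A" "T (r, Suc c) = Some B"
      using es[OF xy(1)] es[OF xy(2)] by blast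
    have "hmax A \<le> hmin B" using T AB unfolding is_hvt_def by blast
    moreover have "x \<le> hmax A" "hmin B \<le> y"
      using xy(1,2) AB by (auto simp: hmax_def hmin_def ent intro!: Max_ge Min_le)
    ultimately show ?thesis by simp
  qed
  have inR: "r \<in> R c" if "x \<in> entries T (r, c)" for x r c
    using es[OF that] by (auto simp: R_def)
  have gent: "g c r \<in> entries T (r, c)" if "r \<in> R c" for r c
    using hk_in(1)[OF that] by (simp add: entries_def)
  have gmono: "g c r < g c r'" if "r \<in> R c" "r' \<in> R c" "r < r'" for r r' c
    using col[OF gent gent] that by blast
  have inj: "inj_on (g c) (R c)" for c
    by (rule inj_onI) (metis gmono less_irrefl linorder_neqE_nat)
  have below_eq: "{h \<in> g c ` R c. h < Suc x} = g c ` {1..r}" if "x \<in> entries T (r, c)" for x r c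
  proof -
    have r: "r \<in> R c" using inR[OF that] .
    have "g c s \<le> x \<longleftrightarrow> s \<le> r" if s: "s \<in> R c" for s
    proof (cases "s \<le> r")
      case True
      then have "g c s \<le> g c r" using gmono[OF s r] by (cases "s = r") auto
      then show ?thesis using hk_in(2)[OF r \<open>x \<in> entries T (r, c)\<close>] True by simp
    next
      case False
      then show ?thesis using col[OF \<open>x \<in> entries T (r, c)\<close> gent[OF s]] by simp
    qed
    moreover have "s \<in> R c" if "1 \<le> s" "s \<le> r" for s using down[OF r that] .
    moreover have "1 \<le> s" if "s \<in> R c" for s using that Rint[of c] by auto
    ultimately show ?thesis by (auto simp: less_Suc_eq_le)
  qed
  have row: "row (C c) x = r" if "x \<in> entries T (r, c)" for x r c
  proof -
    have "{1..r} \<subseteq> R c" using down[OF inR[OF that]] by auto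
    then have "card (g c ` {1..r}) = r" using inj_on_subset[OF inj] by (subst card_image) auto
    then show ?thesis unfolding C_def below_def column.sel below_eq[OF that] .
  qed
  have amc: "x \<in># am (C c) \<longleftrightarrow> (\<exists>r\<in>R c. x \<in> set (arm T (r, c)))" for x c
    using finR by (simp add: C_def set_mset_sum)
  have ents: "x \<in> ents (C c) \<longleftrightarrow> (\<exists>r\<in>R c. x \<in> entries T (r, c))" for x c
    unfolding ents_def Un_iff amc by (auto simp: C_def entries_def)
  have cardR: "card (hk (C c)) = card (R c)" for c using inj by (simp add: C_def card_image)
  have "valid C"
    unfolding valid_def
  proof (intro conjI allI impI)
    show "hk (C 0) = {}" using shape(2)[of _ 0] by (auto simp: C_def R_def)
    obtain n where n: "\<forall>p \<in> dom T. snd p \<le> n" using shape(1) finite_nat_set_iff_bounded_le[of "snd ` dom T"] by auto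
    show "\<exists>n. \<forall>c>n. hk (C c) = {}" using n by (intro exI[of _ n]) (force simp: C_def R_def)
    show "wfcol (C c)" for c
    proof -
      have "hk (C c) \<subseteq> lg (C c)" using hk_in(1) by (auto simp: C_def)
      moreover have "finite (lg (C c))" using finR by (simp add: C_def)
      moreover have "x > 0" if xe: "x \<in> entries T (r, c)" for x r
      proof -
        obtain h where h: "T (r, c) = Some h" using es[OF xe] by blast
        then show ?thesis using hook[OF h] xe by (auto simp: is_hook_def ent)
      qed
      ultimately show ?thesis unfolding wfcol_def ents by blast
    qed
    show "card (hk (C (Suc c))) \<le> card (hk (C c))" if "1 \<le> c" for c
      unfolding cardR using shape(4)[of _ "Suc c"] that finR by (intro card_mono) (auto simp: R_def)
    show "adj (C c) (C (Suc c))" for c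
      unfolding adj_def
    proof
      fix x assume "x \<in> ents (C c)"
      then obtain r where r: "r \<in> R c" "x \<in> entries T (r, c)" unfolding ents by blast
      \<comment> \<open>A hook entry below \<open>x\<close> in row \<open>r\<close> or higher of the
        next column would force the one in row \<open>r\<close> below \<open>x\<close>, against the
        row condition.\<close>
      have "s < r" if s: "s \<in> R (Suc c)" "g (Suc c) s < x" for s
      proof (rule ccontr)
        assume n: "\<not> s < r"
        have r1: "1 \<le> r" using r(1) Rint[of c] by auto
        then have rs: "r \<in> R (Suc c)" using down[OF s(1), of r] n by simp
        have "g (Suc c) r \<le> g (Suc c) s" using gmono[OF rs s(1)] n by (cases "r = s") auto
        moreover have "x \<le> g (Suc c) r" using rowle[OF r(2) gent[OF rs]] .
        ultimately show False using s(2) by simp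
      qed
      moreover have "1 \<le> s" if "s \<in> R (Suc c)" for s using that Rint[of "Suc c"] by auto
      ultimately have "{h \<in> g (Suc c) ` R (Suc c). h < x} \<subseteq> g (Suc c) ` {1..<r}" by auto
      then have "card {h \<in> g (Suc c) ` R (Suc c). h < x} \<le> card (g (Suc c) ` {1..<r})"
        by (intro card_mono) auto
      also have "\<dots> \<le> card {1..<r}" by (rule card_image_le) simp
      finally have "card {h \<in> g (Suc c) ` R (Suc c). h < x} \<le> card {1..<r}" .
      then have "below (hk (C (Suc c))) x \<le> r - 1" by (simp add: below_def C_def)
      moreover have "1 \<le> r" using r(1) Rint[of c] by auto
      ultimately show "below (hk (C (Suc c))) x < row (C c) x" unfolding row[OF r(2)] by simp
    qed
  qed
  moreover have "T = conc C"
  proof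
    fix p :: "nat \<times> nat"
    obtain r c where p: "p = (r, c)" by (cases p)
    show "T p = conc C p"
    proof (cases "T p")
      case None
      then have "r \<notin> R c" by (auto simp: p R_def)
      then have "\<not> (1 \<le> r \<and> r \<le> card (hk (C c)))" unfolding cardR using Rint[of c] by auto
      then show ?thesis using None by (auto simp: p conc_def)
    next
      case (Some h)
      have rR: "r \<in> R c" using Some by (auto simp: p R_def)
      have ih: "is_hook h" using hook Some by blast
      have e: "fst h = xleg T (r, c)" "snd h = arm T (r, c)" using ent Some p by auto
      have "cell_leg (C c) r = fst h"
        unfolding cell_leg_def
      proof (rule sorted_distinct_set_unique)
        show "sorted (fst h)" "distinct (fst h)"
          using ih strict_sorted_iff unfolding is_hook_def by blast+
        have f: "finite {x \<in> lg (C c). row (C c) x = r}" using finR by (simp add: C_def)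
        have "{x \<in> lg (C c). row (C c) x = r} = set (xleg T (r, c))"
        proof (intro set_eqI iffI)
          fix x assume "x \<in> {x \<in> lg (C c). row (C c) x = r}"
          then obtain s where s: "s \<in> R c" "x \<in> set (xleg T (s, c))" "row (C c) x = r" by (auto simp: C_def)
          then have "s = r" using row[of x s c] by (simp add: entries_def)
          then show "x \<in> set (xleg T (r, c))" using s by simp
        next
          fix x assume x: "x \<in> set (xleg T (r, c))"
          then show "x \<in> {x \<in> lg (C c). row (C c) x = r}" using row[of x r c] rR by (auto simp: entries_def C_def)
        qed
        then show "set (sorted_list_of_set {x \<in> lg (C c). row (C c) x = r}) = set (fst h)" using f e by simp
      qed auto
      moreover have "cell_arm (C c) r = snd h"
        unfolding cell_arm_def
      proof (rule sorted_list_of_multiset_eqI)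
        show "sorted (snd h)" using ih by (simp add: is_hook_def)
        show "mset (snd h) = {#x \<in># am (C c). row (C c) x = r#}"
        proof (rule multiset_eqI)
          fix x
          have z: "x \<notin> set (arm T (s, c))" if "row (C c) x \<noteq> s" for s
            using row[of x s c] that by (auto simp: entries_def)
          have "count (am (C c)) x = (\<Sum>s\<in>R c. count (mset (arm T (s, c))) x)" by (simp add: C_def count_sum)
          moreover have "(\<Sum>s\<in>R c. count (mset (arm T (s, c))) x) = count (mset (arm T (r, c))) x" if "row (C c) x = r"
            using z that rR finR by (subst sum.remove[of _ r]) (auto simp: count_mset_0_iff intro!: sum.neutral)
          ultimately show "count (mset (snd h)) x = count {#x \<in># am (C c). row (C c) x = r#} x"
            using z[of r] e by (auto simp: count_mset_0_iff)
        qed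
      qed
      moreover have "1 \<le> r \<and> r \<le> card (hk (C c))" unfolding cardR using Rint[of c] rR by auto
      ultimately show ?thesis using Some by (simp add: p conc_def)
    qed
  qed
  ultimately show ?thesis by blast
qed

section \<open>Iterating the commutation of a single step\<close>

lemma e_op_conc_D:
  assumes v: "valid C" and "e_op i (conc C) = Some T'"
  shows "\<exists>d. esel i C d \<and> T' = conc (e_move i d C)"
proof -
  have "filter snd (unpaired i (conc C)) \<noteq> []"
    using assms(2) by (auto simp: e_op_def Let_def)
  then obtain d where "esel i C d" using first_unpaired_plus[OF v] by blast
  then show ?thesis using e_op_conc[OF v] assms(2) by auto
qed

text \<open>The relation between a tableau and its image under \<open>f_i\<close>, stated through a
  valid column model so that validity travels along with each step.\<close>

definition linked :: "nat \<Rightarrow> hvt \<Rightarrow> hvt \<Rightarrow> bool" where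
  "linked i T T' \<longleftrightarrow> (\<exists>C d. valid C \<and> fsel i C d \<and> T = conc C \<and> T' = conc (f_move i d C))"

lemma bsel_exists: assumes "valid C" "arm_excess (conc C) \<noteq> 0" shows "\<exists>c a. bsel C c a"
proof -
  let ?A = "{c. am (C c) \<noteq> {#}}"
  have f: "finite ?A" by (rule finite_am[OF assms(1)])
  define c where "c = Max ?A"
  define a where "a = Max (set_mset (am (C c)))"
  have "?A \<noteq> {}" using assms unfolding arm_excess_conc[OF assms(1)] by (metis sum.empty)
  then have "c \<in> ?A" using f Max_in unfolding c_def by blast
  then have "a \<in># am (C c)" unfolding a_def by (intro Max_in) auto
  moreover have "\<forall>x \<in># am (C c). x \<le> a" unfolding a_def by simp
  moreover have "\<forall>e>c. am (C e) = {#}" using Max_ge[OF f] unfolding c_def by fastforce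
  ultimately show ?thesis unfolding bsel_def by blast
qed

lemma size_am_f_move: "size (am (f_move i d C e)) = size (am (C e))"
  by (auto simp: f_move_eq f_left_def f_right_def size_Diff_singleton)
    (metis One_nat_def Suc_pred nonempty_has_size empty_iff set_mset_empty)

lemma card_hk_f_move: assumes "valid C" "fsel i C d" shows "card (hk (f_move i d C e)) = card (hk (C e))"
proof -
  note w = wfcolD[OF validD(1)[OF assms(1)]]
  have "card (hk (f_left i (C d) (C (Suc d)))) = card (hk (C d))"
  proof (cases "spill i (C d) (C (Suc d)) \<or> i \<in># am (C d)")
    case True then show ?thesis by (auto simp: f_left_def)
  next
    case False
    then have "Suc i \<notin> lg (C d)"
      using fsel_um(1)[OF assms(2)] by (auto simp: um_def not_in_iff of_bool_def split: if_splits)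
    then have "Suc i \<notin> hk (C d)" using w(3) by blast
    then show ?thesis using False card_swap[OF w(2)] by (auto simp: f_left_def)
  qed
  moreover have "card (hk (f_right i (C d) (C (Suc d)))) = card (hk (C (Suc d)))"
    using card_swap[OF w(2), of i "Suc d" "Suc i"] spill_facts(5)[OF assms]
    by (auto simp: f_right_def spill_def)
  ultimately show ?thesis by (simp add: f_move_eq)
qed

text \<open>Together with the fixed points of \<open>Vb\<close>, these data determine the stopping
  times, the number of insertions and the recorded entries.\<close>

lemma linked_same:
  assumes "linked i T T'"
  shows "dom T = dom T'" "arm_cols T = arm_cols T'" "arm_excess T = arm_excess T'"
proof -
  obtain C d where C: "valid C" "fsel i C d" "T = conc C" "T' = conc (f_move i d C)"
    using assms by (auto simp: linked_def)
  have v: "valid (f_move i d C)" by (rule valid_f_move[OF C(1,2)])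
  have e: "am (f_move i d C c) = {#} \<longleftrightarrow> am (C c) = {#}" for c
    using size_am_f_move[of i d C c] by (metis size_eq_0_iff_empty)
  show "dom T = dom T'" unfolding C(3,4) dom_conc card_hk_f_move[OF C(1,2)] ..
  show "arm_cols T = arm_cols T'" unfolding C(3,4) arm_cols_conc[OF C(1)] arm_cols_conc[OF v] e ..
  show "arm_excess T = arm_excess T'"
    unfolding C(3,4) arm_excess_conc[OF C(1)] arm_excess_conc[OF v] e size_am_f_move ..
qed

lemma linked_Vb: assumes "linked i T T'" shows "linked i (Vb T) (Vb T')"
proof (cases "arm_excess T = 0")
  case True
  then show ?thesis using assms linked_same(3)[OF assms] by (simp add: Vb_def)
next
  case False
  obtain C d where C: "valid C" "fsel i C d" "T = conc C" "T' = conc (f_move i d C)"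
    using assms by (auto simp: linked_def)
  obtain c a where b: "bsel C c a" using bsel_exists[OF C(1)] False C(3) by blast
  interpret bumping C c a by unfold_locales (fact C(1), fact b)
  obtain a' d' where a': "bsel (f_move i d C) c a'" "fsel i (bump c a C) d'"
      "f_move i d' (bump c a C) = bump c a' (f_move i d C)"
    using commutes_all[OF C(2)] unfolding commutes_def by blast
  interpret F: bumping "f_move i d C" c a' by unfold_locales (fact valid_f_move[OF C(1,2)], fact a'(1))
  show ?thesis
    unfolding linked_def C(3,4) Vb_conc F.Vb_conc using valid_bump a'(2,3) by metis
qed

text \<open>A genuine bumping step removes \<open>a\<close> from the arm of its cell and cannot fix
  the tableau. Fixed points are thus recognised by the arm excess, which linked tableaux
  share.\<close>

lemma Vb_fixed: assumes "valid C" shows "Vb (conc C) = conc C \<longleftrightarrow> arm_excess (conc C) = 0"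
proof
  assume eq: "Vb (conc C) = conc C"
  show "arm_excess (conc C) = 0"
  proof (rule ccontr)
    assume "arm_excess (conc C) \<noteq> 0"
    then obtain c a where b: "bsel C c a" using bsel_exists[OF assms] by blast
    interpret bumping C c a by unfold_locales (fact assms, fact b)
    have "arm (conc B) (r, c) = arm (conc C) (r, c)" using eq Vb_conc by simp
    then have "remove1 a (cell_arm K r) = cell_arm K r"
      unfolding arm_conc[OF valid_bump] arm_conc[OF assms] by (simp add: bump_def cell_arm_src)
    moreover have "a \<in> set (cell_arm K r)" using a_in by (simp add: set_cell_arm)
    ultimately show False using length_remove1[of a "cell_arm K r"] by (cases "cell_arm K r") auto
  qed
qed (simp add: Vb_def)

text \<open>Linked tableaux change shape at the same steps and become fixed at the same steps, so
  \<open>LEAST\<close> selects the same number of bumps for both.\<close>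

lemma linked_V: assumes "linked i T T'" shows "linked i (V T) (V T')"
proof -
  have l: "linked i ((Vb ^^ d) T) ((Vb ^^ d) T')" for d
    by (induction d) (auto simp: assms linked_Vb)
  have fx: "Vb X = X \<longleftrightarrow> Vb X' = X'" if lx: "linked i X X'" for X X'
  proof -
    obtain C d where C: "valid C" "fsel i C d" "X = conc C" "X' = conc (f_move i d C)"
      using lx by (auto simp: linked_def)
    show ?thesis
      using Vb_fixed[OF C(1)] Vb_fixed[OF valid_f_move[OF C(1,2)]] linked_same(3)[OF lx] C by simp
  qed
  have "(1 \<le> d \<and> (dom ((Vb ^^ d) T) \<noteq> dom ((Vb ^^ (d - 1)) T) \<or> (Vb ^^ d) T = (Vb ^^ (d - 1)) T))
      \<longleftrightarrow> (1 \<le> d \<and> (dom ((Vb ^^ d) T') \<noteq> dom ((Vb ^^ (d - 1)) T') \<or> (Vb ^^ d) T' = (Vb ^^ (d - 1)) T'))" for d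
  proof (cases d)
    case (Suc n)
    then show ?thesis using linked_same(1)[OF l[of d]] linked_same(1)[OF l[of n]] fx[OF l[of n]] by simp
  qed simp
  then show ?thesis unfolding V_def using l by presburger
qed

lemma linked_uncrowd:
  assumes "linked i T T'"
  shows "linked i (Ptab T) (Ptab T')" "Qtab T = Qtab T'"
proof -
  have "linked i (fst ((uncrowd_step ^^ n) (T, Q))) (fst ((uncrowd_step ^^ n) (T', Q))) \<and>
      snd ((uncrowd_step ^^ n) (T, Q)) = snd ((uncrowd_step ^^ n) (T', Q))" for n Q
  proof (induction n)
    case (Suc n)
    obtain P Q1 P' Q2 where e: "(uncrowd_step ^^ n) (T, Q) = (P, Q1)" "(uncrowd_step ^^ n) (T', Q) = (P', Q2)"
      by (metis surj_pair)
    then have l: "linked i P P'" "Q1 = Q2" using Suc by auto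
    have "dom P = dom P'" "dom (V P) = dom (V P')" "arm_cols P = arm_cols P'"
      using linked_same[OF l(1)] linked_same[OF linked_V[OF l(1)]] by auto
    moreover have "uncrowd_step (X, Y) = (V X, Y((THE x. x \<in> dom (V X) - dom X) :=
        Some (int (snd (THE x. x \<in> dom (V X) - dom X)) - int (Max (arm_cols X)))))" for X Y
      by (simp add: uncrowd_step_def Let_def)
    ultimately show ?case using l(2) linked_V[OF l(1)] unfolding funpow.simps comp_apply e by simp
  qed (simp add: assms)
  then show "linked i (Ptab T) (Ptab T')" "Qtab T = Qtab T'"
    unfolding Ptab_def Qtab_def uncrowd_def linked_same(3)[OF assms] by auto
qed

theorem theorem3p14:
  fixes T :: hvt and i :: nat
  assumes "is_hvt T" and "1 \<le> i"
  shows "(\<forall>T'. f_op i T = Some T' \<longrightarrow> f_op i (Ptab T) = Some (Ptab T') \<and> Qtab T = Qtab T')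
       \<and> (\<forall>T'. e_op i T = Some T' \<longrightarrow> e_op i (Ptab T) = Some (Ptab T') \<and> Qtab T = Qtab T')"
proof (intro conjI allI impI)
  obtain C where C: "valid C" "T = conc C" using hvt_conc[OF assms(1)] by blast
  {
    fix T' assume "f_op i T = Some T'"
    then have "linked i T T'" using f_op_conc_D[OF C(1)] C unfolding linked_def by blast
    note l = linked_uncrowd[OF this]
    show "f_op i (Ptab T) = Some (Ptab T')" using l(1) f_op_conc by (auto simp: linked_def)
    show "Qtab T = Qtab T'" by (fact l(2))
  next
    fix T' assume "e_op i T = Some T'"
    then obtain d where d: "esel i C d" "T' = conc (e_move i d C)" using e_op_conc_D[OF C(1)] C(2) by blast
    \<comment> \<open>As \<open>f_i\<close> inverts \<open>e_i\<close>, the tableau \<open>T\<close>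
      is the image of \<open>T'\<close> under \<open>f_i\<close>. The result for \<open>f_i\<close>
      applies with exchanged roles, and \<open>e_i\<close> then takes the insertion tableau of
      \<open>T\<close> back to that of \<open>T'\<close>.\<close>
    then have "linked i T' T"
      using f_move_e_move[OF C(1) d(1) assms(2)] C(2) unfolding linked_def by metis
    note l = linked_uncrowd[OF this]
    show "Qtab T = Qtab T'" using l(2) by simp
    obtain D e where D: "valid D" "fsel i D e" "Ptab T' = conc D" "Ptab T = conc (f_move i e D)"
      using l(1) by (auto simp: linked_def)
    obtain e' where "esel i (f_move i e D) e'" "e_move i e' (f_move i e D) = D" using e_move_f_move[OF D(1,2)] by blast
    then show "e_op i (Ptab T) = Some (Ptab T')"
      unfolding D(3,4) using e_op_conc[OF valid_f_move[OF D(1,2)]] by simp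
  }
qed

end
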